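(* Let $n\ge2$, let $\Omega$ be an open set in $\mathbb R^n$ with $|\Omega|<\infty$, and let $\varphi$ be a generalized Young function on $\mathbb R^n$ satisfying conditions (A0) and (A1) (written out in the context). Let $\varphi_{n,\diamond}$ be the Sobolev conjugate of $\varphi$ on domains of finite measure defined in the context. Then $V^{1,\varphi(\cdot)}_0(\Omega)$ is continuously embedded into $L^{\varphi_{n,\diamond}(\cdot)}(\Omega)$, and there exists a constant $c=c(\beta,n,|\Omega|)$ such that $$\|u\|_{L^{\varphi_{n,\diamond}(\cdot)}(\Omega)}\le c\,\|\nabla u\|_{L^{\varphi(\cdot)}(\Omega)}$$ for every $u\in V^{1,\varphi(\cdot)}_0(\Omega)$. Here $\beta$ denotes the constant appearing in conditions (A0) and (A1).
   Context: A Young function is a function $A:[0,\infty)\to[0,\infty]$ that is convex, continuous, non-constant and satisfies $A(0)=0$. A generalized Young function is a function $\varphi:\mathbb R^n\times[0,\infty)\to[0,\infty]$ such that $\varphi(x,\cdot)$ is a Young function for a.e. $x$ and $\varphi(\cdot,t)$ is measurable for every $t\ge0$. Its left-continuous inverse is $\varphi^{-1}(x,t)=\inf\{\tau\ge0:\varphi(x,\tau)\ge t\}$. $|E|$ denotes Lebesgue measure. For a measurable set $\Omega\subset\mathbb R^n$, $L^{\varphi(\cdot)}(\Omega)$ is the space of measurable $u$ on $\Omega$ with $\int_\Omega\varphi(x,|u(x)|/\lambda)\,dx<\infty$ for some $\lambda>0$, with norm $\|u\|_{L^{\varphi(\cdot)}(\Omega)}=\inf\{\lambda>0:\int_\Omega\varphi(x,|u(x)|/\lambda)\,dx\le1\}$.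 Conditions: (A0) there is $\beta\in(0,1]$ with $\beta\le\varphi^{-1}(x,1)\le 1/\beta$ for a.e. $x\in\mathbb R^n$. (A1) there is $\beta\in(0,1]$ with $\beta\varphi^{-1}(x,t)\le\varphi^{-1}(y,t)$ for every $t\in[1,1/|B|]$, for a.e. $x,y\in B$, and every ball $B\subset\mathbb R^n$ with $|B|\le1$. The function $\widehat\varphi$: put $\varphi_0(x,t)=\max\{\varphi(x,\varphi^{-1}(x,1)t),\,2t-1\}$ and $$\widehat\varphi(x,t)=\begin{cases}2\varphi_0(x,t)-1& t\ge1,\\ t&0\le t<1.\end{cases}$$ Sobolev conjugate on domains of finite measure: $\varphi_{n,\diamond}(x,t)=\widehat\varphi(x,H_{n,\diamond}^{-1}(x,t))$, where $$H_{n,\diamond}(x,t)=\Big(\int_0^t\Big(\frac{\tau}{\widehat\varphi(x,\tau)}\Big)^{\frac1{n-1}}d\tau\Big)^{\frac1{n'}},\qquad n'=\frac n{n-1},$$ and $H_{n,\diamond}^{-1}(x,\cdot)$ is the generalized left-continuous inverse; when $t>\lim_{s\to\infty}H_{n,\diamond}(x,s)$ one sets $H_{n,\diamond}^{-1}(x,t)=\infty$ and $\varphi_{n,\diamond}(x,t)=\infty$. Sobolev spaces: for open $\Omega$, $V^{1,\varphi(\cdot)}(\Omega)=\{u\in W^{1,1}_{\rm loc}(\Omega):|\nabla u|\in L^{\varphi(\cdot)}(\Omega)\}$; $V^{1,\varphi(\cdot)}_0(\Omega)$ is the set of $u\in W^{1,1}_{\rm loc}(\Omega)$ whose extension by $0$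 outside $\Omega$ belongs to $V^{1,\varphi(\cdot)}(\mathbb R^n)$, normed by $\|\nabla u\|_{L^{\varphi(\cdot)}(\Omega)}$. *)

theory Defs
  imports "HOL-Analysis.Analysis"
begin

section \<open>Generalized Young functions\<close>

text \<open>Functions on \<open>[0,\<infinity>)\<close> are represented by functions on \<open>real\<close>; their values at negative
  arguments are never used. Convexity is spelled out because the library's \<^const>\<open>convex_on\<close> is
  confined to real-valued functions. Continuity refers to the topology of \<open>[0,\<infinity>]\<close>.\<close>

definition young_function :: "(real \<Rightarrow> ennreal) \<Rightarrow> bool" where
  "young_function A \<longleftrightarrow>
     (\<forall>s\<ge>0. \<forall>t\<ge>0. \<forall>l\<in>{0..1}.
        A ((1 - l) * s + l * t) \<le> ennreal (1 - l) * A s + ennreal l * A t) \<and>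
     continuous_on {0..} A \<and>
     (\<exists>s\<ge>0. \<exists>t\<ge>0. A s \<noteq> A t) \<and>
     A 0 = 0"

definition generalized_young_function :: "(real^'n \<Rightarrow> real \<Rightarrow> ennreal) \<Rightarrow> bool" where
  "generalized_young_function \<phi> \<longleftrightarrow>
     (AE x in lebesgue. young_function (\<phi> x)) \<and>
     (\<forall>t\<ge>0. (\<lambda>x. \<phi> x t) \<in> borel_measurable lebesgue)"

text \<open>The infimum is taken in \<^typ>\<open>ennreal\<close>, so that it is \<open>\<infinity>\<close> if the level \<open>t\<close> is never reached.\<close>

definition left_inverse :: "(real \<Rightarrow> ennreal) \<Rightarrow> real \<Rightarrow> ennreal" where
  "left_inverse A t = Inf {ennreal \<tau> |\<tau>. 0 \<le> \<tau> \<and> ennreal t \<le> A \<tau>}"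

definition cond_A0 :: "real \<Rightarrow> (real^'n \<Rightarrow> real \<Rightarrow> ennreal) \<Rightarrow> bool" where
  "cond_A0 \<beta> \<phi> \<longleftrightarrow>
     (AE x in lebesgue. ennreal \<beta> \<le> left_inverse (\<phi> x) 1 \<and>
                        left_inverse (\<phi> x) 1 \<le> ennreal (1 / \<beta>))"

definition cond_A1 :: "real \<Rightarrow> (real^'n \<Rightarrow> real \<Rightarrow> ennreal) \<Rightarrow> bool" where
  "cond_A1 \<beta> \<phi> \<longleftrightarrow>
     (\<forall>z r. 0 < r \<and> measure lebesgue (ball z r) \<le> 1 \<longrightarrow>
        (AE x in lebesgue_on (ball z r). AE y in lebesgue_on (ball z r).
           \<forall>t\<in>{1..1 / measure lebesgue (ball z r)}.
             ennreal \<beta> * left_inverse (\<phi> x) t \<le> left_inverse (\<phi> y) t))"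


section \<open>Musielak-Orlicz spaces\<close>

definition modular :: "(real^'n \<Rightarrow> real \<Rightarrow> ennreal) \<Rightarrow> (real^'n) set \<Rightarrow> (real^'n \<Rightarrow> real) \<Rightarrow> ennreal"
  where "modular \<phi> \<Omega> u = (\<integral>\<^sup>+x. \<phi> x \<bar>u x\<bar> \<partial>lebesgue_on \<Omega>)"

definition L_space :: "(real^'n \<Rightarrow> real \<Rightarrow> ennreal) \<Rightarrow> (real^'n) set \<Rightarrow> (real^'n \<Rightarrow> real) set" where
  "L_space \<phi> \<Omega> = {u \<in> borel_measurable (lebesgue_on \<Omega>).
                      \<exists>k>0. modular \<phi> \<Omega> (\<lambda>x. u x / k) < \<infinity>}"

text \<open>Valued in \<^typ>\<open>ennreal\<close>: an infimum over the empty set is \<open>\<infinity>\<close>, rather than an unspecified real.\<close>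

definition L_norm :: "(real^'n \<Rightarrow> real \<Rightarrow> ennreal) \<Rightarrow> (real^'n) set \<Rightarrow> (real^'n \<Rightarrow> real) \<Rightarrow> ennreal"
  where "L_norm \<phi> \<Omega> u = Inf {ennreal k |k. 0 < k \<and> modular \<phi> \<Omega> (\<lambda>x. u x / k) \<le> 1}"


section \<open>The Sobolev conjugate on domains of finite measure\<close>

text \<open>For almost every \<open>x\<close>, \<open>left_inverse (\<phi> x) 1\<close> is finite and \<^const>\<open>enn2real\<close> just changes its type.
  The truncation of \<open>2 * t - 1\<close> at \<open>0\<close> by \<^const>\<open>ennreal\<close> does not affect the maximum with a
  nonnegative quantity.\<close>

definition phi0 :: "(real^'n \<Rightarrow> real \<Rightarrow> ennreal) \<Rightarrow> real^'n \<Rightarrow> real \<Rightarrow> ennreal" where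
  "phi0 \<phi> x t = max (\<phi> x (enn2real (left_inverse (\<phi> x) 1) * t)) (ennreal (2 * t - 1))"

text \<open>For \<open>t \<ge> 1\<close> one has \<open>phi0 \<phi> x t \<ge> 1\<close>, so the subtraction is not truncated.\<close>

definition phi_hat :: "(real^'n \<Rightarrow> real \<Rightarrow> ennreal) \<Rightarrow> real^'n \<Rightarrow> real \<Rightarrow> ennreal" where
  "phi_hat \<phi> x t = (if 1 \<le> t then 2 * phi0 \<phi> x t - 1 else ennreal t)"

text \<open>Powers with positive exponent on \<open>[0,\<infinity>]\<close>.\<close>

definition ennpowr :: "ennreal \<Rightarrow> real \<Rightarrow> ennreal" where
  "ennpowr a p = (if a = \<infinity> then \<infinity> else ennreal (enn2real a powr p))"

text \<open>Here \<open>1 / n' = (n - 1) / n\<close>. Division in \<^typ>\<open>ennreal\<close> gives \<open>\<tau> / \<infinity> = 0\<close>.\<close>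

definition H_diamond :: "(real^'n \<Rightarrow> real \<Rightarrow> ennreal) \<Rightarrow> real^'n \<Rightarrow> real \<Rightarrow> ennreal" where
  "H_diamond \<phi> x t =
     (let n = real CARD('n); n' = n / (n - 1) in
      ennpowr (\<integral>\<^sup>+\<tau>\<in>{0..t}. ennpowr (ennreal \<tau> / phi_hat \<phi> x \<tau>) (1 / (n - 1)) \<partial>lborel)
              (1 / n'))"

text \<open>If \<open>t\<close> exceeds \<open>lim\<^bsub>s\<rightarrow>\<infinity>\<^esub> H_diamond \<phi> x s\<close>, then the left inverse is an infimum over the
  empty set, i.e. \<open>\<infinity>\<close>, and the conjugate is \<open>\<infinity>\<close>. The same happens if \<open>t\<close> equals a limit that is
  not attained, in accordance with \<open>phi_hat \<phi> x s \<rightarrow> \<infinity>\<close> as \<open>s \<rightarrow> \<infinity>\<close>.\<close>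

definition sobolev_conjugate :: "(real^'n \<Rightarrow> real \<Rightarrow> ennreal) \<Rightarrow> real^'n \<Rightarrow> real \<Rightarrow> ennreal" where
  "sobolev_conjugate \<phi> x t =
     (let s = left_inverse (H_diamond \<phi> x) t in
      if s = \<infinity> then \<infinity> else phi_hat \<phi> x (enn2real s))"


section \<open>Sobolev spaces\<close>

definition partial_deriv :: "'n \<Rightarrow> (real^'n \<Rightarrow> real) \<Rightarrow> real^'n \<Rightarrow> real" where
  "partial_deriv i f x = frechet_derivative f (at x) (axis i 1)"

fun diff_times :: "nat \<Rightarrow> (real^'n \<Rightarrow> real) \<Rightarrow> bool" where
  "diff_times 0 f \<longleftrightarrow> True"
| "diff_times (Suc k) f \<longleftrightarrow>
     (\<forall>x. f differentiable (at x)) \<and> (\<forall>i. diff_times k (partial_deriv i f))"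

text \<open>Being differentiable arbitrarily often is the same as being \<open>C\<^sup>\<infinity>\<close>, since every derivative is
  itself differentiable and hence continuous.\<close>

definition test_function :: "(real^'n) set \<Rightarrow> (real^'n \<Rightarrow> real) \<Rightarrow> bool" where
  "test_function \<Omega> \<psi> \<longleftrightarrow>
     (\<forall>k. diff_times k \<psi>) \<and> compact (closure {x. \<psi> x \<noteq> 0}) \<and> closure {x. \<psi> x \<noteq> 0} \<subseteq> \<Omega>"

definition L1_loc :: "(real^'n) set \<Rightarrow> (real^'n \<Rightarrow> 'b::euclidean_space) \<Rightarrow> bool" where
  "L1_loc \<Omega> f \<longleftrightarrow> (\<forall>K. compact K \<and> K \<subseteq> \<Omega> \<longrightarrow> f absolutely_integrable_on K)"

definition has_weak_gradient ::
    "(real^'n) set \<Rightarrow> (real^'n \<Rightarrow> real) \<Rightarrow> (real^'n \<Rightarrow> real^'n) \<Rightarrow> bool" where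
  "has_weak_gradient \<Omega> u g \<longleftrightarrow>
     L1_loc \<Omega> g \<and>
     (\<forall>\<psi> i. test_function \<Omega> \<psi> \<longrightarrow>
        (LINT x:\<Omega>|lebesgue. u x * partial_deriv i \<psi> x) = - (LINT x:\<Omega>|lebesgue. (g x $ i) * \<psi> x))"

definition W11_loc :: "(real^'n) set \<Rightarrow> (real^'n \<Rightarrow> real) set" where
  "W11_loc \<Omega> = {u. L1_loc \<Omega> u \<and> (\<exists>g. has_weak_gradient \<Omega> u g)}"

text \<open>A representative of the weak gradient, which is unique up to null subsets of \<open>\<Omega>\<close>.\<close>

definition weak_gradient :: "(real^'n) set \<Rightarrow> (real^'n \<Rightarrow> real) \<Rightarrow> real^'n \<Rightarrow> real^'n" where
  "weak_gradient \<Omega> u = (SOME g. has_weak_gradient \<Omega> u g)"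

definition V1 :: "(real^'n \<Rightarrow> real \<Rightarrow> ennreal) \<Rightarrow> (real^'n) set \<Rightarrow> (real^'n \<Rightarrow> real) set" where
  "V1 \<phi> \<Omega> = {u \<in> W11_loc \<Omega>. (\<lambda>x. norm (weak_gradient \<Omega> u x)) \<in> L_space \<phi> \<Omega>}"

text \<open>Functions on \<open>\<Omega>\<close> are total functions whose values outside \<open>\<Omega>\<close> are irrelevant.\<close>

definition V1_0 :: "(real^'n \<Rightarrow> real \<Rightarrow> ennreal) \<Rightarrow> (real^'n) set \<Rightarrow> (real^'n \<Rightarrow> real) set" where
  "V1_0 \<phi> \<Omega> = {u \<in> W11_loc \<Omega>. (\<lambda>x. if x \<in> \<Omega> then u x else 0) \<in> V1 \<phi> UNIV}"

definition V1_0_norm :: "(real^'n \<Rightarrow> real \<Rightarrow> ennreal) \<Rightarrow> (real^'n) set \<Rightarrow> (real^'n \<Rightarrow> real) \<Rightarrow> ennreal"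
  where "V1_0_norm \<phi> \<Omega> u = L_norm \<phi> \<Omega> (\<lambda>x. norm (weak_gradient \<Omega> u x))"

end

theory Submission
  imports Defs
begin

text \<open>The proof works with the Riesz potential and reduces the embedding to a weak type inequality, from
  which the strong one follows by truncation.

  A function whose gradient is locally integrable, and which vanishes outside a set of finite
  measure, satisfies \<open>T u(x) \<le> C \<integral> \<bar>T'(u)\<bar> \<bar>\<nabla>u\<bar> \<bar>x - y\<bar>\<^sup>1\<^sup>-\<^sup>n dy\<close> for almost every \<open>x\<close> and every smooth
  truncation \<open>T\<close> (\<open>weak_potential_estimate\<close>, \<open>level_potential\<close>). Hence the set where \<open>\<bar>u\<bar> \<ge> 2 a\<close> is contained
  in the set where the potential of \<open>f = \<bar>\<nabla>u\<bar>\<close>, restricted to \<open>{a < \<bar>u\<bar> < 2 a}\<close>, is at least \<open>C a\<close>.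

  Let \<open>\<Phi>\<close> be the normalized function \<open>phi_hat \<phi>\<close> and let \<open>g = \<Phi>(y, D f(y))\<close> have integral at most 1. At
  a single point \<open>x\<close> choose \<open>s\<close> with \<open>H_diamond(x, s) = t\<close>, so that \<open>\<Phi>(x, s)\<close> is the value of the conjugate
  at \<open>t\<close>. Splitting \<open>f\<close> at a height that depends on the distance \<open>\<bar>x - y\<bar>\<close>, and exactly so that the part
  below that height contributes \<open>\<integral> (\<tau> / \<Phi>(x, \<tau>))\<^sup>1\<^sup>/\<^sup>(\<^sup>n\<^sup>-\<^sup>1\<^sup>) d\<tau>\<close>, bounds the potential at \<open>x\<close> by \<open>C t\<close>, unless
  the mass of \<open>g\<close> concentrates near \<open>x\<close>: some ball \<open>B\<close> around \<open>x\<close> with \<open>\<Phi>(x, s) \<bar>B\<bar> \<le> C\<close> has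
  \<open>\<integral>\<^sub>B g \<ge> c \<Phi>(x, s) \<bar>B\<bar>\<close> (\<open>far_near_estimate\<close>). Condition (A1) says that \<open>\<Phi>(x, \<cdot>)\<close> and \<open>\<Phi>(y, \<cdot>)\<close> are
  comparable up to the level \<open>\<bar>B\<bar>\<^sup>-\<^sup>1\<close> for \<open>x, y \<in> B\<close>, which is just what is needed to compare the heights at \<open>x\<close>
  and \<open>y\<close>, and to compare the conjugates on \<open>B\<close>. A Vitali covering by such balls therefore gives
  \<open>\<integral> \<Phi>\<^sub>n(x, t / D) dx \<le> C \<integral> g\<close> over the set where the potential exceeds \<open>C t\<close> (\<open>weak_type\<close>). Applied to the dyadic
  levels \<open>a = 2\<^sup>k\<close>, whose functions \<open>f\<close> have disjoint supports, these inequalities add up to a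
  modular inequality (\<open>conjugate_modular_bound\<close>).

  The measure of the domain enters only in the passage from \<open>\<phi>\<close> to \<open>phi_hat \<phi>\<close>: the latter is at least
  linear near 0, and \<open>phi_hat \<phi> x (\<beta> t) \<le> 1 + 4 \<phi> x t\<close> (\<open>phi_hat_le\<close>), where the constant 1 has
  to be integrated over the domain.\<close>

section \<open>Smooth bump functions\<close>

text \<open>The powers in the denominator make the family closed under differentiation up to linear
  combinations.\<close>

definition flat_exp :: "nat \<Rightarrow> real \<Rightarrow> real" where
  "flat_exp m t = (if 0 < t then exp (- 1 / t) / t ^ m else 0)"

lemma flat_exp_nonneg: "0 \<le> flat_exp m t"
  by (simp add: flat_exp_def)

text \<open>The exponential beats every pole. A quadratic bound suffices to see that the derivative at 0
  vanishes.\<close>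

lemma flat_exp_le_square: "flat_exp m t \<le> real ((m + 2) ^ (m + 2)) * t\<^sup>2"
proof (cases "0 < t")
  case True
  define k where "k = m + 2"
  have k: "k > 0" by (simp add: k_def)
  have "(1 / (real k * t)) ^ k \<le> (1 + (1 / t) / real k) ^ k"
    using True k by (intro power_mono) (auto simp: field_simps)
  also have "\<dots> \<le> exp (1 / t)"
    using True k by (intro exp_ge_one_plus_x_over_n_power_n) (auto intro: order_trans[of _ 0])
  finally have "exp (- 1 / t) \<le> (real k * t) ^ k"
    using True k by (simp add: exp_minus field_simps)
  hence "exp (- 1 / t) / t ^ m \<le> (real k * t) ^ k / t ^ m"
    using True by (intro divide_right_mono) auto
  also have "\<dots> = real (k ^ k) * t\<^sup>2"
  proof -
    have "(real k * t) ^ k = real (k ^ k) * t\<^sup>2 * t ^ m"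
      unfolding power_mult_distrib of_nat_power k_def power_add by simp
    thus ?thesis using True by simp
  qed
  finally show ?thesis using True by (simp add: flat_exp_def k_def)
qed (auto simp: flat_exp_def)

lemma flat_exp_has_field_derivative:
  "(flat_exp m has_field_derivative (flat_exp (m + 2) t - real m * flat_exp (m + 1) t)) (at t)"
proof -
  consider "t > 0" | "t < 0" | "t = 0" by linarith
  thus ?thesis
  proof cases
    case 1
    have "((\<lambda>t. exp (- 1 / t) / t ^ m) has_field_derivative
            (flat_exp (m + 2) t - real m * flat_exp (m + 1) t)) (at t)"
      using 1 by (auto intro!: derivative_eq_intros simp: flat_exp_def field_simps power2_eq_square)
         (cases m; simp add: field_simps)
    moreover have "eventually (\<lambda>s. s > 0) (nhds t)"
      using 1 by (intro eventually_nhds_in_open[of "{0<..}", simplified]) auto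
    hence "eventually (\<lambda>s. exp (- 1 / s) / s ^ m = flat_exp m s) (nhds t)"
      by eventually_elim (simp add: flat_exp_def)
    ultimately show ?thesis
      using DERIV_cong_ev[of t t "\<lambda>s. exp (- 1 / s) / s ^ m" "flat_exp m"] by auto
  next
    case 2
    have "eventually (\<lambda>s. s < 0) (nhds t)"
      using 2 by (intro eventually_nhds_in_open[of "{..<0}", simplified]) auto
    hence "eventually (\<lambda>s. 0 = flat_exp m s) (nhds t)"
      by eventually_elim (simp add: flat_exp_def)
    thus ?thesis
      using DERIV_cong_ev[of t t "\<lambda>s. 0" "flat_exp m" 0 0] 2 by (simp add: flat_exp_def)
  next
    case 3
    define C where "C = real ((m + 2) ^ (m + 2))"
    have "((\<lambda>h. flat_exp m h / h) \<longlongrightarrow> 0) (at 0)"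
    proof (rule Lim_null_comparison)
      show "eventually (\<lambda>h. norm (flat_exp m h / h) \<le> C * \<bar>h\<bar>) (at 0)"
        unfolding eventually_at_filter
      proof (rule always_eventually, intro allI impI)
        fix h :: real assume "h \<noteq> 0"
        have "flat_exp m h \<le> C * \<bar>h\<bar>\<^sup>2" using flat_exp_le_square[of m h] by (simp add: C_def)
        thus "norm (flat_exp m h / h) \<le> C * \<bar>h\<bar>"
          using \<open>h \<noteq> 0\<close> flat_exp_nonneg[of m h]
          by (simp add: divide_le_eq power2_eq_square mult.assoc)
      qed
      show "((\<lambda>h. C * \<bar>h\<bar>) \<longlongrightarrow> 0) (at 0)" by (auto intro!: tendsto_eq_intros)
    qed
    thus ?thesis unfolding DERIV_def 3 by (simp add: flat_exp_def)
  qed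
qed

text \<open>All derivatives of a bump are polynomials times members of the family \<^const>\<open>flat_exp\<close>. The set
  below contains them and is closed under partial derivatives by construction, so that no formula for a
  higher derivative is needed.\<close>

inductive_set bump_algebra :: "real^'n \<Rightarrow> real \<Rightarrow> (real^'n \<Rightarrow> real) set" for a :: "real^'n" and r where
  base: "(\<lambda>y. flat_exp m (r - (norm (y - a))\<^sup>2)) \<in> bump_algebra a r"
| add: "f \<in> bump_algebra a r \<Longrightarrow> g \<in> bump_algebra a r \<Longrightarrow> (\<lambda>y. f y + g y) \<in> bump_algebra a r"
| scale: "f \<in> bump_algebra a r \<Longrightarrow> (\<lambda>y. c * f y) \<in> bump_algebra a r"
| coord: "f \<in> bump_algebra a r \<Longrightarrow> (\<lambda>y. y $ i * f y) \<in> bump_algebra a r"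

lemma partial_deriv_eqI: "(f has_derivative f') (at x) \<Longrightarrow> partial_deriv i f x = f' (axis i 1)"
  unfolding partial_deriv_def by (metis frechet_derivative_at)

lemma flat_exp_norm_has_derivative:
  fixes a x :: "real^'n"
  shows "((\<lambda>y. flat_exp m (r - (norm (y - a))\<^sup>2)) has_derivative
     (\<lambda>h. - 2 * (flat_exp (m + 2) (r - (norm (x - a))\<^sup>2) - real m * flat_exp (m + 1) (r - (norm (x - a))\<^sup>2))
            * ((x - a) \<bullet> h))) (at x)"
proof -
  have 1: "((\<lambda>y. r - (norm (y - a))\<^sup>2) has_derivative (\<lambda>h. - 2 * ((x - a) \<bullet> h))) (at x)"
    unfolding power2_norm_eq_inner by (auto intro!: derivative_eq_intros simp: inner_commute algebra_simps)
  show ?thesis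
    using has_derivative_compose[OF 1 flat_exp_has_field_derivative[unfolded has_field_derivative_def]]
    by (rule has_derivative_eq_rhs) (auto simp: algebra_simps)
qed

lemma bump_algebra_closed:
  assumes "f \<in> bump_algebra a r"
  shows "(\<forall>x. f differentiable (at x)) \<and> (\<forall>i. partial_deriv i f \<in> bump_algebra a r)"
  using assms
proof induction
  case (base m)
  let ?q = "\<lambda>y. r - (norm (y - a))\<^sup>2"
  have "partial_deriv i (\<lambda>y. flat_exp m (?q y)) \<in> bump_algebra a r" for i
  proof -
    define d where "d = (\<lambda>y. flat_exp (m + 2) (?q y) + (- real m) * flat_exp (m + 1) (?q y))"
    have d: "d \<in> bump_algebra a r" unfolding d_def
      by (intro bump_algebra.add bump_algebra.scale bump_algebra.base)
    have "partial_deriv i (\<lambda>y. flat_exp m (?q y)) = (\<lambda>y. (-2) * (y $ i * d y) + 2 * a $ i * d y)"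
      by (rule ext, subst partial_deriv_eqI[OF flat_exp_norm_has_derivative])
         (simp add: inner_axis d_def algebra_simps)
    also have "\<dots> \<in> bump_algebra a r"
      by (intro bump_algebra.add bump_algebra.scale bump_algebra.coord d)
    finally show ?thesis .
  qed
  moreover have "(\<lambda>y. flat_exp m (?q y)) differentiable (at x)" for x
    by (rule differentiableI[OF flat_exp_norm_has_derivative])
  ultimately show ?case by blast
next
  case (add f g)
  have D: "((\<lambda>y. f y + g y) has_derivative (\<lambda>h. frechet_derivative f (at x) h + frechet_derivative g (at x) h)) (at x)" for x
    using add.IH by (intro has_derivative_add) (auto simp: frechet_derivative_works)
  have "partial_deriv i (\<lambda>y. f y + g y) = (\<lambda>x. partial_deriv i f x + partial_deriv i g x)" for i
    by (rule ext, subst partial_deriv_eqI[OF D]) (simp add: partial_deriv_def)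
  moreover have "(\<lambda>y. f y + g y) differentiable (at x)" for x by (rule differentiableI[OF D])
  ultimately show ?case using add.IH bump_algebra.add[of "partial_deriv _ f" a r "partial_deriv _ g"] by auto
next
  case (scale f c)
  have D: "((\<lambda>y. c * f y) has_derivative (\<lambda>h. c * frechet_derivative f (at x) h)) (at x)" for x
    using scale.IH by (intro has_derivative_mult_right) (auto simp: frechet_derivative_works)
  have "partial_deriv i (\<lambda>y. c * f y) = (\<lambda>x. c * partial_deriv i f x)" for i
    by (rule ext, subst partial_deriv_eqI[OF D]) (simp add: partial_deriv_def)
  moreover have "(\<lambda>y. c * f y) differentiable (at x)" for x by (rule differentiableI[OF D])
  ultimately show ?case using scale.IH bump_algebra.scale[of "partial_deriv _ f" a r] by auto
next
  case (coord f j)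
  have D: "((\<lambda>y. y $ j * f y) has_derivative (\<lambda>h. x $ j * frechet_derivative f (at x) h + h $ j * f x)) (at x)" for x
  proof (rule has_derivative_mult)
    show "((\<lambda>y. y $ j) has_derivative (\<lambda>h. h $ j)) (at x)"
      by (intro bounded_linear_imp_has_derivative bounded_linear_vec_nth)
  qed (use coord.IH in \<open>auto simp: frechet_derivative_works\<close>)
  have eq: "partial_deriv i (\<lambda>y. y $ j * f y) = (\<lambda>x. x $ j * partial_deriv i f x + (if i = j then 1 else 0) * f x)" for i
    by (rule ext, subst partial_deriv_eqI[OF D]) (simp add: partial_deriv_def axis_def)
  have "(\<lambda>y. y $ j * f y) differentiable (at x)" for x by (rule differentiableI[OF D])
  moreover have "(\<lambda>x. x $ j * partial_deriv i f x + (if i = j then 1 else 0) * f x) \<in> bump_algebra a r" for i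
    using coord.IH coord.hyps by (intro bump_algebra.add bump_algebra.scale bump_algebra.coord) auto
  ultimately show ?case unfolding eq by blast
qed

lemma bump_algebra_diff_times: "f \<in> bump_algebra a r \<Longrightarrow> diff_times k f"
proof (induction k arbitrary: f)
  case (Suc k)
  thus ?case using bump_algebra_closed[OF Suc.prems] by simp
qed simp

definition bump :: "real \<Rightarrow> real^'n \<Rightarrow> real" where
  "bump d x = flat_exp 0 (d\<^sup>2 - (norm x)\<^sup>2)"

lemma bump_nonneg: "0 \<le> bump d x" by (simp add: bump_def flat_exp_nonneg)

lemma bump_le_1: "bump d x \<le> 1" by (simp add: bump_def flat_exp_def)

lemma bump_pos_iff: assumes "d > 0" shows "0 < bump d x \<longleftrightarrow> norm x < d"
proof -
  have "(norm x)\<^sup>2 < d\<^sup>2 \<longleftrightarrow> norm x < d"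
    using assms by (metis abs_norm_cancel abs_of_pos abs_square_less_1 norm_ge_zero power2_less_imp_less pos2 power_strict_mono order.strict_implies_order)
  thus ?thesis by (auto simp: bump_def flat_exp_def)
qed

lemma bump_eq_0: "d > 0 \<Longrightarrow> d \<le> norm x \<Longrightarrow> bump d x = 0"
  using bump_pos_iff[of d x] bump_nonneg[of d x] by force

lemma test_function_bump:
  assumes "d > 0" "cball a d \<subseteq> S"
  shows "test_function S (\<lambda>y. bump d (a - y))"
proof -
  have "{x. bump d (a - x) \<noteq> 0} \<subseteq> cball a d"
    using assms bump_eq_0[of d] by (force simp: dist_norm)
  hence cl: "closure {x. bump d (a - x) \<noteq> 0} \<subseteq> cball a d"
    by (intro closure_minimal) auto
  have "(\<lambda>y. bump d (a - y)) \<in> bump_algebra a (d\<^sup>2)"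
    using bump_algebra.base[of 0 "d\<^sup>2" a] by (simp add: bump_def norm_minus_commute)
  thus ?thesis unfolding test_function_def
    using cl assms bump_algebra_diff_times compact_cball[of a d]
    by (metis (no_types, lifting) bounded_subset closed_closure compact_eq_bounded_closed subset_trans)
qed

text \<open>The gradient of \<^const>\<open>bump\<close>.\<close>

definition dbump :: "real \<Rightarrow> real^'n \<Rightarrow> real^'n" where
  "dbump d x = (- 2 * flat_exp 2 (d\<^sup>2 - (norm x)\<^sup>2)) *\<^sub>R x"

lemma bump_has_derivative: "(bump d has_derivative (\<lambda>h. dbump d x \<bullet> h)) (at x)"
  using flat_exp_norm_has_derivative[of 0 "d\<^sup>2" 0 x]
  unfolding bump_def[abs_def] dbump_def by (simp add: numeral_2_eq_2)

lemma partial_deriv_bump: "partial_deriv i (\<lambda>y. bump d (a - y)) y = - (dbump d (a - y) $ i)"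
proof -
  have "((\<lambda>y. bump d (a - y)) has_derivative (\<lambda>h. dbump d (a - y) \<bullet> (- h))) (at y)"
    by (rule has_derivative_compose[OF _ bump_has_derivative]) (auto intro!: derivative_eq_intros)
  thus ?thesis by (simp add: partial_deriv_eqI inner_axis)
qed

lemma continuous_on_flat_exp: "continuous_on UNIV (flat_exp m)"
  by (intro continuous_at_imp_continuous_on ballI DERIV_isCont[OF flat_exp_has_field_derivative])

lemma continuous_on_bump: "continuous_on UNIV (bump d)"
  unfolding bump_def
  by (intro continuous_on_compose2[OF continuous_on_flat_exp] continuous_intros) auto

lemma continuous_on_dbump: "continuous_on UNIV (dbump d)"
  unfolding dbump_def
  by (intro continuous_intros continuous_on_compose2[OF continuous_on_flat_exp]) auto

lemma dbump_eq_0: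
  assumes "d > 0" "d \<le> norm x"
  shows "dbump d x = 0"
proof -
  have "d\<^sup>2 \<le> (norm x)\<^sup>2" using assms by (intro power_mono) auto
  thus ?thesis by (simp add: dbump_def flat_exp_def)
qed

lemma dbump_bounded: "\<exists>B. \<forall>x :: real^'n. norm (dbump d x) \<le> B" if "d > 0"
proof -
  have "compact (dbump d ` cball (0::real^'n) d)"
    by (intro compact_continuous_image continuous_on_subset[OF continuous_on_dbump]) auto
  then obtain B where B: "\<forall>y\<in>dbump d ` cball (0::real^'n) d. norm y \<le> B"
    using compact_imp_bounded bounded_iff by metis
  have "norm (dbump d x) \<le> max B 0" for x :: "real^'n"
  proof (cases "norm x \<le> d")
    case True thus ?thesis using B by (force simp: le_max_iff_disj)
  qed (use dbump_eq_0[of d x] that in auto)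
  thus ?thesis by blast
qed

section \<open>Approximation by mollification\<close>

lemma nn_integral_lborel_shift:
  fixes f :: "'a::euclidean_space \<Rightarrow> ennreal"
  assumes [measurable]: "f \<in> borel_measurable borel"
  shows "(\<integral>\<^sup>+x. f (a + x) \<partial>lborel) = (\<integral>\<^sup>+x. f x \<partial>lborel)"
proof -
  have "(\<integral>\<^sup>+x. f x \<partial>lborel) = (\<integral>\<^sup>+x. f x \<partial>distr lborel borel ((+) a))"
    by (simp add: lborel_distr_plus)
  also have "\<dots> = (\<integral>\<^sup>+x. f (a + x) \<partial>lborel)"
    by (subst nn_integral_distr) auto
  finally show ?thesis ..
qed

lemma nn_integral_lborel_reflect:
  fixes f :: "'a::euclidean_space \<Rightarrow> ennreal"
  assumes [measurable]: "f \<in> borel_measurable borel"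
  shows "(\<integral>\<^sup>+x. f (a - x) \<partial>lborel) = (\<integral>\<^sup>+x. f x \<partial>lborel)"
proof -
  have "(\<integral>\<^sup>+x. f x \<partial>lborel) = (\<integral>\<^sup>+x. f x \<partial>density (distr lborel borel (\<lambda>x. a + (- 1) *\<^sub>R x)) (\<lambda>_. \<bar>- 1 :: real\<bar> ^ DIM('a)))"
    by (subst lborel_affine[of "- 1" a, symmetric]) auto
  also have "\<dots> = (\<integral>\<^sup>+x. f (a - x) \<partial>lborel)"
    by (simp add: nn_integral_density nn_integral_distr)
  finally show ?thesis ..
qed

text \<open>A measurable function is the almost everywhere limit of continuous ones. Clipping the values of
  the function and cutting off at infinity, both continuously, provides a dominating function.\<close>

lemma L1_dense_continuous:
  fixes f :: "'a::euclidean_space \<Rightarrow> 'b::euclidean_space"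
  assumes int: "integrable lborel f" and "e > 0"
  obtains v K where "continuous_on UNIV v" "\<And>x. K \<le> norm x \<Longrightarrow> v x = 0"
    "(\<integral>\<^sup>+x. ennreal (norm (f x - v x)) \<partial>lborel) < ennreal e"
proof -
  have fm [measurable]: "f \<in> borel_measurable borel" using int by auto
  have "f measurable_on UNIV"
    using fm by (subst measurable_on_iff_borel_measurable)
      (auto simp: lebesgue_on_UNIV_eq intro!: measurable_completion)
  then obtain N g where N: "negligible N" and gc: "\<And>n. continuous_on UNIV (g n)"
    and g: "\<And>x. x \<notin> N \<Longrightarrow> (\<lambda>n. g n x) \<longlonglongrightarrow> f x"
    unfolding measurable_on_def by auto
  have AE_N: "AE x in lborel. x \<notin> N"
    using AE_not_in[OF N[unfolded negligible_iff_null_sets]] by (simp add: AE_completion_iff)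
  define clip where "clip = (\<lambda>M (z::'b). (M / max M (norm z)) *\<^sub>R z)"
  define cut where "cut = (\<lambda>M (x::'a). max 0 (min 1 (M + 1 - norm x)))"
  have clip_norm: "norm (clip M z) \<le> M" "norm (clip M z) \<le> norm z" if "M > 0" for M z
  proof -
    have "norm (clip M z) = M * norm z / max M (norm z)" using that by (simp add: clip_def)
    thus "norm (clip M z) \<le> M" "norm (clip M z) \<le> norm z"
      using that by (auto simp: divide_le_eq max_def mult.commute intro!: mult_mono)
  qed
  have clip_cont: "continuous_on UNIV (clip M)" if "M > 0" for M
    unfolding clip_def using that by (intro continuous_intros) (auto simp: max_def)
  have cut_cont: "continuous_on UNIV (cut M)" for M
    unfolding cut_def by (intro continuous_intros)
  have cut_bd: "0 \<le> cut M x" "cut M x \<le> 1" for M x by (auto simp: cut_def)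
  have clip_meas [measurable]: "clip (real (Suc m)) \<in> borel_measurable borel" for m
    by (intro borel_measurable_continuous_onI clip_cont) auto
  have cut_meas [measurable]: "cut (real (Suc m)) \<in> borel_measurable borel" for m
    by (intro borel_measurable_continuous_onI cut_cont)
  define F where "F = (\<lambda>m x. cut (real (Suc m)) x *\<^sub>R clip (real (Suc m)) (f x))"
  have F_meas [measurable]: "F m \<in> borel_measurable borel" for m unfolding F_def by measurable
  have norm_f: "(\<integral>\<^sup>+x. ennreal (norm (f x)) \<partial>lborel) < \<infinity>"
    using int by (simp add: integrable_iff_bounded)
  have "(\<lambda>m. \<integral>\<^sup>+ x. ennreal (norm (f x - F m x)) \<partial>lborel) \<longlonglongrightarrow> 0"
  proof (rule nn_integral_dominated_convergence_norm[where w="\<lambda>x. norm (f x)"])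
    show "AE x in lborel. norm (F m x) \<le> norm (f x)" for m
      using clip_norm(2)[of "real (Suc m)" "f _"] cut_bd[of "real (Suc m)"]
      by (intro AE_I2) (auto simp: F_def intro!: mult_left_le_one_le order_trans[OF mult_left_le_one_le])
    show "AE x in lborel. (\<lambda>m. F m x) \<longlonglongrightarrow> f x"
    proof (rule AE_I2)
      fix x
      have "eventually (\<lambda>m. real (Suc m) > norm x + norm (f x)) sequentially"
        using eventually_gt_at_top[of "nat \<lceil>norm x + norm (f x)\<rceil>"]
        by eventually_elim linarith
      hence "eventually (\<lambda>m. F m x = f x) sequentially"
      proof eventually_elim
        case (elim m)
        have "norm x < real (Suc m)" "norm (f x) < real (Suc m)" using elim by (smt (verit) norm_ge_zero)+
        thus ?case by (simp add: F_def cut_def clip_def max_def)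
      qed
      thus "(\<lambda>m. F m x) \<longlonglongrightarrow> f x" by (rule tendsto_eventually)
    qed
  qed (use norm_f in auto)
  hence "eventually (\<lambda>m. (\<integral>\<^sup>+ x. ennreal (norm (f x - F m x)) \<partial>lborel) < ennreal (e / 2)) sequentially"
    using \<open>e > 0\<close> by (intro order_tendstoD) auto
  then obtain m where m: "(\<integral>\<^sup>+ x. ennreal (norm (f x - F m x)) \<partial>lborel) < ennreal (e / 2)"
    by (auto simp: eventually_sequentially)
  define M where "M = real (Suc m)"
  have M: "M > 0" by (simp add: M_def)
  define v where "v = (\<lambda>n x. cut M x *\<^sub>R clip M (g n x))"
  have v_cont: "continuous_on UNIV (v n)" for n unfolding v_def
    by (intro continuous_intros cut_cont continuous_on_compose2[OF clip_cont[OF M] gc]) auto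
  have v_meas [measurable]: "v n \<in> borel_measurable borel" for n
    by (intro borel_measurable_continuous_onI v_cont)
  have v_bd: "norm (v n x) \<le> M * indicator (ball 0 (M + 1)) x" for n x
  proof (cases "norm x < M + 1")
    case True
    have "\<bar>cut M x\<bar> * norm (clip M (g n x)) \<le> 1 * M"
      using clip_norm(1)[OF M] cut_bd[of M x] by (intro mult_mono) auto
    thus ?thesis using True by (simp add: v_def)
  qed (auto simp: v_def cut_def)
  have "(\<lambda>n. \<integral>\<^sup>+ x. ennreal (norm (F m x - v n x)) \<partial>lborel) \<longlonglongrightarrow> 0"
  proof (rule nn_integral_dominated_convergence_norm[where w="\<lambda>x. M * indicator (ball 0 (M + 1)) x"])
    show "(\<integral>\<^sup>+ x. ennreal (M * indicator (ball (0::'a) (M + 1)) x) \<partial>lborel) < \<infinity>"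
      using M by (simp add: ennreal_mult' ennreal_indicator nn_integral_cmult_indicator emeasure_ball ennreal_mult_less_top)
    show "AE x in lborel. (\<lambda>n. v n x) \<longlonglongrightarrow> F m x"
      using AE_N
    proof eventually_elim
      case (elim x)
      have "(\<lambda>n. clip M (g n x)) \<longlonglongrightarrow> clip M (f x)"
        using clip_cont[OF M] g[OF elim] by (auto intro: continuous_on_tendsto_compose)
      thus ?case unfolding v_def F_def M_def by (intro tendsto_intros)
    qed
    show "(\<lambda>x. M * indicator (ball (0::'a) (M + 1)) x) \<in> borel_measurable lborel"
      by (intro borel_measurable_times borel_measurable_indicator) auto
    show "AE x in lborel. norm (v n x) \<le> M * indicator (ball 0 (M + 1)) x" for n
      using v_bd by (intro AE_I2)
  qed measurable
  hence "eventually (\<lambda>n. (\<integral>\<^sup>+ x. ennreal (norm (F m x - v n x)) \<partial>lborel) < ennreal (e / 2)) sequentially"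
    using \<open>e > 0\<close> by (intro order_tendstoD) auto
  then obtain n where n: "(\<integral>\<^sup>+ x. ennreal (norm (F m x - v n x)) \<partial>lborel) < ennreal (e / 2)"
    by (auto simp: eventually_sequentially)
  have "(\<integral>\<^sup>+ x. ennreal (norm (f x - v n x)) \<partial>lborel)
          \<le> (\<integral>\<^sup>+ x. ennreal (norm (f x - F m x)) + ennreal (norm (F m x - v n x)) \<partial>lborel)"
  proof (intro nn_integral_mono)
    fix x
    have "norm (f x - v n x) \<le> norm (f x - F m x) + norm (F m x - v n x)" by norm
    thus "ennreal (norm (f x - v n x)) \<le> ennreal (norm (f x - F m x)) + ennreal (norm (F m x - v n x))"
      by (simp flip: ennreal_plus)
  qed
  also have "\<dots> = (\<integral>\<^sup>+ x. ennreal (norm (f x - F m x)) \<partial>lborel) + (\<integral>\<^sup>+ x. ennreal (norm (F m x - v n x)) \<partial>lborel)"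
    by (intro nn_integral_add) auto
  also have "\<dots> < ennreal (e / 2) + ennreal (e / 2)"
    using m n by (intro add_strict_mono)
  also have "\<dots> = ennreal e" using \<open>e > 0\<close> by (simp flip: ennreal_plus)
  finally show thesis
    by (intro that[of "v n" "M + 1"] v_cont) (auto simp: v_def cut_def)
qed

text \<open>For a continuous function with compact support this is uniform continuity; density does the rest.\<close>

lemma L1_translation:
  fixes f :: "'a::euclidean_space \<Rightarrow> 'b::euclidean_space"
  assumes int: "integrable lborel f" and "e > 0"
  shows "\<exists>d>0. \<forall>h. norm h < d \<longrightarrow> (\<integral>\<^sup>+x. ennreal (norm (f (x - h) - f x)) \<partial>lborel) \<le> ennreal e"
proof -
  have fm [measurable]: "f \<in> borel_measurable borel" using int by auto
  obtain v K where vc: "continuous_on UNIV v" and v0: "\<And>x. K \<le> norm x \<Longrightarrow> v x = 0"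
    and v: "(\<integral>\<^sup>+x. ennreal (norm (f x - v x)) \<partial>lborel) < ennreal (e / 3)"
    using L1_dense_continuous[OF int, of "e / 3"] \<open>e > 0\<close> by auto
  have vm [measurable]: "v \<in> borel_measurable borel"
    by (intro borel_measurable_continuous_onI vc)
  define B where "B = measure lborel (cball (0::'a) (\<bar>K\<bar> + 1)) + 1"
  have B: "B > 0" unfolding B_def by (smt (verit) measure_nonneg)
  have "uniformly_continuous_on (cball 0 (\<bar>K\<bar> + 2)) v"
    by (intro compact_uniformly_continuous continuous_on_subset[OF vc]) auto
  then obtain d where d: "d > 0"
    "\<And>x y. x \<in> cball 0 (\<bar>K\<bar> + 2) \<Longrightarrow> y \<in> cball 0 (\<bar>K\<bar> + 2) \<Longrightarrow> dist y x < d \<Longrightarrow> dist (v y) (v x) < e / (3 * B)"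
    unfolding uniformly_continuous_on_def using B \<open>e > 0\<close>
    by (metis divide_pos_pos mult_pos_pos zero_less_numeral)
  show ?thesis
  proof (intro exI[of _ "min d 1"] conjI allI impI)
    fix h :: 'a assume h: "norm h < min d 1"
    have vh: "norm (v (x - h) - v x) \<le> e / (3 * B) * indicator (cball 0 (\<bar>K\<bar> + 1)) x" for x
    proof (cases "norm x \<le> \<bar>K\<bar> + 1")
      case True
      have "norm (x - h) \<le> \<bar>K\<bar> + 2" using True h norm_triangle_ineq4[of x h] by linarith
      hence "dist (v (x - h)) (v x) < e / (3 * B)"
        using True h by (intro d) (simp_all only: mem_cball dist_norm, auto simp: norm_minus_commute)
      thus ?thesis using True by (simp add: dist_norm)
    next
      case False
      have "norm (x - h) \<ge> K" "norm x \<ge> K" using False h norm_triangle_ineq2[of x h] by linarith+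
      thus ?thesis using False v0 by simp
    qed
    have "(\<integral>\<^sup>+x. ennreal (norm (v (x - h) - v x)) \<partial>lborel)
        \<le> (\<integral>\<^sup>+x. ennreal (e / (3 * B)) * indicator (cball (0::'a) (\<bar>K\<bar> + 1)) x \<partial>lborel)"
      using vh B \<open>e > 0\<close> by (intro nn_integral_mono) (auto simp flip: ennreal_indicator ennreal_mult intro!: ennreal_leI)
    also have "\<dots> = ennreal (e / (3 * B)) * emeasure lborel (cball (0::'a) (\<bar>K\<bar> + 1))"
      by (intro nn_integral_cmult_indicator) simp
    also have "\<dots> \<le> ennreal (e / (3 * B)) * ennreal B"
      using emeasure_compact_finite[of "cball (0::'a) (\<bar>K\<bar> + 1)"]
      by (intro mult_left_mono) (auto simp: emeasure_eq_ennreal_measure B_def intro!: ennreal_leI)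
    also have "\<dots> = ennreal (e / 3)" using B \<open>e > 0\<close> by (simp flip: ennreal_mult)
    finally have 1: "(\<integral>\<^sup>+x. ennreal (norm (v (x - h) - v x)) \<partial>lborel) \<le> ennreal (e / 3)" .
    have 2: "(\<integral>\<^sup>+x. ennreal (norm (f (x - h) - v (x - h))) \<partial>lborel) \<le> ennreal (e / 3)"
      using nn_integral_lborel_shift[of "\<lambda>x. ennreal (norm (f x - v x))" "- h"] v by simp
    have "(\<integral>\<^sup>+x. ennreal (norm (f (x - h) - f x)) \<partial>lborel)
       \<le> (\<integral>\<^sup>+x. ennreal (norm (f (x - h) - v (x - h))) + ennreal (norm (v (x - h) - v x)) + ennreal (norm (f x - v x)) \<partial>lborel)"
    proof (intro nn_integral_mono)
      fix x
      have "norm (f (x - h) - f x) \<le> norm (f (x - h) - v (x - h)) + norm (v (x - h) - v x) + norm (f x - v x)"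
        by norm
      thus "ennreal (norm (f (x - h) - f x)) \<le> ennreal (norm (f (x - h) - v (x - h))) + ennreal (norm (v (x - h) - v x)) + ennreal (norm (f x - v x))"
        by (simp flip: ennreal_plus)
    qed
    also have "\<dots> = (\<integral>\<^sup>+x. ennreal (norm (f (x - h) - v (x - h))) \<partial>lborel) + (\<integral>\<^sup>+x. ennreal (norm (v (x - h) - v x)) \<partial>lborel)
         + (\<integral>\<^sup>+x. ennreal (norm (f x - v x)) \<partial>lborel)"
      by (simp add: nn_integral_add)
    also have "\<dots> \<le> ennreal (e / 3) + ennreal (e / 3) + ennreal (e / 3)"
      using 1 2 v by (intro add_mono) auto
    also have "\<dots> = ennreal e" using \<open>e > 0\<close> by (simp flip: ennreal_plus)
    finally show "(\<integral>\<^sup>+x. ennreal (norm (f (x - h) - f x)) \<partial>lborel) \<le> ennreal e" .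
  qed (use d in auto)
qed

definition mollifier :: "real \<Rightarrow> real^'n \<Rightarrow> real" where
  "mollifier d x = bump d x / (LINT y|lborel. bump d (y :: real^'n))"

definition mollify :: "real \<Rightarrow> (real^'n \<Rightarrow> 'b::euclidean_space) \<Rightarrow> real^'n \<Rightarrow> 'b" where
  "mollify d f x = (LINT y|lborel. mollifier d (x - y) *\<^sub>R f y)"

lemma bump_measurable [measurable]: "bump d \<in> borel_measurable borel"
  by (intro borel_measurable_continuous_onI continuous_on_bump)

lemma dbump_measurable [measurable]: "dbump d \<in> borel_measurable borel"
  by (intro borel_measurable_continuous_onI continuous_on_dbump)

lemma integrable_bump:
  assumes "d > 0"
  shows "integrable lborel (bump d :: real^'n \<Rightarrow> real)"
proof (rule Bochner_Integration.integrable_bound)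
  show "integrable lborel (indicator (cball (0::real^'n) d) :: _ \<Rightarrow> real)"
    using emeasure_compact_finite[of "cball (0::real^'n) d"] by (simp add: integrable_indicator_iff)
  show "AE x in lborel. norm (bump d x) \<le> norm (indicator (cball 0 d) (x :: real^'n) :: real)"
  proof (rule AE_I2)
    fix x :: "real^'n"
    show "norm (bump d x) \<le> norm (indicator (cball 0 d) x :: real)"
      using bump_nonneg[of d x] bump_le_1[of d x] bump_eq_0[OF assms, of x]
      by (cases "norm x \<le> d") auto
  qed
qed auto

lemma bump_mass_pos:
  assumes "d > 0"
  shows "0 < (LINT y|lborel. bump d (y :: real^'n))"
proof -
  have "0 \<le> (LINT y|lborel. bump d (y :: real^'n))" using bump_nonneg by (intro integral_nonneg_AE) auto
  moreover have "(LINT y|lborel. bump d (y :: real^'n)) \<noteq> 0"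
  proof
    assume "(LINT y|lborel. bump d (y :: real^'n)) = 0"
    hence "AE y in lborel. bump d (y :: real^'n) = 0"
      using integral_nonneg_eq_0_iff_AE[OF integrable_bump[OF assms]] bump_nonneg by auto
    hence "AE y in lborel. (y::real^'n) \<notin> ball 0 d"
      by eventually_elim (use bump_pos_iff[OF assms] in force)
    hence "emeasure lborel (ball (0::real^'n) d) = 0"
      by (subst (asm) AE_iff_measurable[of "ball 0 d"]) auto
    thus False using assms unit_ball_vol_pos[of "real CARD('n)"]
      by (simp add: emeasure_ball del: unit_ball_vol_pos)
  qed
  ultimately show ?thesis by linarith
qed

lemma mollifier_measurable [measurable]: "mollifier d \<in> borel_measurable borel"
  unfolding mollifier_def by measurable

lemma mollifier_nonneg: "0 \<le> mollifier d x"
  unfolding mollifier_def by (intro divide_nonneg_nonneg integral_nonneg_AE bump_nonneg AE_I2)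

lemma mollifier_eq_0: "d > 0 \<Longrightarrow> d \<le> norm x \<Longrightarrow> mollifier d x = 0"
  by (simp add: mollifier_def bump_eq_0)

lemma mollifier_bounded:
  fixes x :: "real^'n"
  assumes "d > 0"
  shows "mollifier d x \<le> 1 / (LINT y|lborel. bump d (y :: real^'n))"
  unfolding mollifier_def using bump_mass_pos[OF assms, where 'n='n] bump_le_1
  by (intro divide_right_mono) (auto intro: less_imp_le)

lemma nn_integral_mollifier:
  assumes "d > 0"
  shows "(\<integral>\<^sup>+x. ennreal (mollifier d (x :: real^'n)) \<partial>lborel) = 1"
proof -
  have "integrable lborel (mollifier d :: real^'n \<Rightarrow> real)"
    unfolding mollifier_def by (intro integrable_divide_zero impI integrable_bump assms)
  moreover have "(LINT x|lborel. mollifier d (x :: real^'n)) = 1"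
    unfolding mollifier_def using bump_mass_pos[OF assms, where 'n='n] by simp
  ultimately show ?thesis
    by (subst nn_integral_eq_integral) (auto simp: mollifier_nonneg)
qed

lemma continuous_on_mollifier: "continuous_on UNIV (mollifier d)"
  unfolding mollifier_def divide_inverse
  by (intro continuous_intros continuous_on_bump)

text \<open>The mollification error at a point is an average of errors of small translations, so that Tonelli's
  theorem reduces the claim to \<open>L1_translation\<close>.\<close>

lemma L1_mollify:
  fixes f :: "real^'n \<Rightarrow> 'b::euclidean_space"
  assumes int: "integrable lborel f" and "e > 0"
  shows "\<exists>d0>0. \<forall>d. 0 < d \<and> d < d0 \<longrightarrow>
     (\<integral>\<^sup>+x. ennreal (norm (mollify d f x - f x)) \<partial>lborel) \<le> ennreal e"
proof -
  have fm [measurable]: "f \<in> borel_measurable borel" using int by auto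
  obtain d0 where d0: "d0 > 0"
    "\<And>h. norm h < d0 \<Longrightarrow> (\<integral>\<^sup>+x. ennreal (norm (f (x - h) - f x)) \<partial>lborel) \<le> ennreal e"
    using L1_translation[OF assms] by blast
  show ?thesis
  proof (intro exI[of _ d0] conjI allI impI d0(1))
    fix d assume d: "0 < d \<and> d < d0"
    have bd: "ennreal (norm (mollify d f x - f x)) \<le> (\<integral>\<^sup>+h. ennreal (mollifier d h) * ennreal (norm (f (x - h) - f x)) \<partial>lborel)" for x
    proof -
      have i1: "integrable lborel (\<lambda>y. mollifier d (x - y) *\<^sub>R f y)"
      proof (rule Bochner_Integration.integrable_bound)
        show "integrable lborel (\<lambda>y. (1 / (LINT y|lborel. bump d (y :: real^'n))) *\<^sub>R f y)" using int by (intro integrable_scaleR_right)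
        show "AE y in lborel. norm (mollifier d (x - y) *\<^sub>R f y) \<le> norm ((1 / (LINT y|lborel. bump d (y :: real^'n))) *\<^sub>R f y)"
        proof (rule AE_I2)
          fix y
          have "mollifier d (x - y) * norm (f y) \<le> 1 / (LINT y|lborel. bump d (y :: real^'n)) * norm (f y)"
            using mollifier_bounded[of d "x - y"] d by (intro mult_right_mono) auto
          thus "norm (mollifier d (x - y) *\<^sub>R f y) \<le> norm ((1 / (LINT y|lborel. bump d (y :: real^'n))) *\<^sub>R f y)"
            using mollifier_nonneg[of d "x - y"] bump_mass_pos[of d, where 'n='n] d by simp
        qed
      qed auto
      have nm: "(\<integral>\<^sup>+y. ennreal (mollifier d (x - y)) \<partial>lborel) = 1"
        using nn_integral_lborel_reflect[of "\<lambda>y. ennreal (mollifier d y)" x] nn_integral_mollifier[of d] d by simp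
      hence i2: "integrable lborel (\<lambda>y. mollifier d (x - y))"
        by (intro integrableI_bounded) (auto simp: mollifier_nonneg)
      have "(LINT y|lborel. mollifier d (x - y)) = 1"
        using nm i2 by (subst (asm) nn_integral_eq_integral) (auto simp: mollifier_nonneg)
      hence "f x = (LINT y|lborel. mollifier d (x - y) *\<^sub>R f x)" using i2 by simp
      hence "mollify d f x - f x = (LINT y|lborel. mollifier d (x - y) *\<^sub>R f y - mollifier d (x - y) *\<^sub>R f x)"
        unfolding mollify_def using i1 i2 by (subst Bochner_Integration.integral_diff) auto
      hence "ennreal (norm (mollify d f x - f x)) \<le> (\<integral>\<^sup>+y. ennreal (norm (mollifier d (x - y) *\<^sub>R f y - mollifier d (x - y) *\<^sub>R f x)) \<partial>lborel)"
        by (simp only:) (intro integral_norm_bound_ennreal Bochner_Integration.integrable_diff i1 integrable_scaleR_left i2)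
      also have "\<dots> = (\<integral>\<^sup>+y. ennreal (mollifier d (x - y)) * ennreal (norm (f y - f x)) \<partial>lborel)"
        by (intro nn_integral_cong) (simp add: mollifier_nonneg flip: scaleR_diff_right ennreal_mult)
      also have "\<dots> = (\<integral>\<^sup>+h. ennreal (mollifier d h) * ennreal (norm (f (x - h) - f x)) \<partial>lborel)"
        using nn_integral_lborel_reflect[of "\<lambda>y. ennreal (mollifier d (x - y)) * ennreal (norm (f y - f x))" x] by simp
      finally show ?thesis .
    qed
    have "(\<integral>\<^sup>+x. ennreal (norm (mollify d f x - f x)) \<partial>lborel)
        \<le> (\<integral>\<^sup>+x. (\<integral>\<^sup>+h. ennreal (mollifier d h) * ennreal (norm (f (x - h) - f x)) \<partial>lborel) \<partial>lborel)"
      by (intro nn_integral_mono bd)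
    also have "\<dots> = (\<integral>\<^sup>+h. (\<integral>\<^sup>+x. ennreal (mollifier d h) * ennreal (norm (f (x - h) - f x)) \<partial>lborel) \<partial>lborel)"
      by (intro lborel_pair.Fubini') measurable
    also have "\<dots> = (\<integral>\<^sup>+h. ennreal (mollifier d h) * (\<integral>\<^sup>+x. ennreal (norm (f (x - h) - f x)) \<partial>lborel) \<partial>lborel)"
      by (intro nn_integral_cong nn_integral_cmult) measurable
    also have "\<dots> \<le> (\<integral>\<^sup>+(h::real^'n). ennreal (mollifier d h) * ennreal e \<partial>lborel)"
    proof (intro nn_integral_mono)
      fix h :: "real^'n"
      show "ennreal (mollifier d h) * (\<integral>\<^sup>+x. ennreal (norm (f (x - h) - f x)) \<partial>lborel) \<le> ennreal (mollifier d h) * ennreal e"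
      proof (cases "norm h < d")
        case True thus ?thesis using d by (intro mult_left_mono d0) auto
      qed (use d mollifier_eq_0[of d h] in auto)
    qed
    also have "\<dots> = ennreal e" using d nn_integral_mollifier[of d, where 'n='n] by (simp add: nn_integral_multc)
    finally show "(\<integral>\<^sup>+x. ennreal (norm (mollify d f x - f x)) \<partial>lborel) \<le> ennreal e" .
  qed
qed

definition loc_integrable :: "(real^'n \<Rightarrow> 'b::euclidean_space) \<Rightarrow> bool" where
  "loc_integrable f \<longleftrightarrow> f \<in> borel_measurable borel \<and>
     (\<forall>K. integrable lborel (\<lambda>x. indicator (ball 0 K) x *\<^sub>R f x))"

lemma loc_integrable_measurable [measurable_dest]: "loc_integrable f \<Longrightarrow> f \<in> borel_measurable borel"
  by (simp add: loc_integrable_def)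

lemma loc_integrableD: "loc_integrable f \<Longrightarrow> integrable lborel (\<lambda>x. indicator (ball 0 K) x *\<^sub>R f x)"
  by (simp add: loc_integrable_def)

lemma mollify_cut:
  assumes "d > 0" "norm x + d \<le> K"
  shows "mollify d f x = mollify d (\<lambda>y. indicator (ball 0 K) y *\<^sub>R f y) x"
  unfolding mollify_def
proof (rule Bochner_Integration.integral_cong)
  fix y
  show "mollifier d (x - y) *\<^sub>R f y = mollifier d (x - y) *\<^sub>R indicator (ball 0 K) y *\<^sub>R f y"
  proof (cases "norm (x - y) < d")
    case True
    hence "norm y < K" using assms norm_triangle_ineq2[of y x] by (simp add: norm_minus_commute)
    thus ?thesis by simp
  qed (use assms mollifier_eq_0[of d "x - y"] in auto)
qed simp

text \<open>Mollification is local: on a ball it only sees the function on the concentric ball whose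
  radius is larger by 1.\<close>

lemma L1_mollify_loc:
  assumes f: "loc_integrable f" and "e > 0"
  shows "\<exists>d0>0. \<forall>d. 0 < d \<and> d < d0 \<longrightarrow>
    (\<integral>\<^sup>+x. indicator (ball 0 K) x * ennreal (norm (mollify d f x - f x)) \<partial>lborel) \<le> ennreal e"
proof -
  let ?F = "\<lambda>y. indicator (ball 0 (K + 1)) y *\<^sub>R f y"
  obtain d0 where d0: "d0 > 0" "\<And>d. 0 < d \<Longrightarrow> d < d0 \<Longrightarrow>
     (\<integral>\<^sup>+x. ennreal (norm (mollify d ?F x - ?F x)) \<partial>lborel) \<le> ennreal e"
    using L1_mollify[OF loc_integrableD[OF f] \<open>e > 0\<close>, of "K + 1"] by blast
  show ?thesis
  proof (intro exI[of _ "min d0 1"] conjI allI impI)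
    fix d assume d: "0 < d \<and> d < min d0 1"
    have "(\<integral>\<^sup>+x. indicator (ball 0 K) x * ennreal (norm (mollify d f x - f x)) \<partial>lborel)
        \<le> (\<integral>\<^sup>+x. ennreal (norm (mollify d ?F x - ?F x)) \<partial>lborel)"
      using d mollify_cut[of d _ "K + 1" f] by (intro nn_integral_mono) (auto simp: indicator_def)
    also have "\<dots> \<le> ennreal e" using d d0 by auto
    finally show "(\<integral>\<^sup>+x. indicator (ball 0 K) x * ennreal (norm (mollify d f x - f x)) \<partial>lborel) \<le> ennreal e" .
  qed (use d0 in auto)
qed

lemma mollifier_le_cut:
  fixes f :: "real^'n \<Rightarrow> 'b::euclidean_space"
  assumes "d > 0" "norm x + d \<le> K"
  shows "norm (mollifier d (x - y) *\<^sub>R f y)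
          \<le> norm ((1 / (LINT y|lborel. bump d (y :: real^'n))) *\<^sub>R indicator (ball 0 K) y *\<^sub>R f y)"
proof (cases "norm (x - y) < d")
  case True
  hence "norm y < K" using assms norm_triangle_ineq2[of y x] by (simp add: norm_minus_commute)
  moreover have "mollifier d (x - y) * norm (f y) \<le> 1 / (LINT y|lborel. bump d (y :: real^'n)) * norm (f y)"
    using mollifier_bounded[of d "x - y"] assms by (intro mult_right_mono) auto
  ultimately show ?thesis
    using mollifier_nonneg[of d "x - y"] bump_mass_pos[OF assms(1), where 'n='n] by simp
qed (use assms mollifier_eq_0[of d "x - y"] in auto)

lemma continuous_mollify:
  fixes f :: "real^'n \<Rightarrow> 'b::euclidean_space"
  assumes f: "loc_integrable f" and d: "d > 0"
  shows "continuous_on UNIV (mollify d f)"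
proof (intro continuous_at_imp_continuous_on ballI)
  fix x :: "real^'n"
  note [measurable] = loc_integrable_measurable[OF f]
  show "isCont (mollify d f) x"
    unfolding continuous_at_sequentially comp_def
  proof (intro allI impI)
    fix X assume X: "X \<longlonglongrightarrow> x"
    then obtain K where K: "\<And>n. norm (X n) \<le> K"
      using convergent_imp_bounded[OF X] by (auto simp: bounded_iff)
    show "(\<lambda>n. mollify d f (X n)) \<longlonglongrightarrow> mollify d f x"
      unfolding mollify_def
    proof (rule integral_dominated_convergence)
      show "integrable lborel (\<lambda>y. norm ((1 / (LINT y|lborel. bump d (y :: real^'n))) *\<^sub>R indicator (ball 0 (K + d)) y *\<^sub>R f y))"
        by (intro integrable_norm integrable_scaleR_right loc_integrableD f)
      show "AE y in lborel. norm (mollifier d (X n - y) *\<^sub>R f y)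
               \<le> norm ((1 / (LINT y|lborel. bump d (y :: real^'n))) *\<^sub>R indicator (ball 0 (K + d)) y *\<^sub>R f y)" for n
        using mollifier_le_cut[OF d, of "X n" "K + d"] K[of n] by (intro AE_I2) auto
      show "AE y in lborel. (\<lambda>n. mollifier d (X n - y) *\<^sub>R f y) \<longlonglongrightarrow> mollifier d (x - y) *\<^sub>R f y"
        by (intro AE_I2 tendsto_intros continuous_on_tendsto_compose[OF continuous_on_mollifier] X) auto
    qed measurable
  qed
qed

text \<open>The only consequence of the notion of a weak gradient that the estimates use: integration by
  parts against translated bumps, in vector form. There is no minus sign because \<open>dbump d (a - y)\<close> is
  minus the gradient of \<open>bump d (a - y)\<close> with respect to \<open>y\<close>.\<close>

definition weak_pair :: "(real^'n \<Rightarrow> real) \<Rightarrow> (real^'n \<Rightarrow> real^'n) \<Rightarrow> bool" where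
  "weak_pair u g \<longleftrightarrow> loc_integrable u \<and> loc_integrable g \<and>
     (\<forall>d>0. \<forall>a. (LINT y|lborel. u y *\<^sub>R dbump d (a - y)) = (LINT y|lborel. bump d (a - y) *\<^sub>R g y))"

text \<open>Differentiation under the integral sign puts the derivative on the bump, and integration by parts
  moves it to the function. Only directional derivatives along lines are needed later.\<close>

lemma mollify_has_derivative_line:
  fixes u :: "real^'n \<Rightarrow> real"
  assumes ug: "weak_pair u g" and d: "d > 0"
  shows "((\<lambda>s. mollify d u (p + s *\<^sub>R h)) has_real_derivative (mollify d g (p + t *\<^sub>R h) \<bullet> h)) (at t)"
proof -
  have lu: "loc_integrable u" and lg: "loc_integrable g" using ug by (auto simp: weak_pair_def)
  note [measurable] = loc_integrable_measurable[OF lu] loc_integrable_measurable[OF lg]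
  define m where "m = (LINT y|lborel. bump d (y :: real^'n))"
  have m: "m > 0" unfolding m_def by (rule bump_mass_pos[OF d])
  obtain B where B: "\<And>x :: real^'n. norm (dbump d x) \<le> B" using dbump_bounded[OF d] by blast
  have B0: "B \<ge> 0" using B[of 0] norm_ge_zero order_trans by blast
  have lip: "\<bar>bump d x - bump d y\<bar> \<le> B * norm (x - y)" for x y :: "real^'n"
  proof -
    have "onorm (\<lambda>h. dbump d z \<bullet> h) \<le> B" for z :: "real^'n"
    proof (rule onorm_le)
      fix h :: "real^'n"
      have "norm (dbump d z \<bullet> h) \<le> norm (dbump d z) * norm h" by (simp add: Cauchy_Schwarz_ineq2)
      also have "\<dots> \<le> B * norm h" by (intro mult_right_mono B) auto
      finally show "norm (dbump d z \<bullet> h) \<le> B * norm h" .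
    qed
    thus ?thesis
      using differentiable_bound[of UNIV "bump d" "\<lambda>x h. dbump d x \<bullet> h" B x y] bump_has_derivative
      by (auto simp: has_derivative_at_withinI)
  qed
  define q where "q = p + t *\<^sub>R h"
  have "((\<lambda>k. (mollify d u (q + k *\<^sub>R h) - mollify d u q) / k) \<longlongrightarrow> mollify d g q \<bullet> h) (at 0)"
    unfolding tendsto_at_iff_sequentially comp_def
  proof (intro allI impI)
    fix S :: "nat \<Rightarrow> real" assume "\<forall>i. S i \<in> UNIV - {0}" and S: "S \<longlonglongrightarrow> 0"
    hence S0: "S i \<noteq> 0" for i by auto
    obtain S1 where S1: "\<And>n. \<bar>S n\<bar> \<le> S1"
      using convergent_imp_bounded[OF S] by (auto simp: bounded_iff)
    define K where "K = norm q + S1 * norm h + d"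
    have K: "norm (q + S n *\<^sub>R h) + d \<le> K" "norm q + d \<le> K" for n
    proof -
      have "norm (q + S n *\<^sub>R h) \<le> norm q + \<bar>S n\<bar> * norm h" by (metis norm_scaleR norm_triangle_ineq)
      thus "norm (q + S n *\<^sub>R h) + d \<le> K" using mult_right_mono[OF S1[of n], of "norm h"] by (simp add: K_def)
      have "0 \<le> S1" using S1[of 0] by linarith
      thus "norm q + d \<le> K" by (simp add: K_def)
    qed
    have int: "integrable lborel (\<lambda>y. mollifier d (x - y) *\<^sub>R u y)" if "norm x + d \<le> K" for x
    proof (rule Bochner_Integration.integrable_bound)
      show "integrable lborel (\<lambda>y. (1 / m) *\<^sub>R indicator (ball 0 K) y *\<^sub>R u y)"
        by (intro integrable_scaleR_right loc_integrableD lu)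
    qed (use mollifier_le_cut[OF d that, of _ u] in \<open>auto simp: m_def\<close>)
    define Q where "Q = (\<lambda>n y. ((bump d (q + S n *\<^sub>R h - y) - bump d (q - y)) / S n) * u y / m)"
    have quot: "(mollify d u (q + S n *\<^sub>R h) - mollify d u q) / S n = (LINT y|lborel. Q n y)" for n
      unfolding mollify_def
      by (subst Bochner_Integration.integral_diff[symmetric, OF int int], rule K, rule K,
          subst Bochner_Integration.integral_divide_zero[symmetric])
         (intro Bochner_Integration.integral_cong refl, simp add: Q_def mollifier_def m_def[symmetric] diff_divide_distrib left_diff_distrib right_diff_distrib mult_ac)
    have lim: "(\<lambda>n. LINT y|lborel. Q n y) \<longlonglongrightarrow> (LINT y|lborel. (dbump d (q - y) \<bullet> h) * u y / m)"
    proof (rule integral_dominated_convergence)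
      show "integrable lborel (\<lambda>y. (B * norm h / m) * norm (indicator (ball 0 K) y *\<^sub>R u y))"
        by (intro integrable_mult_right integrable_norm loc_integrableD lu)
      show "AE y in lborel. norm (Q n y) \<le> (B * norm h / m) * norm (indicator (ball 0 K) y *\<^sub>R u y)" for n
      proof (rule AE_I2)
        fix y
        show "norm (Q n y) \<le> (B * norm h / m) * norm (indicator (ball 0 K) y *\<^sub>R u y)"
        proof (cases "norm y < K")
          case True
          have "\<bar>bump d (q + S n *\<^sub>R h - y) - bump d (q - y)\<bar> / \<bar>S n\<bar> \<le> B * norm h"
            using lip[of "q + S n *\<^sub>R h - y" "q - y"] S0[of n] by (simp add: divide_le_eq mult_ac)
          hence "\<bar>bump d (q + S n *\<^sub>R h - y) - bump d (q - y)\<bar> / \<bar>S n\<bar> * (\<bar>u y\<bar> / m) \<le> B * norm h * (\<bar>u y\<bar> / m)"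
            using m by (intro mult_right_mono) auto
          thus ?thesis using True m by (simp add: Q_def abs_mult)
        next
          case False
          have "d \<le> norm (q + S n *\<^sub>R h - y)" "d \<le> norm (q - y)"
            using K(1)[of n] K(2) False norm_triangle_ineq2[of y q] norm_triangle_ineq2[of y "q + S n *\<^sub>R h"]
            by (auto simp: norm_minus_commute)
          thus ?thesis using False d by (simp add: Q_def bump_eq_0)
        qed
      qed
      show "AE y in lborel. (\<lambda>n. Q n y) \<longlonglongrightarrow> (dbump d (q - y) \<bullet> h) * u y / m"
      proof (rule AE_I2)
        fix y
        have "((\<lambda>k. q - y + k *\<^sub>R h) has_derivative (\<lambda>k. k *\<^sub>R h)) (at 0)"
          by (auto intro!: derivative_eq_intros)
        from has_derivative_compose[OF this bump_has_derivative]
        have "((\<lambda>k. bump d (q - y + k *\<^sub>R h)) has_real_derivative (dbump d (q - y) \<bullet> h)) (at 0)"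
          unfolding has_field_derivative_def by (rule has_derivative_eq_rhs) (auto simp: mult_ac)
        hence "((\<lambda>k. (bump d (q - y + k *\<^sub>R h) - bump d (q - y)) / k) \<longlongrightarrow> dbump d (q - y) \<bullet> h) (at 0)"
          by (simp add: DERIV_def)
        hence "(\<lambda>n. (bump d (q - y + S n *\<^sub>R h) - bump d (q - y)) / S n) \<longlonglongrightarrow> dbump d (q - y) \<bullet> h"
          using S S0 by (auto simp: tendsto_at_iff_sequentially comp_def)
        hence "(\<lambda>n. (bump d (q - y + S n *\<^sub>R h) - bump d (q - y)) / S n * u y / m) \<longlonglongrightarrow> (dbump d (q - y) \<bullet> h) * u y / m"
          using m by (intro tendsto_intros) auto
        thus "(\<lambda>n. Q n y) \<longlonglongrightarrow> (dbump d (q - y) \<bullet> h) * u y / m"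
          by (simp add: Q_def algebra_simps)
      qed
    qed (unfold Q_def, measurable)
    have intd: "integrable lborel (\<lambda>y. u y *\<^sub>R dbump d (q - y))"
    proof (rule Bochner_Integration.integrable_bound)
      show "integrable lborel (\<lambda>y. B *\<^sub>R indicator (ball 0 K) y *\<^sub>R u y)"
        by (intro integrable_scaleR_right loc_integrableD lu)
      show "AE y in lborel. norm (u y *\<^sub>R dbump d (q - y)) \<le> norm (B *\<^sub>R indicator (ball 0 K) y *\<^sub>R u y)"
      proof (rule AE_I2)
        fix y
        show "norm (u y *\<^sub>R dbump d (q - y)) \<le> norm (B *\<^sub>R indicator (ball 0 K) y *\<^sub>R u y)"
        proof (cases "norm y < K")
          case True thus ?thesis using mult_right_mono[OF B[of "q - y"], of "\<bar>u y\<bar>"] B0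
            by (simp add: abs_mult mult.commute)
        next
          case False
          have "d \<le> norm (q - y)"
            using K(2) False norm_triangle_ineq2[of y q] by (auto simp: norm_minus_commute)
          thus ?thesis using False d by (simp add: dbump_eq_0)
        qed
      qed
    qed measurable
    have "(LINT y|lborel. (dbump d (q - y) \<bullet> h) * u y / m) = (LINT y|lborel. u y *\<^sub>R dbump d (q - y)) \<bullet> h / m"
      by (subst integral_inner_left[symmetric]) (use intd in \<open>auto simp: mult_ac\<close>)
    also have "\<dots> = (LINT y|lborel. bump d (q - y) *\<^sub>R g y) \<bullet> h / m"
      using ug d by (simp add: weak_pair_def)
    also have "\<dots> = mollify d g q \<bullet> h"
      unfolding mollify_def mollifier_def m_def[symmetric] divide_inverse
      by (simp add: scaleR_scaleR[symmetric] mult.commute del: scaleR_scaleR)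
    finally show "(\<lambda>n. (mollify d u (q + S n *\<^sub>R h) - mollify d u q) / S n) \<longlonglongrightarrow> mollify d g q \<bullet> h"
      using lim quot by simp
  qed
  hence "((\<lambda>k. (mollify d u (p + (t + k) *\<^sub>R h) - mollify d u (p + t *\<^sub>R h)) / k) \<longlongrightarrow> mollify d g q \<bullet> h) (at 0)"
    by (simp add: q_def algebra_simps)
  thus ?thesis by (simp add: DERIV_def q_def)
qed

section \<open>The Riesz potential estimate\<close>

text \<open>The Riesz kernel \<open>\<bar>z\<bar>\<^sup>1\<^sup>-\<^sup>n\<close>. For \<open>n \<ge> 2\<close> its value at the origin is 0, by the convention for
  division by 0.\<close>

definition riesz :: "real^'n \<Rightarrow> real" where
  "riesz z = 1 / norm z ^ (CARD('n) - 1)"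

lemma riesz_measurable [measurable]: "riesz \<in> borel_measurable borel"
  unfolding riesz_def by measurable

lemma pred_in_ball [measurable (raw)]:
  fixes c y :: "'a \<Rightarrow> 'b::euclidean_space"
  assumes [measurable]: "c \<in> borel_measurable M" "y \<in> borel_measurable M" "r \<in> borel_measurable M"
  shows "Measurable.pred M (\<lambda>w. y w \<in> ball (c w) (r w))"
  unfolding mem_ball by measurable

lemma riesz_nonneg: "0 \<le> riesz z"
  by (simp add: riesz_def)

lemma nn_integral_inverse_power:
  fixes a b :: real
  assumes "0 < a" "a \<le> b" "0 < k"
  shows "(\<integral>\<^sup>+s. ennreal (1 / s ^ Suc k) * indicator {a..b} s \<partial>lborel) = ennreal ((1 / a ^ k - 1 / b ^ k) / real k)"
proof -
  have "(\<integral>\<^sup>+s. ennreal (1 / s ^ Suc k) * indicator {a..b} s \<partial>lborel) = ennreal (- (inverse b ^ k) / real k - (- (inverse a ^ k) / real k))"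
  proof (rule nn_integral_FTC_Icc[where F = "\<lambda>s. - (inverse s ^ k) / real k"])
    fix s assume "s \<in> {a..b}"
    hence "s > 0" using assms by auto
    obtain j where k: "k = Suc j" using \<open>0 < k\<close> by (cases k) auto
    have "((\<lambda>s. - (inverse s ^ k) / real k) has_real_derivative
             - (real k * (- (inverse s ^ Suc (Suc 0)) * inverse s ^ (k - Suc 0))) / real k) (at s)"
      using \<open>s > 0\<close> by (intro DERIV_cdivide DERIV_minus DERIV_power DERIV_inverse) auto
    also have "- (real k * (- (inverse s ^ Suc (Suc 0)) * inverse s ^ (k - Suc 0))) / real k = 1 / s ^ Suc k"
    proof -
      have "- (real k * (- (inverse s ^ Suc (Suc 0)) * inverse s ^ (k - Suc 0))) / real k = inverse s ^ (Suc (Suc 0) + (k - Suc 0))"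
        unfolding power_add using \<open>0 < k\<close> by simp
      also have "Suc (Suc 0) + (k - Suc 0) = Suc k" using \<open>0 < k\<close> by simp
      finally show ?thesis by (simp add: inverse_eq_divide power_one_over)
    qed
    finally show "((\<lambda>s. - (inverse s ^ k) / real k) has_real_derivative 1 / s ^ Suc k) (at s)" .
    show "0 \<le> 1 / s ^ Suc k" using \<open>s > 0\<close> by simp
  qed (use assms in auto)
  also have "- (inverse b ^ k) / real k - (- (inverse a ^ k) / real k) = (1 / a ^ k - 1 / b ^ k) / real k"
    using assms by (simp add: diff_divide_distrib inverse_eq_divide power_one_over)
  finally show ?thesis .
qed

text \<open>Writing \<open>\<bar>z\<bar>\<^sup>1\<^sup>-\<^sup>n = r\<^sup>1\<^sup>-\<^sup>n + (n - 1) \<integral> s\<^sup>-\<^sup>n ds\<close> with \<open>s\<close> ranging from \<open>\<bar>z\<bar>\<close> to \<open>r\<close> expresses the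
  potential at the centre of a ball by the masses of the concentric balls. The density is
  arbitrary: the lemma is applied to the constant 1 and to the integrand of a modular.\<close>

lemma riesz_mass_bound:
  fixes G :: "real^'n \<Rightarrow> ennreal" and x :: "real^'n"
  assumes n: "CARD('n) \<ge> 2" and [measurable]: "G \<in> borel_measurable borel" and "r > 0" "A \<ge> 0"
    and mass: "\<And>\<sigma>. 0 < \<sigma> \<Longrightarrow> \<sigma> \<le> r \<Longrightarrow> (\<integral>\<^sup>+y. indicator (ball x \<sigma>) y * G y \<partial>lborel) \<le> ennreal (A * \<sigma> ^ CARD('n))"
  shows "(\<integral>\<^sup>+y. indicator (ball x r) y * G y * ennreal (riesz (y - x)) \<partial>lborel) \<le> ennreal (real CARD('n) * A * r)"
proof -
  define n where "n = CARD('n)"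
  obtain k where k: "n = Suc k" "k > 0" using n by (cases n) (auto simp: n_def)
  have pw: "indicator (ball x r) y * G y * ennreal (riesz (y - x)) \<le>
      (\<integral>\<^sup>+s. ennreal (real k / s ^ n) * (indicator {0<..r} s * (indicator (ball x s) y * G y)) \<partial>lborel)
        + ennreal (1 / r ^ k) * (indicator (ball x r) y * G y)" for y
  proof (cases "y \<in> ball x r \<and> y \<noteq> x")
    case True
    define \<rho> where "\<rho> = norm (y - x)"
    have \<rho>: "0 < \<rho>" "\<rho> < r" using True by (auto simp: \<rho>_def dist_norm norm_minus_commute)
    have "ennreal ((1 / \<rho> ^ k - 1 / r ^ k)) * G y = (\<integral>\<^sup>+s. ennreal (real k) * (ennreal (1 / s ^ Suc k) * indicator {\<rho>..r} s) \<partial>lborel) * G y"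
      using nn_integral_inverse_power[of \<rho> r k] \<rho> k by (simp add: nn_integral_cmult power_mono frac_le flip: ennreal_mult)
    also have "\<dots> = (\<integral>\<^sup>+s. ennreal (real k) * (ennreal (1 / s ^ Suc k) * indicator {\<rho>..r} s) * G y \<partial>lborel)"
      by (intro nn_integral_multc[symmetric]) auto
    also have "\<dots> \<le> (\<integral>\<^sup>+s. ennreal (real k / s ^ n) * (indicator {0<..r} s * (indicator (ball x s) y * G y)) \<partial>lborel)"
    proof (rule nn_integral_mono_AE)
      have "AE s in lborel. s \<noteq> \<rho>" by (rule AE_lborel_singleton)
      thus "AE s in lborel. ennreal (real k) * (ennreal (1 / s ^ Suc k) * indicator {\<rho>..r} s) * G y
          \<le> ennreal (real k / s ^ n) * (indicator {0<..r} s * (indicator (ball x s) y * G y))"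
      proof eventually_elim
        case (elim s)
        show ?case
        proof (cases "s \<in> {\<rho>..r}")
          case True
          hence "s > \<rho>" "s > 0" using elim \<rho> by auto
          hence "y \<in> ball x s" by (auto simp: \<rho>_def dist_norm norm_minus_commute)
          moreover have "ennreal (real k) * ennreal (1 / s ^ Suc k) = ennreal (real k / s ^ n)"
            using \<open>s > 0\<close> by (simp add: k(1) flip: ennreal_mult)
          ultimately show ?thesis using True \<open>s > 0\<close> by (simp add: mult_ac)
        qed simp
      qed
    qed
    finally have *: "ennreal ((1 / \<rho> ^ k - 1 / r ^ k)) * G y \<le> \<dots>" .
    have "ennreal (riesz (y - x)) = ennreal (1 / \<rho> ^ k - 1 / r ^ k) + ennreal (1 / r ^ k)"
      using \<rho> k n_def by (subst ennreal_plus[symmetric]) (auto simp: riesz_def \<rho>_def[symmetric] power_mono frac_le)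
    hence "indicator (ball x r) y * G y * ennreal (riesz (y - x)) =
        ennreal (1 / \<rho> ^ k - 1 / r ^ k) * G y + ennreal (1 / r ^ k) * (indicator (ball x r) y * G y)"
      using True by (simp add: distrib_right distrib_left mult.commute)
    also have "\<dots> \<le> (\<integral>\<^sup>+s. ennreal (real k / s ^ n) * (indicator {0<..r} s * (indicator (ball x s) y * G y)) \<partial>lborel)
        + ennreal (1 / r ^ k) * (indicator (ball x r) y * G y)"
      by (intro add_mono * order_refl)
    finally show ?thesis .
  next
    case False
    moreover have "riesz (0 :: real^'n) = 0" using k n_def by (simp add: riesz_def)
    ultimately show ?thesis by (cases "y = x") auto
  qed
  have "(\<integral>\<^sup>+y. indicator (ball x r) y * G y * ennreal (riesz (y - x)) \<partial>lborel)
      \<le> (\<integral>\<^sup>+y. (\<integral>\<^sup>+s. ennreal (real k / s ^ n) * (indicator {0<..r} s * (indicator (ball x s) y * G y)) \<partial>lborel)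
        + ennreal (1 / r ^ k) * (indicator (ball x r) y * G y) \<partial>lborel)"
    by (intro nn_integral_mono pw)
  also have "\<dots> = (\<integral>\<^sup>+y. (\<integral>\<^sup>+s. ennreal (real k / s ^ n) * (indicator {0<..r} s * (indicator (ball x s) y * G y)) \<partial>lborel) \<partial>lborel)
        + (\<integral>\<^sup>+y. ennreal (1 / r ^ k) * (indicator (ball x r) y * G y) \<partial>lborel)"
    by (intro nn_integral_add) measurable
  also have "(\<integral>\<^sup>+y. (\<integral>\<^sup>+s. ennreal (real k / s ^ n) * (indicator {0<..r} s * (indicator (ball x s) y * G y)) \<partial>lborel) \<partial>lborel)
      = (\<integral>\<^sup>+s. (\<integral>\<^sup>+y. ennreal (real k / s ^ n) * (indicator {0<..r} s * (indicator (ball x s) y * G y)) \<partial>lborel) \<partial>lborel)"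
    by (intro lborel_pair.Fubini') measurable
  also have "\<dots> = (\<integral>\<^sup>+s. ennreal (real k / s ^ n) * (indicator {0<..r} s * (\<integral>\<^sup>+y. indicator (ball x s) y * G y \<partial>lborel)) \<partial>lborel)"
    by (intro nn_integral_cong) (simp add: nn_integral_cmult)
  also have "\<dots> \<le> (\<integral>\<^sup>+s. ennreal (real k * A) * indicator {0<..r} s \<partial>lborel)"
  proof (intro nn_integral_mono)
    fix s
    show "ennreal (real k / s ^ n) * (indicator {0<..r} s * (\<integral>\<^sup>+y. indicator (ball x s) y * G y \<partial>lborel))
       \<le> ennreal (real k * A) * indicator {0<..r} s"
    proof (cases "s \<in> {0<..r}")
      case True
      have "ennreal (real k / s ^ n) * (\<integral>\<^sup>+y. indicator (ball x s) y * G y \<partial>lborel) \<le> ennreal (real k / s ^ n) * ennreal (A * s ^ n)"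
        using mass[of s] True by (intro mult_left_mono) (auto simp: n_def)
      also have "\<dots> = ennreal (real k * A)" using True \<open>A \<ge> 0\<close> by (simp flip: ennreal_mult)
      finally show ?thesis using True by simp
    qed simp
  qed
  also have "\<dots> = ennreal (real k * A * r)"
    using \<open>r > 0\<close> \<open>A \<ge> 0\<close> by (simp add: nn_integral_cmult_indicator flip: ennreal_mult)
  also have "(\<integral>\<^sup>+y. ennreal (1 / r ^ k) * (indicator (ball x r) y * G y) \<partial>lborel) = ennreal (1 / r ^ k) * (\<integral>\<^sup>+y. indicator (ball x r) y * G y \<partial>lborel)"
    by (intro nn_integral_cmult) measurable
  also have "\<dots> \<le> ennreal (1 / r ^ k) * ennreal (A * r ^ n)"
    using mass[of r] \<open>r > 0\<close> by (intro mult_left_mono) (auto simp: n_def)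
  also have "\<dots> = ennreal (A * r)" using \<open>r > 0\<close> \<open>A \<ge> 0\<close> k by (simp flip: ennreal_mult)
  also have "ennreal (real k * A * r) + ennreal (A * r) = ennreal (real CARD('n) * A * r)"
    using \<open>r > 0\<close> \<open>A \<ge> 0\<close> k n_def by (simp add: algebra_simps flip: ennreal_plus)
  finally show ?thesis by (simp add: add_mono)
qed

lemma riesz_ball_bound:
  fixes x :: "real^'n"
  assumes n: "CARD('n) \<ge> 2" and "r > 0"
  shows "(\<integral>\<^sup>+y. indicator (ball x r) y * ennreal (riesz (y - x)) \<partial>lborel)
          \<le> ennreal (real CARD('n) * unit_ball_vol (real CARD('n)) * r)"
proof -
  have "(\<integral>\<^sup>+y. indicator (ball x \<sigma>) y * (1::ennreal) \<partial>lborel) \<le> ennreal (unit_ball_vol (real CARD('n)) * \<sigma> ^ CARD('n))"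
    if "0 < \<sigma>" for \<sigma> using that by (simp add: emeasure_ball)
  thus ?thesis using riesz_mass_bound[OF n, of "\<lambda>_. 1" r "unit_ball_vol (real CARD('n))" x] \<open>r > 0\<close> by simp
qed

text \<open>Substitute \<open>y = x + s (z - x)\<close> for fixed \<open>s\<close> and exchange the integrals. The remaining integral of
  \<open>s\<^sup>-\<^sup>n\<^sup>-\<^sup>1\<close> over \<open>s \<ge> \<bar>y - x\<bar> / R\<close> produces the kernel.\<close>

lemma ball_segment_potential:
  fixes F :: "real^'n \<Rightarrow> ennreal" and x :: "real^'n"
  assumes n: "CARD('n) \<ge> 2" and [measurable]: "F \<in> borel_measurable borel" and "R > 0"
  shows "(\<integral>\<^sup>+z. indicator (ball x R) z * (\<integral>\<^sup>+s. indicator {0..1} s * (F (x + s *\<^sub>R (z - x)) * ennreal (norm (z - x))) \<partial>lborel) \<partial>lborel)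
     \<le> ennreal (R ^ CARD('n) / real CARD('n)) * (\<integral>\<^sup>+y. indicator (ball x R) y * (F y * ennreal (riesz (y - x))) \<partial>lborel)"
proof -
  define n where "n = CARD('n)"
  have n0: "n > 0" by (simp add: n_def)
  have "(\<integral>\<^sup>+z. indicator (ball x R) z * (\<integral>\<^sup>+s. indicator {0..1} s * (F (x + s *\<^sub>R (z - x)) * ennreal (norm (z - x))) \<partial>lborel) \<partial>lborel)
     = (\<integral>\<^sup>+z. (\<integral>\<^sup>+s. indicator (ball x R) z * (indicator {0..1} s * (F (x + s *\<^sub>R (z - x)) * ennreal (norm (z - x)))) \<partial>lborel) \<partial>lborel)"
    by (intro nn_integral_cong nn_integral_cmult[symmetric]) measurable
  also have "\<dots> = (\<integral>\<^sup>+s. (\<integral>\<^sup>+z. indicator (ball x R) z * (indicator {0..1} s * (F (x + s *\<^sub>R (z - x)) * ennreal (norm (z - x)))) \<partial>lborel) \<partial>lborel)"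
    by (intro lborel_pair.Fubini') measurable
  also have "\<dots> = (\<integral>\<^sup>+s. indicator {0..1} s * (\<integral>\<^sup>+z. indicator (ball x R) z * (F (x + s *\<^sub>R (z - x)) * ennreal (norm (z - x))) \<partial>lborel) \<partial>lborel)"
    by (intro nn_integral_cong) (simp add: nn_integral_cmult[symmetric] mult_ac)
  also have "\<dots> = (\<integral>\<^sup>+s. indicator {0<..1} s * (\<integral>\<^sup>+y. indicator (ball x (s * R)) y * (F y * ennreal (norm (y - x))) * ennreal (1 / s ^ Suc n) \<partial>lborel) \<partial>lborel)"
  proof (rule nn_integral_cong_AE)
    have "AE s in lborel. s \<noteq> (0::real)" by (rule AE_lborel_singleton)
    thus "AE s in lborel. indicator {0..1} s * (\<integral>\<^sup>+z. indicator (ball x R) z * (F (x + s *\<^sub>R (z - x)) * ennreal (norm (z - x))) \<partial>lborel)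
       = indicator {0<..1} s * (\<integral>\<^sup>+y. indicator (ball x (s * R)) y * (F y * ennreal (norm (y - x))) * ennreal (1 / s ^ Suc n) \<partial>lborel)"
    proof eventually_elim
      case (elim s)
      show ?case
      proof (cases "s \<in> {0<..1}")
        case True
        hence s: "s > 0" by simp
        let ?G = "\<lambda>y. indicator (ball x (s * R)) y * (F y * ennreal (norm (y - x))) * ennreal (1 / s ^ Suc n)"
        have "(\<integral>\<^sup>+y. ?G y \<partial>lborel) = (\<integral>\<^sup>+y. ?G y \<partial>density (distr lborel borel (\<lambda>z. (x - s *\<^sub>R x) + s *\<^sub>R z)) (\<lambda>_. ennreal (\<bar>s\<bar> ^ DIM(real^'n))))"
          using s by (subst lborel_affine[of s "x - s *\<^sub>R x", symmetric]) auto
        also have "\<dots> = (\<integral>\<^sup>+z. ennreal (s ^ n) * ?G (x - s *\<^sub>R x + s *\<^sub>R z) \<partial>lborel)"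
          using s by (simp add: nn_integral_density nn_integral_distr n_def)
        also have "\<dots> = (\<integral>\<^sup>+z. indicator (ball x R) z * (F (x + s *\<^sub>R (z - x)) * ennreal (norm (z - x))) \<partial>lborel)"
        proof (intro nn_integral_cong)
          fix z
          have e1: "x - s *\<^sub>R x + s *\<^sub>R z = x + s *\<^sub>R (z - x)" by (simp add: algebra_simps)
          have e2: "indicator (ball x (s * R)) (x + s *\<^sub>R (z - x)) = (indicator (ball x R) z :: ennreal)"
            using s by (auto simp: indicator_def dist_norm norm_minus_commute)
          have e3: "norm (x + s *\<^sub>R (z - x) - x) = s * norm (z - x)" using s by simp
          have e4: "ennreal (s ^ n) * (ennreal (s * norm (z - x)) * ennreal (1 / s ^ Suc n)) = ennreal (norm (z - x))"
            using s by (simp flip: ennreal_mult)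
          show "ennreal (s ^ n) * ?G (x - s *\<^sub>R x + s *\<^sub>R z) = indicator (ball x R) z * (F (x + s *\<^sub>R (z - x)) * ennreal (norm (z - x)))"
            unfolding e1 e2 e3 e4[symmetric] by (simp add: mult_ac)
        qed
        finally show ?thesis using True by simp
      next
        case False
        thus ?thesis using elim by auto
      qed
    qed
  qed
  also have "\<dots> = (\<integral>\<^sup>+s. (\<integral>\<^sup>+y. indicator {0<..1} s * (indicator (ball x (s * R)) y * (F y * ennreal (norm (y - x))) * ennreal (1 / s ^ Suc n)) \<partial>lborel) \<partial>lborel)"
    by (intro nn_integral_cong nn_integral_cmult[symmetric]) measurable
  also have "\<dots> = (\<integral>\<^sup>+y. (\<integral>\<^sup>+s. indicator {0<..1} s * (indicator (ball x (s * R)) y * (F y * ennreal (norm (y - x))) * ennreal (1 / s ^ Suc n)) \<partial>lborel) \<partial>lborel)"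
    by (intro lborel_pair.Fubini'[symmetric]) measurable
  also have "\<dots> \<le> (\<integral>\<^sup>+y. ennreal (R ^ n / real n) * (indicator (ball x R) y * (F y * ennreal (riesz (y - x)))) \<partial>lborel)"
  proof (intro nn_integral_mono)
    fix y
    define \<rho> where "\<rho> = norm (y - x)"
    define c where "c = \<rho> / R"
    show "(\<integral>\<^sup>+s. indicator {0<..1} s * (indicator (ball x (s * R)) y * (F y * ennreal (norm (y - x))) * ennreal (1 / s ^ Suc n)) \<partial>lborel)
        \<le> ennreal (R ^ n / real n) * (indicator (ball x R) y * (F y * ennreal (riesz (y - x))))"
    proof (cases "0 < c \<and> c < 1")
      case True
      have \<rho>: "0 < \<rho>" "\<rho> < R" using True \<open>R > 0\<close> by (auto simp: c_def zero_less_divide_iff)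
      have "(\<integral>\<^sup>+s. indicator {0<..1} s * (indicator (ball x (s * R)) y * (F y * ennreal (norm (y - x))) * ennreal (1 / s ^ Suc n)) \<partial>lborel)
         \<le> (\<integral>\<^sup>+s. (F y * ennreal \<rho>) * (ennreal (1 / s ^ Suc n) * indicator {c..1} s) \<partial>lborel)"
      proof (intro nn_integral_mono)
        fix s
        have "s \<in> {0<..1} \<Longrightarrow> y \<in> ball x (s * R) \<Longrightarrow> s \<in> {c..1}"
          using \<open>R > 0\<close> by (auto simp: c_def \<rho>_def dist_norm norm_minus_commute divide_le_eq less_imp_le)
        thus "indicator {0<..1} s * (indicator (ball x (s * R)) y * (F y * ennreal (norm (y - x))) * ennreal (1 / s ^ Suc n))
           \<le> (F y * ennreal \<rho>) * (ennreal (1 / s ^ Suc n) * indicator {c..1} s)"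
          by (auto simp: indicator_def \<rho>_def mult_ac)
      qed
      also have "\<dots> = (F y * ennreal \<rho>) * (\<integral>\<^sup>+s. (ennreal (1 / s ^ Suc n) * indicator {c..1} s) \<partial>lborel)"
        by (intro nn_integral_cmult) auto
      also have "\<dots> = (F y * ennreal \<rho>) * ennreal ((1 / c ^ n - 1 / 1 ^ n) / real n)"
        using True n0 by (subst nn_integral_inverse_power) auto
      also have "\<dots> \<le> (F y * ennreal \<rho>) * ennreal ((1 / c ^ n) / real n)"
        using n0 by (intro mult_left_mono ennreal_leI divide_right_mono) auto
      also have "\<dots> = F y * ennreal (\<rho> * ((1 / c ^ n) / real n))"
        using \<rho> True by (subst ennreal_mult) (auto simp: mult_ac)
      also have "\<rho> * ((1 / c ^ n) / real n) = R ^ n / real n * riesz (y - x)"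
      proof -
        obtain k where "n = Suc k" using n0 by (cases n) auto
        thus ?thesis using \<rho> by (simp add: c_def riesz_def \<rho>_def[symmetric] n_def[symmetric] power_divide)
      qed
      also have "F y * ennreal (R ^ n / real n * riesz (y - x)) = ennreal (R ^ n / real n) * (F y * ennreal (riesz (y - x)))"
        using \<open>R > 0\<close> by (subst ennreal_mult) (auto simp: riesz_nonneg mult_ac)
      also have "\<dots> = ennreal (R ^ n / real n) * (indicator (ball x R) y * (F y * ennreal (riesz (y - x))))"
        using \<rho> by (simp add: \<rho>_def dist_norm norm_minus_commute)
      finally show ?thesis .
    next
      case False
      have z: "indicator {0<..1} s * (indicator (ball x (s * R)) y * (F y * ennreal (norm (y - x))) * ennreal (1 / s ^ Suc n)) = 0" for s
      proof (cases "y = x")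
        case y: False
        hence "c > 0" using \<open>R > 0\<close> by (simp add: c_def \<rho>_def)
        hence "1 \<le> c" using False by auto
        hence "R \<le> \<rho>" using \<open>R > 0\<close> by (simp add: c_def)
        moreover have "s * R \<le> R" if "s \<le> 1" using \<open>R > 0\<close> that by simp
        ultimately show ?thesis by (auto simp: indicator_def \<rho>_def dist_norm norm_minus_commute)
      qed simp
      show ?thesis unfolding z by simp
    qed
  qed
  also have "\<dots> = ennreal (R ^ n / real n) * (\<integral>\<^sup>+y. indicator (ball x R) y * (F y * ennreal (riesz (y - x))) \<partial>lborel)"
    by (intro nn_integral_cmult) measurable
  finally show ?thesis by (simp add: n_def)
qed

text \<open>The fundamental theorem of calculus on the segments that issue from \<open>x\<close>.\<close>

lemma smooth_potential_estimate:
  fixes u :: "real^'n \<Rightarrow> real"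
  assumes n: "CARD('n) \<ge> 2" and ug: "weak_pair u g" and d: "d > 0" and "R > 0"
    and T: "\<And>t. (T has_real_derivative T' t) (at t)" and T': "continuous_on UNIV T'"
  shows "(\<integral>\<^sup>+z. indicator (ball x R) z * ennreal \<bar>T (mollify d u z) - T (mollify d u x)\<bar> \<partial>lborel)
     \<le> ennreal (R ^ CARD('n) / real CARD('n)) *
       (\<integral>\<^sup>+y. indicator (ball x R) y * (ennreal (\<bar>T' (mollify d u y)\<bar> * norm (mollify d g y)) * ennreal (riesz (y - x))) \<partial>lborel)"
proof -
  have cu: "continuous_on UNIV (mollify d u)" and cg: "continuous_on UNIV (mollify d g)"
    using ug d continuous_mollify by (auto simp: weak_pair_def)
  define F where "F = (\<lambda>y. \<bar>T' (mollify d u y)\<bar> * norm (mollify d g y))"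
  have cF: "continuous_on UNIV F" unfolding F_def
    by (intro continuous_intros cg continuous_on_compose2[OF T' cu]) auto
  hence [measurable]: "F \<in> borel_measurable borel" by (rule borel_measurable_continuous_onI)
  have seg: "ennreal \<bar>T (mollify d u z) - T (mollify d u x)\<bar>
     \<le> (\<integral>\<^sup>+s. indicator {0..1} s * (ennreal (F (x + s *\<^sub>R (z - x))) * ennreal (norm (z - x))) \<partial>lborel)" for z
  proof -
    define v where "v = (\<lambda>s. T (mollify d u (x + s *\<^sub>R (z - x))))"
    define v' where "v' = (\<lambda>s. T' (mollify d u (x + s *\<^sub>R (z - x))) * (mollify d g (x + s *\<^sub>R (z - x)) \<bullet> (z - x)))"
    have dv: "(v has_real_derivative v' s) (at s)" for s
      unfolding v_def v'_def by (intro DERIV_chain2[OF T] mollify_has_derivative_line ug d)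
    have cv': "continuous_on UNIV v'" unfolding v'_def
      by (intro continuous_intros continuous_on_compose2[OF T'] continuous_on_compose2[OF cu] continuous_on_compose2[OF cg]) auto
    have hb: "has_bochner_integral lborel (\<lambda>s. v' s * indicator {0..1} s) (v 1 - v 0)"
      using dv cv' by (intro has_bochner_integral_FTC_Icc_real) (auto simp: continuous_on_eq_continuous_at)
    have "ennreal \<bar>T (mollify d u z) - T (mollify d u x)\<bar> = ennreal (norm (v 1 - v 0))"
      by (simp add: v_def)
    also have "\<dots> \<le> (\<integral>\<^sup>+s. ennreal (norm (v' s * indicator {0..1} s)) \<partial>lborel)"
      by (rule has_bochner_integral_norm_bound[OF hb])
    also have "\<dots> \<le> (\<integral>\<^sup>+s. indicator {0..1} s * (ennreal (F (x + s *\<^sub>R (z - x))) * ennreal (norm (z - x))) \<partial>lborel)"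
    proof (intro nn_integral_mono)
      fix s :: real
      have "norm (v' s) \<le> F (x + s *\<^sub>R (z - x)) * norm (z - x)"
        unfolding v'_def F_def abs_mult real_norm_def mult.assoc
        by (intro mult_left_mono Cauchy_Schwarz_ineq2) auto
      thus "ennreal (norm (v' s * indicator {0..1} s)) \<le> indicator {0..1} s * (ennreal (F (x + s *\<^sub>R (z - x))) * ennreal (norm (z - x)))"
        by (auto simp: indicator_def ennreal_mult''[symmetric] intro!: ennreal_leI)
    qed
    finally show ?thesis .
  qed
  have "(\<integral>\<^sup>+z. indicator (ball x R) z * ennreal \<bar>T (mollify d u z) - T (mollify d u x)\<bar> \<partial>lborel)
    \<le> (\<integral>\<^sup>+z. indicator (ball x R) z * (\<integral>\<^sup>+s. indicator {0..1} s * (ennreal (F (x + s *\<^sub>R (z - x))) * ennreal (norm (z - x))) \<partial>lborel) \<partial>lborel)"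
    by (intro nn_integral_mono mult_left_mono seg) auto
  also have "\<dots> \<le> ennreal (R ^ CARD('n) / real CARD('n)) * (\<integral>\<^sup>+y. indicator (ball x R) y * (ennreal (F y) * ennreal (riesz (y - x))) \<partial>lborel)"
    by (intro ball_segment_potential n \<open>R > 0\<close>) measurable
  finally show ?thesis by (simp add: F_def)
qed

text \<open>The sum of the functions is integrable, hence finite almost everywhere.\<close>

lemma AE_tendsto_0_geometric:
  fixes F :: "nat \<Rightarrow> 'a \<Rightarrow> ennreal"
  assumes [measurable]: "\<And>j. F j \<in> borel_measurable M"
    and bd: "\<And>j. (\<integral>\<^sup>+x. F j x \<partial>M) \<le> ennreal (C * (1/2) ^ j)" and "C \<ge> 0"
  shows "AE x in M. (\<lambda>j. F j x) \<longlonglongrightarrow> 0"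
proof -
  have "(\<integral>\<^sup>+x. (\<Sum>j. F j x) \<partial>M) = (\<Sum>j. \<integral>\<^sup>+x. F j x \<partial>M)"
    by (intro nn_integral_suminf) measurable
  also have "\<dots> \<le> (\<Sum>j. ennreal (C * (1/2) ^ j))"
    by (intro suminf_le bd) auto
  also have "\<dots> < \<infinity>"
    using \<open>C \<ge> 0\<close> by (subst suminf_ennreal2) (auto intro!: summable_mult summable_geometric)
  finally have "AE x in M. (\<Sum>j. F j x) \<noteq> \<infinity>"
    by (intro nn_integral_PInf_AE) auto
  thus ?thesis
  proof eventually_elim
    case (elim x)
    hence fin: "F j x \<noteq> top" for j
      using sum_le_suminf[of "\<lambda>j. F j x" "{j}"] by (auto simp: top_unique)
    have eq: "F j x = ennreal (enn2real (F j x))" for j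
      using fin[of j] by (simp add: less_top)
    have "(\<Sum>j. ennreal (enn2real (F j x))) \<noteq> \<infinity>" using elim by (simp flip: eq)
    hence "summable (\<lambda>j. enn2real (F j x))"
      by (intro summable_suminf_not_top) auto
    from tendsto_ennrealI[OF summable_LIMSEQ_zero[OF this]]
    show ?case by (simp flip: eq)
  qed
qed

text \<open>The mollification parameters are chosen so that the errors on growing balls are summable. Then
  there is convergence almost everywhere along the whole sequence, also after applying a potential.\<close>

lemma mollify_sequence:
  fixes u :: "real^'n \<Rightarrow> 'a::euclidean_space" and g :: "real^'n \<Rightarrow> 'b::euclidean_space"
  assumes u: "loc_integrable u" and g: "loc_integrable g"
  obtains d :: "nat \<Rightarrow> real" where "\<And>j. d j > 0"
    "\<And>j. (\<integral>\<^sup>+x. indicator (ball 0 (real j)) x * ennreal (norm (mollify (d j) u x - u x)) \<partial>lborel) \<le> ennreal ((1/2) ^ j)"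
    "\<And>j. (\<integral>\<^sup>+x. indicator (ball 0 (real j)) x * ennreal (norm (mollify (d j) g x - g x)) \<partial>lborel) \<le> ennreal ((1/2) ^ j)"
proof -
  define I1 where "I1 = (\<lambda>j d. (\<integral>\<^sup>+x. indicator (ball 0 (real j)) x * ennreal (norm (mollify d u x - u x)) \<partial>lborel))"
  define I2 where "I2 = (\<lambda>j d. (\<integral>\<^sup>+x. indicator (ball 0 (real j)) x * ennreal (norm (mollify d g x - g x)) \<partial>lborel))"
  have "\<exists>d>0. I1 j d \<le> ennreal ((1/2) ^ j) \<and> I2 j d \<le> ennreal ((1/2) ^ j)" for j :: nat
  proof -
    have e: "(1/2 :: real) ^ j > 0" by simp
    from L1_mollify_loc[OF u e, of "real j"] obtain d1 where
      d1: "d1 > 0" "\<And>d. 0 < d \<Longrightarrow> d < d1 \<Longrightarrow> I1 j d \<le> ennreal ((1/2) ^ j)"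
      unfolding I1_def by blast
    from L1_mollify_loc[OF g e, of "real j"] obtain d2 where
      d2: "d2 > 0" "\<And>d. 0 < d \<Longrightarrow> d < d2 \<Longrightarrow> I2 j d \<le> ennreal ((1/2) ^ j)"
      unfolding I2_def by blast
    have "0 < min d1 d2 / 2" "min d1 d2 / 2 < d1" "min d1 d2 / 2 < d2" using d1(1) d2(1) by auto
    thus ?thesis by (intro exI[of _ "min d1 d2 / 2"] conjI d1(2) d2(2))
  qed
  then obtain d where "\<And>j. 0 < d j \<and> I1 j (d j) \<le> ennreal ((1/2) ^ j) \<and> I2 j (d j) \<le> ennreal ((1/2) ^ j)"
    by metis
  thus thesis unfolding I1_def I2_def by (intro that[of d]) blast+
qed

lemma mollify_measurable:
  "loc_integrable f \<Longrightarrow> d > 0 \<Longrightarrow> mollify d f \<in> borel_measurable borel"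
  by (intro borel_measurable_continuous_onI continuous_mollify)

lemma AE_tendsto_of_balls:
  fixes f :: "real^'n \<Rightarrow> 'b::euclidean_space"
  assumes [measurable]: "f \<in> borel_measurable borel" "\<And>j. w j \<in> borel_measurable borel"
    and bd: "\<And>j. (\<integral>\<^sup>+x. indicator (ball 0 (real j)) x * ennreal (norm (w j x - f x)) \<partial>lborel) \<le> ennreal ((1/2) ^ j)"
  shows "AE x in lborel. (\<lambda>j. w j x) \<longlonglongrightarrow> f x"
proof -
  have "AE x in lborel. (\<lambda>j. indicator (ball 0 (real j)) x * ennreal (norm (w j x - f x))) \<longlonglongrightarrow> 0"
    by (intro AE_tendsto_0_geometric[where C=1]) (use bd in auto)
  thus ?thesis
  proof eventually_elim
    case (elim x)
    have "eventually (\<lambda>j. norm x < real j) sequentially"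
      using eventually_gt_at_top[of "nat \<lceil>norm x\<rceil>"] by eventually_elim linarith
    hence "eventually (\<lambda>j. indicator (ball 0 (real j)) x * ennreal (norm (w j x - f x)) = ennreal (norm (w j x - f x))) sequentially"
      by eventually_elim simp
    from iffD1[OF tendsto_cong[OF this] elim]
    have "(\<lambda>j. ennreal (norm (w j x - f x))) \<longlonglongrightarrow> ennreal 0" by simp
    hence "(\<lambda>j. norm (w j x - f x)) \<longlonglongrightarrow> 0"
      by (rule tendsto_ennrealD) auto
    thus ?case by (rule LIM_zero_cancel[OF tendsto_norm_zero_cancel])
  qed
qed

lemma riesz_potential_L1:
  fixes G :: "real^'n \<Rightarrow> ennreal"
  assumes n: "CARD('n) \<ge> 2" and [measurable]: "G \<in> borel_measurable borel" and "R > 0"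
  shows "(\<integral>\<^sup>+x. indicator (ball 0 K) x * (\<integral>\<^sup>+y. indicator (ball x R) y * (G y * ennreal (riesz (y - x))) \<partial>lborel) \<partial>lborel)
      \<le> ennreal (real CARD('n) * unit_ball_vol (real CARD('n)) * R) * (\<integral>\<^sup>+y. indicator (ball 0 (K + R)) y * G y \<partial>lborel)"
proof -
  let ?C = "real CARD('n) * unit_ball_vol (real CARD('n)) * R"
  have "(\<integral>\<^sup>+x. indicator (ball 0 K) x * (\<integral>\<^sup>+y. indicator (ball x R) y * (G y * ennreal (riesz (y - x))) \<partial>lborel) \<partial>lborel)
     = (\<integral>\<^sup>+x. (\<integral>\<^sup>+y. indicator (ball 0 K) x * (indicator (ball x R) y * (G y * ennreal (riesz (y - x)))) \<partial>lborel) \<partial>lborel)"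
    by (intro nn_integral_cong nn_integral_cmult[symmetric]) measurable
  also have "\<dots> = (\<integral>\<^sup>+y. (\<integral>\<^sup>+x. indicator (ball 0 K) x * (indicator (ball x R) y * (G y * ennreal (riesz (y - x)))) \<partial>lborel) \<partial>lborel)"
    by (intro lborel_pair.Fubini') measurable
  also have "\<dots> \<le> (\<integral>\<^sup>+y. (\<integral>\<^sup>+x. (indicator (ball 0 (K + R)) y * G y) * (indicator (ball y R) x * ennreal (riesz (x - y))) \<partial>lborel) \<partial>lborel)"
  proof (intro nn_integral_mono)
    fix x y :: "real^'n"
    have "norm y < K + R" if "norm x < K" "norm (x - y) < R"
      using that norm_triangle_ineq2[of y x] by (simp add: norm_minus_commute)
    moreover have "riesz (y - x) = riesz (x - y)" by (simp add: riesz_def norm_minus_commute)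
    ultimately show "indicator (ball 0 K) x * (indicator (ball x R) y * (G y * ennreal (riesz (y - x))))
       \<le> (indicator (ball 0 (K + R)) y * G y) * (indicator (ball y R) x * ennreal (riesz (x - y)))"
      by (auto simp: indicator_def dist_norm norm_minus_commute)
  qed
  also have "\<dots> = (\<integral>\<^sup>+y. (indicator (ball 0 (K + R)) y * G y) * (\<integral>\<^sup>+x. (indicator (ball y R) x * ennreal (riesz (x - y))) \<partial>lborel) \<partial>lborel)"
    by (intro nn_integral_cong nn_integral_cmult) measurable
  also have "\<dots> \<le> (\<integral>\<^sup>+y. (indicator (ball 0 (K + R)) y * G y) * ennreal ?C \<partial>lborel)"
    by (intro nn_integral_mono mult_left_mono riesz_ball_bound n \<open>R > 0\<close>) auto
  also have "\<dots> = ennreal ?C * (\<integral>\<^sup>+y. (indicator (ball 0 (K + R)) y * G y) \<partial>lborel)"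
    by (subst nn_integral_multc) (auto simp: mult.commute)
  finally show ?thesis .
qed

text \<open>The limit of \<open>smooth_potential_estimate\<close> along a mollifying sequence \<open>v\<^sub>j \<rightarrow> u\<close>, \<open>V\<^sub>j \<rightarrow> g\<close>: Fatou's lemma
  for the left hand side; on the right, dominated convergence handles \<open>T'(v\<^sub>j) \<bar>g\<bar>\<close>, and the
  potential of the error \<open>\<bar>V\<^sub>j - g\<bar>\<close> tends to 0 almost everywhere, because its \<open>L\<^sup>1\<close> norms on balls
  are summable. Keeping the derivative of \<open>T\<close> on the right spares a chain rule for weak derivatives.\<close>

lemma weak_potential_estimate:
  fixes u :: "real^'n \<Rightarrow> real"
  assumes n: "CARD('n) \<ge> 2" and ug: "weak_pair u g" and R: "R > 0"
    and T: "\<And>t. (T has_real_derivative T' t) (at t)" and T': "continuous_on UNIV T'"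
    and M: "\<And>t. \<bar>T' t\<bar> \<le> M"
  shows "AE x in lborel.
     (\<integral>\<^sup>+z. indicator (ball x R) z * ennreal \<bar>T (u z) - T (u x)\<bar> \<partial>lborel)
     \<le> ennreal (R ^ CARD('n) / real CARD('n)) *
       (\<integral>\<^sup>+y. indicator (ball x R) y * (ennreal (\<bar>T' (u y)\<bar> * norm (g y)) * ennreal (riesz (y - x))) \<partial>lborel)"
proof -
  have lu: "loc_integrable u" and lg: "loc_integrable g" using ug by (auto simp: weak_pair_def)
  note [measurable] = loc_integrable_measurable[OF lu] loc_integrable_measurable[OF lg]
  have M0: "M \<ge> 0" using M[of 0] by linarith
  have [measurable]: "T' \<in> borel_measurable borel" by (rule borel_measurable_continuous_onI[OF T'])
  have cT: "continuous_on UNIV T" using T by (intro DERIV_continuous_on) auto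
  hence [measurable]: "T \<in> borel_measurable borel" by (rule borel_measurable_continuous_onI)
  obtain d :: "nat \<Rightarrow> real" where d: "\<And>j. d j > 0"
    "\<And>j. (\<integral>\<^sup>+x. indicator (ball 0 (real j)) x * ennreal (norm (mollify (d j) u x - u x)) \<partial>lborel) \<le> ennreal ((1/2) ^ j)"
    "\<And>j. (\<integral>\<^sup>+x. indicator (ball 0 (real j)) x * ennreal (norm (mollify (d j) g x - g x)) \<partial>lborel) \<le> ennreal ((1/2) ^ j)"
    using mollify_sequence[OF lu lg] by blast
  define v where "v = (\<lambda>j. mollify (d j) u)"
  define V where "V = (\<lambda>j. mollify (d j) g)"
  have [measurable]: "v j \<in> borel_measurable borel" "V j \<in> borel_measurable borel" for j
    using d(1) lu lg by (auto simp: v_def V_def mollify_measurable)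
  have v_lim: "AE x in lborel. (\<lambda>j. v j x) \<longlonglongrightarrow> u x"
    using d(2) by (intro AE_tendsto_of_balls) (measurable, simp add: v_def)
  let ?C = "real CARD('n) * unit_ball_vol (real CARD('n)) * R"
  have C: "?C \<ge> 0" using R by simp
  define P where "P = (\<lambda>(G :: real^'n \<Rightarrow> ennreal) x. (\<integral>\<^sup>+y. indicator (ball x R) y * (G y * ennreal (riesz (y - x))) \<partial>lborel))"
  have P_meas [measurable]: "P G \<in> borel_measurable borel" if [measurable]: "G \<in> borel_measurable borel" for G
    unfolding P_def by measurable
  define D where "D = (\<lambda>j y. ennreal (norm (V j y - g y)))"
  have [measurable]: "D j \<in> borel_measurable borel" for j unfolding D_def by measurable
  have "AE x in lborel. (\<lambda>j. indicator (ball 0 (real j - R)) x * P (D j) x) \<longlonglongrightarrow> 0"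
  proof (rule AE_tendsto_0_geometric[where C = ?C])
    fix j
    have "(\<integral>\<^sup>+x. indicator (ball 0 (real j - R)) x * P (D j) x \<partial>lborel)
       \<le> ennreal ?C * (\<integral>\<^sup>+y. indicator (ball 0 (real j - R + R)) y * D j y \<partial>lborel)"
      unfolding P_def by (intro riesz_potential_L1 n R) measurable
    also have "\<dots> \<le> ennreal ?C * ennreal ((1/2) ^ j)"
      using d(3)[of j] by (intro mult_left_mono) (auto simp: D_def V_def)
    also have "\<dots> = ennreal (?C * (1/2) ^ j)" using C by (simp add: ennreal_mult)
    finally show "(\<integral>\<^sup>+x. indicator (ball 0 (real j - R)) x * P (D j) x \<partial>lborel) \<le> ennreal (?C * (1/2) ^ j)" .
  qed (use C in auto)
  moreover have "AE x in lborel. \<forall>j::nat. indicator (ball 0 (real j)) x * P (\<lambda>y. ennreal (norm (g y))) x \<noteq> \<infinity>"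
  proof (unfold AE_all_countable, intro allI nn_integral_PInf_AE)
    fix j :: nat
    have "(\<integral>\<^sup>+x. indicator (ball 0 (real j)) x * P (\<lambda>y. ennreal (norm (g y))) x \<partial>lborel)
       \<le> ennreal ?C * (\<integral>\<^sup>+y. indicator (ball 0 (real j + R)) y * ennreal (norm (g y)) \<partial>lborel)"
      unfolding P_def by (intro riesz_potential_L1 n R) measurable
    also have "(\<integral>\<^sup>+y. indicator (ball 0 (real j + R)) y * ennreal (norm (g y)) \<partial>lborel)
       = (\<integral>\<^sup>+y. ennreal (norm (indicator (ball 0 (real j + R)) y *\<^sub>R g y)) \<partial>lborel)"
      by (intro nn_integral_cong) (auto simp: indicator_def)
    also have "ennreal ?C * \<dots> < \<infinity>"
      using loc_integrableD[OF lg, of "real j + R"]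
      by (simp add: integrable_iff_bounded ennreal_mult_less_top)
    finally show "(\<integral>\<^sup>+x. indicator (ball 0 (real j)) x * P (\<lambda>y. ennreal (norm (g y))) x \<partial>lborel) \<noteq> \<infinity>" by simp
  qed measurable
  ultimately show ?thesis using v_lim
  proof eventually_elim
    case (elim x)
    have ev: "eventually (\<lambda>j. norm x < real j - R) sequentially"
      using eventually_gt_at_top[of "nat \<lceil>norm x + R\<rceil>"] by eventually_elim linarith
    hence "eventually (\<lambda>j. indicator (ball 0 (real j - R)) x * P (D j) x = P (D j) x) sequentially"
      by eventually_elim simp
    from iffD1[OF tendsto_cong[OF this] elim(1)]
    have PD: "(\<lambda>j. P (D j) x) \<longlonglongrightarrow> 0" .
    obtain j0 :: nat where "norm x < real j0" using reals_Archimedean2 by blast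
    hence Pg: "P (\<lambda>y. ennreal (norm (g y))) x \<noteq> \<infinity>" using elim(2)[rule_format, of j0] by simp
    let ?c = "ennreal (R ^ CARD('n) / real CARD('n))"
    define W where "W = (\<lambda>j. P (\<lambda>y. ennreal (\<bar>T' (v j y)\<bar> * norm (g y))) x)"
    define W0 where "W0 = P (\<lambda>y. ennreal (\<bar>T' (u y)\<bar> * norm (g y))) x"
    have W: "W \<longlonglongrightarrow> W0"
      unfolding W_def W0_def P_def
    proof (rule nn_integral_dominated_convergence)
      let ?w = "\<lambda>y. ennreal M * (indicator (ball x R) y * (ennreal (norm (g y)) * ennreal (riesz (y - x))))"
      have "(\<integral>\<^sup>+y. ?w y \<partial>lborel) = ennreal M * P (\<lambda>y. ennreal (norm (g y))) x"
        unfolding P_def by (intro nn_integral_cmult) measurable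
      also have "\<dots> < \<infinity>" using Pg by (simp add: ennreal_mult_less_top less_top)
      finally show "(\<integral>\<^sup>+y. ?w y \<partial>lborel) < \<infinity>" .
      show "AE y in lborel. indicator (ball x R) y * (ennreal (\<bar>T' (v j y)\<bar> * norm (g y)) * ennreal (riesz (y - x))) \<le> ?w y" for j
      proof (rule AE_I2)
        fix y
        have "ennreal (\<bar>T' (v j y)\<bar> * norm (g y)) \<le> ennreal M * ennreal (norm (g y))"
          using M[of "v j y"] M0 by (simp add: mult_right_mono flip: ennreal_mult)
        hence "indicator (ball x R) y * (ennreal (\<bar>T' (v j y)\<bar> * norm (g y)) * ennreal (riesz (y - x)))
           \<le> indicator (ball x R) y * (ennreal M * ennreal (norm (g y)) * ennreal (riesz (y - x)))"
          by (intro mult_left_mono mult_right_mono) auto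
        thus "indicator (ball x R) y * (ennreal (\<bar>T' (v j y)\<bar> * norm (g y)) * ennreal (riesz (y - x))) \<le> ?w y"
          by (simp add: mult_ac)
      qed
      show "AE y in lborel. (\<lambda>j. indicator (ball x R) y * (ennreal (\<bar>T' (v j y)\<bar> * norm (g y)) * ennreal (riesz (y - x))))
         \<longlonglongrightarrow> indicator (ball x R) y * (ennreal (\<bar>T' (u y)\<bar> * norm (g y)) * ennreal (riesz (y - x)))"
        using v_lim
      proof eventually_elim
        case (elim y)
        have "(\<lambda>j. T' (v j y)) \<longlonglongrightarrow> T' (u y)"
          by (rule continuous_on_tendsto_compose[OF T' elim]) auto
        hence "(\<lambda>j. ennreal (indicator (ball x R) y * (\<bar>T' (v j y)\<bar> * norm (g y) * riesz (y - x))))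
           \<longlonglongrightarrow> ennreal (indicator (ball x R) y * (\<bar>T' (u y)\<bar> * norm (g y) * riesz (y - x)))"
          by (intro tendsto_intros)
        thus ?case by (simp add: ennreal_mult riesz_nonneg ennreal_indicator)
      qed
    qed measurable
    have bound: "(\<integral>\<^sup>+z. indicator (ball x R) z * ennreal \<bar>T (v j z) - T (v j x)\<bar> \<partial>lborel) \<le> ?c * (W j + ennreal M * P (D j) x)" for j
    proof -
      have "(\<integral>\<^sup>+z. indicator (ball x R) z * ennreal \<bar>T (v j z) - T (v j x)\<bar> \<partial>lborel)
        \<le> ?c * P (\<lambda>y. ennreal (\<bar>T' (v j y)\<bar> * norm (V j y))) x"
        unfolding v_def V_def P_def by (rule smooth_potential_estimate[OF n ug d(1) R T T'])
      also have "P (\<lambda>y. ennreal (\<bar>T' (v j y)\<bar> * norm (V j y))) x \<le>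
          (\<integral>\<^sup>+y. indicator (ball x R) y * (ennreal (\<bar>T' (v j y)\<bar> * norm (g y)) * ennreal (riesz (y - x)))
              + ennreal M * (indicator (ball x R) y * (D j y * ennreal (riesz (y - x)))) \<partial>lborel)"
        unfolding P_def
      proof (intro nn_integral_mono)
        fix y
        have "\<bar>T' (v j y)\<bar> * norm (V j y) \<le> \<bar>T' (v j y)\<bar> * (norm (g y) + norm (V j y - g y))"
          by (intro mult_left_mono) (norm, simp)
        also have "\<dots> \<le> \<bar>T' (v j y)\<bar> * norm (g y) + M * norm (V j y - g y)"
          using M[of "v j y"] by (simp add: distrib_left mult_right_mono)
        finally have "ennreal (\<bar>T' (v j y)\<bar> * norm (V j y)) \<le> ennreal (\<bar>T' (v j y)\<bar> * norm (g y)) + ennreal M * D j y"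
          using M0 by (simp add: D_def flip: ennreal_mult ennreal_plus)
        hence "indicator (ball x R) y * (ennreal (\<bar>T' (v j y)\<bar> * norm (V j y)) * ennreal (riesz (y - x)))
          \<le> indicator (ball x R) y * ((ennreal (\<bar>T' (v j y)\<bar> * norm (g y)) + ennreal M * D j y) * ennreal (riesz (y - x)))"
          by (intro mult_left_mono mult_right_mono) auto
        thus "indicator (ball x R) y * (ennreal (\<bar>T' (v j y)\<bar> * norm (V j y)) * ennreal (riesz (y - x)))
          \<le> indicator (ball x R) y * (ennreal (\<bar>T' (v j y)\<bar> * norm (g y)) * ennreal (riesz (y - x)))
              + ennreal M * (indicator (ball x R) y * (D j y * ennreal (riesz (y - x))))"
          by (simp add: distrib_left distrib_right mult_ac)
      qed
      also have "\<dots> = W j + ennreal M * P (D j) x"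
        unfolding W_def P_def by (subst nn_integral_add) (auto simp: nn_integral_cmult)
      finally show ?thesis by (simp add: mult_left_mono)
    qed
    have lim: "(\<lambda>j. ?c * (W j + ennreal M * P (D j) x)) \<longlonglongrightarrow> ?c * (W0 + ennreal M * 0)"
      by (intro tendsto_intros ennreal_tendsto_cmult W PD) auto
    have "(\<integral>\<^sup>+z. indicator (ball x R) z * ennreal \<bar>T (u z) - T (u x)\<bar> \<partial>lborel)
       = (\<integral>\<^sup>+z. liminf (\<lambda>j. indicator (ball x R) z * ennreal \<bar>T (v j z) - T (v j x)\<bar>) \<partial>lborel)"
    proof (rule nn_integral_cong_AE)
      show "AE z in lborel. indicator (ball x R) z * ennreal \<bar>T (u z) - T (u x)\<bar>
          = liminf (\<lambda>j. indicator (ball x R) z * ennreal \<bar>T (v j z) - T (v j x)\<bar>)"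
        using v_lim
      proof eventually_elim
        case (elim z)
        have "(\<lambda>j. T (v j z)) \<longlonglongrightarrow> T (u z)" "(\<lambda>j. T (v j x)) \<longlonglongrightarrow> T (u x)"
          by (auto intro!: continuous_on_tendsto_compose[OF cT] elim \<open>(\<lambda>j. v j x) \<longlonglongrightarrow> u x\<close>)
        hence "(\<lambda>j. ennreal (indicator (ball x R) z * \<bar>T (v j z) - T (v j x)\<bar>)) \<longlonglongrightarrow> ennreal (indicator (ball x R) z * \<bar>T (u z) - T (u x)\<bar>)"
          by (intro tendsto_intros)
        hence "(\<lambda>j. indicator (ball x R) z * ennreal \<bar>T (v j z) - T (v j x)\<bar>) \<longlonglongrightarrow> indicator (ball x R) z * ennreal \<bar>T (u z) - T (u x)\<bar>"
          by (simp add: ennreal_mult ennreal_indicator)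
        thus ?case by (intro lim_imp_Liminf[symmetric]) auto
      qed
    qed
    also have "\<dots> \<le> liminf (\<lambda>j. \<integral>\<^sup>+z. indicator (ball x R) z * ennreal \<bar>T (v j z) - T (v j x)\<bar> \<partial>lborel)"
      by (intro nn_integral_liminf) measurable
    also have "\<dots> \<le> liminf (\<lambda>j. ?c * (W j + ennreal M * P (D j) x))"
      by (intro Liminf_mono always_eventually allI bound)
    also have "\<dots> = ?c * (W0 + ennreal M * 0)"
      by (intro lim_imp_Liminf lim) simp
    finally show ?case by (simp add: W0_def P_def)
  qed
qed

section \<open>One Young function: its conjugate and potentials\<close>

text \<open>The properties of \<^const>\<open>phi_hat\<close> at a fixed point that the estimates use. The second one
  says that \<open>A t / t\<close> is nondecreasing.\<close>

definition young_normal :: "(real \<Rightarrow> ennreal) \<Rightarrow> bool" where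
  "young_normal A \<longleftrightarrow> (\<forall>t\<in>{0..1}. A t = ennreal t) \<and>
     (\<forall>l\<in>{0..1}. \<forall>t\<ge>0. A (l * t) \<le> ennreal l * A t) \<and> continuous_on {0..} A"

definition conj_weight :: "nat \<Rightarrow> (real \<Rightarrow> ennreal) \<Rightarrow> real \<Rightarrow> real" where
  "conj_weight n A \<tau> = enn2real (ennreal \<tau> / A \<tau>) powr (1 / (real n - 1))"

text \<open>The integral inside \<^const>\<open>H_diamond\<close>, before the outer power \<open>1 / n'\<close> is taken.\<close>

definition H_int :: "nat \<Rightarrow> (real \<Rightarrow> ennreal) \<Rightarrow> real \<Rightarrow> ennreal" where
  "H_int n A s = (\<integral>\<^sup>+\<tau>. ennreal (conj_weight n A \<tau>) * indicator {0..s} \<tau> \<partial>lborel)"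

context
  fixes A :: "real \<Rightarrow> ennreal"
  assumes A: "young_normal A"
begin

lemma young_normal_small: "0 \<le> t \<Longrightarrow> t \<le> 1 \<Longrightarrow> A t = ennreal t"
  using A by (simp add: young_normal_def)

lemma young_normal_scale: "0 \<le> l \<Longrightarrow> l \<le> 1 \<Longrightarrow> 0 \<le> t \<Longrightarrow> A (l * t) \<le> ennreal l * A t"
  using A by (simp add: young_normal_def)

lemma young_normal_cont: "continuous_on {0..} A"
  using A by (simp add: young_normal_def)

lemma young_normal_mono: assumes "0 \<le> s" "s \<le> t" shows "A s \<le> A t"
proof (cases "t = 0")
  case False
  hence t: "t > 0" using assms by auto
  have "A ((s / t) * t) \<le> ennreal (s / t) * A t" using t assms by (intro young_normal_scale) auto
  also have "\<dots> \<le> 1 * A t" using t assms by (intro mult_right_mono) auto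
  finally show ?thesis using t by simp
qed (use assms in auto)

lemma young_normal_ge: assumes "0 \<le> t" shows "ennreal t \<le> A t"
proof (cases "t \<le> 1")
  case False
  have "ennreal 1 = A ((1 / t) * t)" using False young_normal_small[of 1] by simp
  also have "\<dots> \<le> ennreal (1 / t) * A t" using False by (intro young_normal_scale) auto
  finally have "ennreal t * ennreal 1 \<le> ennreal t * (ennreal (1 / t) * A t)" by (intro mult_left_mono) auto
  also have "\<dots> = A t" using False by (simp add: mult.assoc[symmetric] ennreal_mult[symmetric])
  finally show ?thesis by simp
qed (use assms young_normal_small in auto)

lemma young_normal_IVT: assumes "0 \<le> s" "v \<le> A s" shows "\<exists>s'. 0 \<le> s' \<and> s' \<le> s \<and> A s' = v"
proof -
  have "\<exists>x\<ge>0. x \<le> s \<and> A x = v"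
    using assms young_normal_small[of 0] continuous_on_subset[OF young_normal_cont, of "{0..s}"]
    by (intro IVT') auto
  thus ?thesis by blast
qed

lemma young_normal_measurable [measurable]: "(\<lambda>\<tau>. A (max 0 \<tau>)) \<in> borel_measurable borel"
  by (intro borel_measurable_continuous_onI continuous_on_compose2[OF young_normal_cont] continuous_intros) auto

lemma conj_weight_measurable [measurable]: "(\<lambda>\<tau>. conj_weight n A (max 0 \<tau>)) \<in> borel_measurable borel"
  unfolding conj_weight_def by measurable

lemma ratio_le_1: assumes "0 \<le> \<tau>" shows "ennreal \<tau> / A \<tau> \<le> 1"
proof (cases "\<tau> = 0")
  case False
  hence "\<tau> > 0" using assms by simp
  hence "A \<tau> > 0" using young_normal_ge[of \<tau>] by (metis assms ennreal_less_zero_iff order_less_le_trans)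
  thus ?thesis using young_normal_ge[OF assms] \<open>\<tau> > 0\<close>
    by (cases "A \<tau> = top") (auto simp: divide_le_posI_ennreal)
qed (simp add: divide_ennreal_def)

lemma conj_weight_nonneg: "0 \<le> conj_weight n A \<tau>"
  by (simp add: conj_weight_def)

lemma conj_weight_le_1: assumes "0 \<le> \<tau>" "n \<ge> 2" shows "conj_weight n A \<tau> \<le> 1"
proof -
  have "enn2real (ennreal \<tau> / A \<tau>) \<le> 1"
    using enn2real_mono[OF ratio_le_1[OF assms(1)]] by simp
  thus ?thesis using assms(2) unfolding conj_weight_def by (intro powr_le1) auto
qed

lemma H_int_eq: "H_int n A s = (\<integral>\<^sup>+\<tau>. ennreal (conj_weight n A (max 0 \<tau>)) * indicator {0..s} \<tau> \<partial>lborel)"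
  unfolding H_int_def by (intro nn_integral_cong) (auto simp: indicator_def)

text \<open>The central estimate, at a fixed point \<open>x\<close>. With \<open>d = \<bar>y - x\<bar>\<close> and \<open>\<rho>(\<tau>) = (\<tau> / (T A(\<tau>)))\<^sup>1\<^sup>/\<^sup>(\<^sup>n\<^sup>-\<^sup>1\<^sup>)\<close>, which
  is nonincreasing, the hypothesis on \<^const>\<open>H_int\<close> reads \<open>\<integral> \<rho> \<le> T\<close> over \<open>(0, s]\<close>. The function \<open>f\<close> is
  split at the height \<open>l(d) = Sup {\<tau> \<le> s. d < \<rho>(\<tau>)}\<close>.

  Below the height, the layer cake formula and \<open>riesz_ball_bound\<close> bound the potential of \<open>l(d)\<close> by a
  multiple of \<open>\<integral> \<rho> \<le> T\<close>.

  Above the height, \<open>f \<le> (l / A(l)) g\<close>, by the comparison hypothesis; it is available since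
  \<open>l d \<le> \<integral> \<rho> \<le> T\<close> implies \<open>A(l) d\<^sup>n \<le> 1\<close>. As long as \<open>d \<ge> r = \<rho>(s)\<close>, a positive height
  satisfies \<open>l d\<^sup>1\<^sup>-\<^sup>n = T A(l)\<close>, while \<open>d\<^sup>1\<^sup>-\<^sup>n \<le> T\<close> and \<open>f \<le> g\<close> where the height is 0, so that this part of the potential is at most \<open>T \<integral> g \<le> T\<close>. For \<open>d < r\<close> the height
  is the constant \<open>s\<close>, and the hypothesis that the mass of \<open>g\<close> does not concentrate on small
  balls controls the potential of \<open>g\<close> there.\<close>

lemma far_near_estimate:
  fixes x :: "real^'n" and f :: "real^'n \<Rightarrow> real" and g :: "real^'n \<Rightarrow> ennreal"
  assumes n: "CARD('n) \<ge> 2" and T: "T > 0" and s: "s > 0" and fin: "A s < \<infinity>"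
    and H: "H_int CARD('n) A s \<le> ennreal (T powr (real CARD('n) / (real CARD('n) - 1)))"
    and f_meas [measurable]: "f \<in> borel_measurable borel" and g_meas [measurable]: "g \<in> borel_measurable borel"
    and f0: "\<And>y. 0 \<le> f y"
    and g1: "(\<integral>\<^sup>+y. g y \<partial>lborel) \<le> 1"
    and fg: "AE y in lborel. ennreal (f y) \<le> g y \<and>
        (\<forall>l\<ge>0. l < f y \<longrightarrow> A l * ennreal (norm (y - x) ^ CARD('n)) \<le> 1 \<longrightarrow> ennreal (f y) * A l \<le> ennreal l * g y)"
    and near: "\<And>\<sigma>. 0 < \<sigma> \<Longrightarrow> A s * ennreal (\<sigma> ^ CARD('n)) \<le> 1 \<Longrightarrow>
        (\<integral>\<^sup>+y. indicator (ball x \<sigma>) y * g y \<partial>lborel) \<le> A s * ennreal (\<sigma> ^ CARD('n))"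
  shows "(\<integral>\<^sup>+y. ennreal (f y) * ennreal (riesz (y - x)) \<partial>lborel)
      \<le> ennreal ((real CARD('n) * unit_ball_vol (real CARD('n)) + 1 + real CARD('n)) * T)"
proof -
  define n where "n = CARD('n)"
  define k where "k = n - 1"
  have k: "k > 0" "n = Suc k" "real n - 1 = real k" using n by (auto simp: k_def n_def)
  define p where "p = 1 / real k"
  have p: "p > 0" using k by (simp add: p_def)
  define a where "a = (\<lambda>\<tau>. enn2real (A (max 0 \<tau>)))"
  have [measurable]: "a \<in> borel_measurable borel" unfolding a_def by measurable
  have a0: "0 \<le> a \<tau>" for \<tau> by (simp add: a_def)
  have Aa: "A \<tau> = ennreal (a \<tau>)" if "0 \<le> \<tau>" "\<tau> \<le> s" for \<tau>
  proof -
    have "A \<tau> < top" using le_less_trans[OF young_normal_mono[OF that] fin] by simp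
    thus ?thesis using that unfolding a_def by (simp only: max_absorb2 ennreal_enn2real)
  qed
  have a_ge: "\<tau> \<le> a \<tau>" if "0 \<le> \<tau>" "\<tau> \<le> s" for \<tau>
  proof -
    have "ennreal \<tau> \<le> ennreal (a \<tau>)" using young_normal_ge[of \<tau>] that unfolding Aa[OF that] by simp
    thus ?thesis by (subst (asm) ennreal_le_iff) (auto simp: a_def)
  qed
  have a_small: "a \<tau> = \<tau>" if "0 \<le> \<tau>" "\<tau> \<le> 1" for \<tau>
    using young_normal_small[of \<tau>] that by (simp add: a_def max_def)
  have a_scale: "a (l * \<tau>) \<le> l * a \<tau>" if "0 \<le> l" "l \<le> 1" "0 \<le> \<tau>" "\<tau> \<le> s" for l \<tau>
  proof -
    have "l * \<tau> \<le> s" using that mult_left_le_one_le[of \<tau> l] by linarith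
    hence "ennreal (a (l * \<tau>)) \<le> ennreal l * ennreal (a \<tau>)"
      using young_normal_scale[of l \<tau>] that by (simp add: Aa)
    thus ?thesis using that by (simp add: a0 flip: ennreal_mult)
  qed
  have a_cont: "continuous_on {0..s} a"
  proof -
    have c: "continuous_on {0..s} (\<lambda>\<tau>. ennreal (a \<tau>))"
      by (rule continuous_on_eq[OF continuous_on_subset[OF young_normal_cont]]) (use Aa in auto)
    show ?thesis
      unfolding continuous_on_def
      by (intro ballI tendsto_ennrealD c[unfolded continuous_on_def, rule_format]) (auto simp: a_def)
  qed
  define W where "W = (\<lambda>d \<tau>. T * a \<tau> * d ^ k)"
  define \<rho> where "\<rho> = (\<lambda>\<tau>. (\<tau> / (T * a \<tau>)) powr p)"
  have powk: "(z powr p) ^ k = z" if "z > 0" for z :: real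
    using that k by (simp add: p_def powr_powr flip: powr_realpow)
  have less_rho: "d < \<rho> \<tau> \<longleftrightarrow> W d \<tau> < \<tau>" if "0 \<le> d" "0 < \<tau>" "\<tau> \<le> s" for d \<tau>
  proof -
    have pos: "0 < \<tau> / (T * a \<tau>)" using that a_ge[of \<tau>] T by auto
    have e: "\<rho> \<tau> ^ k = \<tau> / (T * a \<tau>)"
      unfolding \<rho>_def by (rule powk[OF pos])
    have "d < \<rho> \<tau> \<longleftrightarrow> d ^ k < \<rho> \<tau> ^ k"
      using that(1) k(1) power_strict_mono[of d "\<rho> \<tau>" k] power_less_imp_less_base[of d k "\<rho> \<tau>"]
      by (auto simp: \<rho>_def)
    also have "\<dots> \<longleftrightarrow> W d \<tau> < \<tau>"
      unfolding e W_def using that a_ge[of \<tau>] T by (simp add: field_simps)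
    finally show ?thesis .
  qed
  have \<rho>_pos: "\<rho> \<tau> > 0" if "0 < \<tau>" "\<tau> \<le> s" for \<tau>
    using that a_ge[of \<tau>] T by (auto simp: \<rho>_def)
  have [measurable]: "\<rho> \<in> borel_measurable borel" unfolding \<rho>_def by measurable
  have \<rho>_int: "(\<integral>\<^sup>+\<tau>. ennreal (\<rho> \<tau>) * indicator {0<..s} \<tau> \<partial>lborel) \<le> ennreal T"
  proof -
    have "(\<integral>\<^sup>+\<tau>. ennreal (\<rho> \<tau>) * indicator {0<..s} \<tau> \<partial>lborel)
       \<le> (\<integral>\<^sup>+\<tau>. ennreal (T powr (- p)) * (ennreal (conj_weight n A (max 0 \<tau>)) * indicator {0..s} \<tau>) \<partial>lborel)"
    proof (intro nn_integral_mono)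
      fix \<tau> :: real
      show "ennreal (\<rho> \<tau>) * indicator {0<..s} \<tau> \<le> ennreal (T powr (- p)) * (ennreal (conj_weight n A (max 0 \<tau>)) * indicator {0..s} \<tau>)"
      proof (cases "\<tau> \<in> {0<..s}")
        case True
        have "enn2real (ennreal \<tau> / A \<tau>) = \<tau> / a \<tau>"
          using True a_ge[of \<tau>] by (simp add: Aa divide_ennreal)
        moreover have "\<rho> \<tau> = T powr (- p) * (\<tau> / a \<tau>) powr p"
        proof -
          have "\<tau> / (T * a \<tau>) = inverse T * (\<tau> / a \<tau>)" by (simp add: field_simps)
          hence "\<rho> \<tau> = (inverse T * (\<tau> / a \<tau>)) powr p" by (simp only: \<rho>_def)
          also have "\<dots> = inverse T powr p * (\<tau> / a \<tau>) powr p"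
            by (rule powr_mult)
          also have "inverse T powr p = T powr (- p)"
            using T by (simp add: powr_minus inverse_powr)
          finally show ?thesis .
        qed
        ultimately have "\<rho> \<tau> = T powr (- p) * conj_weight n A \<tau>"
          by (simp add: conj_weight_def k p_def)
        thus ?thesis using True by (simp add: ennreal_mult conj_weight_nonneg)
      qed simp
    qed
    also have "\<dots> = ennreal (T powr (- p)) * H_int n A s"
      unfolding H_int_eq by (intro nn_integral_cmult) measurable
    also have "\<dots> \<le> ennreal (T powr (- p)) * ennreal (T powr (real n / (real n - 1)))"
      using H by (intro mult_left_mono) (auto simp: n_def)
    also have "\<dots> = ennreal (T powr (- p + real n / real k))"
      by (subst powr_add) (simp add: k flip: ennreal_mult)
    also have "- p + real n / real k = 1" using k by (simp add: p_def field_simps)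
    finally show ?thesis using T by simp
  qed
  define r where "r = \<rho> s"
  have r: "r > 0" unfolding r_def using s by (intro \<rho>_pos) auto
  have r_eq: "T * a s * r ^ k = s"
  proof -
    have pos: "0 < s / (T * a s)" using s a_ge[of s] T by auto
    have "r ^ k = s / (T * a s)"
      unfolding r_def \<rho>_def by (rule powk[OF pos])
    thus ?thesis using pos T s by auto
  qed
  have down: "W d \<tau>' < \<tau>'" if "W d \<tau> < \<tau>" "0 < \<tau>'" "\<tau>' \<le> \<tau>" "\<tau> \<le> s" "0 \<le> d" for d \<tau> \<tau>'
  proof -
    have "a ((\<tau>' / \<tau>) * \<tau>) \<le> (\<tau>' / \<tau>) * a \<tau>" using that by (intro a_scale) auto
    hence "W d \<tau>' \<le> (\<tau>' / \<tau>) * W d \<tau>"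
      using that T mult_right_mono[of "a \<tau>'" "\<tau>' / \<tau> * a \<tau>" "T * d ^ k"] by (simp add: W_def mult_ac)
    also have "\<dots> < (\<tau>' / \<tau>) * \<tau>" using that by (intro mult_strict_left_mono) auto
    finally show ?thesis using that by simp
  qed
  have level: "l * d \<le> T" if "0 < l" "l \<le> s" "0 \<le> d" and *: "\<And>\<tau>. 0 < \<tau> \<Longrightarrow> \<tau> < l \<Longrightarrow> d \<le> \<rho> \<tau>" for l d
  proof -
    have "ennreal (l * d) = (\<integral>\<^sup>+\<tau>. ennreal d * indicator {0<..<l} \<tau> \<partial>lborel)"
      using that by (simp add: nn_integral_cmult_indicator mult.commute ennreal_mult)
    also have "\<dots> \<le> (\<integral>\<^sup>+\<tau>. ennreal (\<rho> \<tau>) * indicator {0<..s} \<tau> \<partial>lborel)"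
      using * that by (intro nn_integral_mono) (auto simp: indicator_def intro!: ennreal_leI)
    also note \<rho>_int
    finally show ?thesis using T by simp
  qed
  have W_cont: "continuous_on {0..s} (W d)" for d
    unfolding W_def by (intro continuous_intros a_cont)
  have rs: "A s * ennreal (r ^ n) \<le> 1"
  proof -
    have "s * r \<le> T"
    proof (rule level)
      fix \<tau> assume "0 < \<tau>" "\<tau> < s"
      show "r \<le> \<rho> \<tau>"
      proof (rule ccontr)
        assume "\<not> r \<le> \<rho> \<tau>"
        hence "W (\<rho> \<tau>) s < s"
          using less_rho[of "\<rho> \<tau>" s] s \<rho>_pos[of \<tau>] \<open>0 < \<tau>\<close> \<open>\<tau> < s\<close> by (simp add: r_def)
        from down[OF this, of \<tau>] have "W (\<rho> \<tau>) \<tau> < \<tau>"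
          using \<rho>_pos[of \<tau>] \<open>0 < \<tau>\<close> \<open>\<tau> < s\<close> by auto
        thus False
          using less_rho[of "\<rho> \<tau>" \<tau>] \<rho>_pos[of \<tau>] \<open>0 < \<tau>\<close> \<open>\<tau> < s\<close> by simp
      qed
    qed (use s r in auto)
    moreover have "T * (a s * r ^ n) = s * r" using r_eq by (simp add: k(2) mult_ac)
    ultimately have "a s * r ^ n \<le> 1" using T mult_le_cancel_left_pos[of T "a s * r ^ n" 1] by simp
    thus ?thesis using s r by (simp add: Aa a0 flip: ennreal_mult)
  qed
  \<comment> \<open>Here the absence of concentration is used.\<close>
  have near_r: "(\<integral>\<^sup>+y. indicator (ball x r) y * g y * ennreal (riesz (y - x)) \<partial>lborel) \<le> ennreal (real n * a s * r)"
    unfolding n_def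
  proof (rule riesz_mass_bound[OF n g_meas r])
    show "0 \<le> a s" by (simp add: a_def)
    fix \<sigma> assume \<sigma>: "0 < \<sigma>" "\<sigma> \<le> r"
    have "A s * ennreal (\<sigma> ^ n) \<le> A s * ennreal (r ^ n)"
      using \<sigma> by (intro mult_left_mono ennreal_leI power_mono) auto
    hence "A s * ennreal (\<sigma> ^ CARD('n)) \<le> 1" using rs by (simp add: n_def)
    from near[OF \<sigma>(1) this]
    show "(\<integral>\<^sup>+y. indicator (ball x \<sigma>) y * g y \<partial>lborel) \<le> ennreal (a s * \<sigma> ^ CARD('n))"
      using s \<sigma> by (simp add: Aa ennreal_mult a0)
  qed
  \<comment> \<open>The function \<open>L y\<close> dominates the height \<open>l\<close> in layer cake form.\<close>
  define L where "L = (\<lambda>y. \<integral>\<^sup>+\<tau>. indicator {0<..s} \<tau> * indicator (ball x (\<rho> \<tau>)) y \<partial>lborel)"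
  have [measurable]: "L \<in> borel_measurable borel" unfolding L_def by measurable
  have "AE y in lborel. y \<noteq> x" by (rule AE_lborel_singleton)
  with fg have pw: "AE y in lborel. ennreal (f y) * ennreal (riesz (y - x)) \<le>
      L y * ennreal (riesz (y - x)) + ennreal T * g y
       + ennreal (s / a s) * (indicator (ball x r) y * g y * ennreal (riesz (y - x)))"
  proof eventually_elim
    case (elim y)
    define d where "d = norm (y - x)"
    have d: "d > 0" using elim by (simp add: d_def)
    have rz: "riesz (y - x) = 1 / d ^ k" by (simp add: riesz_def d_def k_def n_def)
    let ?R = "L y * ennreal (riesz (y - x)) + ennreal T * g y
       + ennreal (s / a s) * (indicator (ball x r) y * g y * ennreal (riesz (y - x)))"
    define J where "J = {\<tau>. 0 < \<tau> \<and> \<tau> \<le> s \<and> W d \<tau> < \<tau>}"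
    show ?case
    proof (cases "J = {}")
      case True
      define \<tau> where "\<tau> = min 1 s"
      have "0 < \<tau>" "\<tau> \<le> s" "\<tau> \<le> 1" using s by (auto simp: \<tau>_def)
      hence "\<tau> \<le> W d \<tau>" using True by (auto simp: J_def not_less)
      hence "\<tau> * 1 \<le> \<tau> * (T * d ^ k)" using a_small[of \<tau>] \<open>0 < \<tau>\<close> \<open>\<tau> \<le> 1\<close> by (simp add: W_def mult_ac)
      hence "1 / d ^ k \<le> T" using \<open>0 < \<tau>\<close> d by (simp add: divide_le_eq)
      hence "ennreal (f y) * ennreal (riesz (y - x)) \<le> g y * ennreal T"
        using elim rz by (intro mult_mono) (auto intro!: ennreal_leI)
      also have "\<dots> \<le> ?R" by (simp add: mult.commute add_increasing add_increasing2)
      finally show ?thesis .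
    next
      case False
      define l where "l = Sup J"
      have bdd: "bdd_above J" by (rule bdd_aboveI[of _ s]) (auto simp: J_def)
      obtain \<tau>0 where \<tau>0: "\<tau>0 \<in> J" using False by auto
      have l0: "0 < l" using cSup_upper[OF \<tau>0 bdd] \<tau>0 by (auto simp: l_def J_def)
      have ls: "l \<le> s" unfolding l_def using False by (intro cSup_least) (auto simp: J_def)
      have below: "\<tau> \<in> J" if "0 < \<tau>" "\<tau> < l" for \<tau>
      proof -
        have "\<tau> < Sup J" using that by (simp add: l_def)
        then obtain \<tau>1 where "\<tau>1 \<in> J" "\<tau> < \<tau>1" using less_cSup_iff[OF False bdd] by auto
        thus ?thesis using down[of d \<tau>1 \<tau>] that d by (auto simp: J_def)
      qed
      have above: "\<tau> \<le> W d \<tau>" if "l < \<tau>" "\<tau> \<le> s" for \<tau>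
        using that l0 cSup_upper[OF _ bdd, of \<tau>] by (force simp: J_def l_def not_less)
      have ld: "l * d \<le> T"
        using below d less_rho[of d] by (intro level l0 ls) (auto simp: J_def intro!: less_imp_le)
      have Wl: "W d l \<le> l"
      proof -
        have "closed {\<tau>\<in>{0..s}. W d \<tau> \<le> \<tau>}"
          by (intro continuous_on_closed_Collect_le W_cont continuous_intros)
        moreover have "J \<subseteq> {\<tau>\<in>{0..s}. W d \<tau> \<le> \<tau>}" by (auto simp: J_def)
        ultimately have "closure J \<subseteq> {\<tau>\<in>{0..s}. W d \<tau> \<le> \<tau>}" by (intro closure_minimal)
        thus ?thesis using closure_contains_Sup[OF False bdd] by (auto simp: l_def)
      qed
      have Al: "A l * ennreal (norm (y - x) ^ CARD('n)) \<le> 1"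
      proof -
        have "T * (a l * d ^ n) \<le> l * d" using mult_right_mono[OF Wl, of d] d by (simp add: W_def k(2) mult_ac)
        also have "\<dots> \<le> T" by (rule ld)
        finally have "a l * d ^ n \<le> 1" using T by simp
        thus ?thesis using l0 ls by (simp add: Aa a0 d_def n_def flip: ennreal_mult)
      qed
      have Ll: "ennreal l \<le> L y"
      proof -
        have "ennreal l = (\<integral>\<^sup>+\<tau>. indicator {0<..<l} \<tau> \<partial>lborel)" using l0 by simp
        also have "\<dots> \<le> L y" unfolding L_def
        proof (intro nn_integral_mono)
          fix \<tau> :: real
          show "indicator {0<..<l} \<tau> \<le> indicator {0<..s} \<tau> * (indicator (ball x (\<rho> \<tau>)) y :: ennreal)"
            using below[of \<tau>] less_rho[of d \<tau>] d ls
            by (auto simp: indicator_def J_def d_def dist_norm norm_minus_commute)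
        qed
        finally show ?thesis .
      qed
      show ?thesis
      proof (cases "f y \<le> l")
        case True
        hence "ennreal (f y) * ennreal (riesz (y - x)) \<le> L y * ennreal (riesz (y - x))"
          using Ll order_trans[OF ennreal_leI Ll] by (intro mult_right_mono) auto
        also have "\<dots> \<le> ?R" by (simp add: add.assoc)
        finally show ?thesis .
      next
        case False
        hence le: "ennreal (f y) * ennreal (a l) \<le> ennreal l * g y"
          using conjunct2[OF elim(1), rule_format, of l] Al l0 ls False by (simp add: Aa)
        have al: "a l > 0" using a_ge[of l] l0 ls by auto
        have f_le: "ennreal (f y) \<le> ennreal (l / a l) * g y"
        proof -
          have "ennreal (1 / a l) * (ennreal (f y) * ennreal (a l)) \<le> ennreal (1 / a l) * (ennreal l * g y)"
            using le by (intro mult_left_mono) auto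
          moreover have "ennreal (1 / a l) * (ennreal (f y) * ennreal (a l)) = ennreal (f y)"
            using al f0[of y] by (simp flip: ennreal_mult)
          moreover have "ennreal (1 / a l) * (ennreal l * g y) = ennreal (l / a l) * g y"
            using al l0 by (simp add: mult.assoc[symmetric] flip: ennreal_mult)
          ultimately show ?thesis by simp
        qed
        show ?thesis
        proof (cases "W d s < s")
          case True
          have "s \<in> J" using True s by (simp add: J_def)
          hence "l = s" using ls cSup_upper[OF _ bdd] by (auto simp: l_def intro: antisym)
          have "d < r" using True less_rho[of d s] d s by (simp add: r_def)
          hence "ennreal (f y) * ennreal (riesz (y - x)) \<le> ennreal (s / a s) * (indicator (ball x r) y * g y * ennreal (riesz (y - x)))"
            using mult_right_mono[OF f_le, of "ennreal (riesz (y - x))"] \<open>l = s\<close>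
            by (simp add: d_def dist_norm norm_minus_commute mult_ac)
          also have "\<dots> \<le> ?R" by simp
          finally show ?thesis .
        next
          case nl: False
          have "l \<le> W d l"
          proof (cases "l = s")
            case False
            hence lts: "l < s" using ls by simp
            have "closed {\<tau>\<in>{0..s}. \<tau> \<le> W d \<tau>}"
              by (intro continuous_on_closed_Collect_le W_cont continuous_intros)
            moreover have "{l<..<s} \<subseteq> {\<tau>\<in>{0..s}. \<tau> \<le> W d \<tau>}" using above l0 by auto
            ultimately have "closure {l<..<s} \<subseteq> {\<tau>\<in>{0..s}. \<tau> \<le> W d \<tau>}" by (intro closure_minimal)
            moreover have "l \<in> closure {l<..<s}" using lts by simp
            ultimately show ?thesis by blast
          qed (use nl in auto)
          hence "(l / a l) * (1 / d ^ k) \<le> T" using al d by (simp add: W_def field_simps)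
          hence "ennreal (l / a l) * ennreal (1 / d ^ k) \<le> ennreal T"
            using al l0 d by (subst ennreal_mult[symmetric]) (auto intro: ennreal_leI)
          have "ennreal (f y) * ennreal (riesz (y - x)) \<le> ennreal (l / a l) * g y * ennreal (1 / d ^ k)"
            unfolding rz by (intro mult_right_mono f_le) auto
          also have "\<dots> = (ennreal (l / a l) * ennreal (1 / d ^ k)) * g y" by (simp add: mult_ac)
          also have "\<dots> \<le> ennreal T * g y" by (intro mult_right_mono) (fact, simp)
          also have "\<dots> \<le> ?R" by (simp add: add_increasing add_increasing2)
          finally show ?thesis .
        qed
      qed
    qed
  qed
  have "(\<integral>\<^sup>+y. ennreal (f y) * ennreal (riesz (y - x)) \<partial>lborel) \<le>
    (\<integral>\<^sup>+y. L y * ennreal (riesz (y - x)) + ennreal T * g y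
       + ennreal (s / a s) * (indicator (ball x r) y * g y * ennreal (riesz (y - x))) \<partial>lborel)"
    by (rule nn_integral_mono_AE[OF pw])
  also have "\<dots> = (\<integral>\<^sup>+y. L y * ennreal (riesz (y - x)) \<partial>lborel) + (\<integral>\<^sup>+y. ennreal T * g y \<partial>lborel)
       + (\<integral>\<^sup>+y. ennreal (s / a s) * (indicator (ball x r) y * g y * ennreal (riesz (y - x))) \<partial>lborel)"
    by (subst nn_integral_add, measurable, subst nn_integral_add, measurable)
  also have "\<dots> \<le> ennreal (real n * unit_ball_vol (real n) * T) + ennreal T + ennreal (real n * T)"
  proof (intro add_mono)
    have "(\<integral>\<^sup>+y. L y * ennreal (riesz (y - x)) \<partial>lborel)
       = (\<integral>\<^sup>+y. (\<integral>\<^sup>+\<tau>. indicator {0<..s} \<tau> * indicator (ball x (\<rho> \<tau>)) y * ennreal (riesz (y - x)) \<partial>lborel) \<partial>lborel)"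
      unfolding L_def by (intro nn_integral_cong nn_integral_multc[symmetric]) measurable
    also have "\<dots> = (\<integral>\<^sup>+\<tau>. (\<integral>\<^sup>+y. indicator {0<..s} \<tau> * indicator (ball x (\<rho> \<tau>)) y * ennreal (riesz (y - x)) \<partial>lborel) \<partial>lborel)"
      by (intro lborel_pair.Fubini') measurable
    also have "\<dots> = (\<integral>\<^sup>+\<tau>. indicator {0<..s} \<tau> * (\<integral>\<^sup>+y. indicator (ball x (\<rho> \<tau>)) y * ennreal (riesz (y - x)) \<partial>lborel) \<partial>lborel)"
      by (intro nn_integral_cong) (simp add: nn_integral_cmult[symmetric] mult.assoc)
    also have "\<dots> \<le> (\<integral>\<^sup>+\<tau>. ennreal (real n * unit_ball_vol (real n)) * (ennreal (\<rho> \<tau>) * indicator {0<..s} \<tau>) \<partial>lborel)"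
    proof (intro nn_integral_mono)
      fix \<tau> :: real
      show "indicator {0<..s} \<tau> * (\<integral>\<^sup>+y. indicator (ball x (\<rho> \<tau>)) y * ennreal (riesz (y - x)) \<partial>lborel)
         \<le> ennreal (real n * unit_ball_vol (real n)) * (ennreal (\<rho> \<tau>) * indicator {0<..s} \<tau>)"
        using riesz_ball_bound[OF n \<rho>_pos, of \<tau> x]
        by (auto simp: indicator_def n_def ennreal_mult[symmetric] \<rho>_def)
    qed
    also have "\<dots> = ennreal (real n * unit_ball_vol (real n)) * (\<integral>\<^sup>+\<tau>. (ennreal (\<rho> \<tau>) * indicator {0<..s} \<tau>) \<partial>lborel)"
      by (intro nn_integral_cmult) measurable
    also have "\<dots> \<le> ennreal (real n * unit_ball_vol (real n)) * ennreal T"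
      by (intro mult_left_mono \<rho>_int) auto
    finally show "(\<integral>\<^sup>+y. L y * ennreal (riesz (y - x)) \<partial>lborel) \<le> ennreal (real n * unit_ball_vol (real n) * T)"
      using T by (simp add: ennreal_mult)
    show "(\<integral>\<^sup>+y. ennreal T * g y \<partial>lborel) \<le> ennreal T"
      using mult_left_mono[OF g1, of "ennreal T"] by (simp add: nn_integral_cmult)
    have "(\<integral>\<^sup>+y. ennreal (s / a s) * (indicator (ball x r) y * g y * ennreal (riesz (y - x))) \<partial>lborel)
       = ennreal (s / a s) * (\<integral>\<^sup>+y. indicator (ball x r) y * g y * ennreal (riesz (y - x)) \<partial>lborel)"
      by (intro nn_integral_cmult) measurable
    also have "\<dots> \<le> ennreal (s / a s) * ennreal (real n * a s * r)"
      by (intro mult_left_mono near_r) auto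
    also have "\<dots> = ennreal (real n * (s * r))"
      using s a_ge[of s] r by (simp add: mult_ac flip: ennreal_mult)
    also have "\<dots> \<le> ennreal (real n * T)"
    proof -
      have "a s * r ^ n \<le> 1" using rs s r by (simp add: Aa a0 flip: ennreal_mult)
      hence "T * (a s * r ^ n) \<le> T * 1" using T by (intro mult_left_mono) auto
      moreover have "T * (a s * r ^ n) = s * r" using r_eq by (simp add: k(2) mult_ac)
      ultimately show ?thesis by (intro ennreal_leI mult_left_mono) auto
    qed
    finally show "(\<integral>\<^sup>+y. ennreal (s / a s) * (indicator (ball x r) y * g y * ennreal (riesz (y - x))) \<partial>lborel) \<le> ennreal (real n * T)" .
  qed
  also have "\<dots> = ennreal ((real n * unit_ball_vol (real n) + 1 + real n) * T)"
    using T by (simp add: algebra_simps flip: ennreal_plus)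
  finally show ?thesis by (simp add: n_def)
qed

end

text \<open>The constructions \<^const>\<open>H_diamond\<close> and \<^const>\<open>sobolev_conjugate\<close> for a single function in place
  of \<open>phi_hat \<phi> x\<close>. The conjugates at different points have to be compared, and this form makes the
  dependence on the point explicit.\<close>

definition sob_H :: "nat \<Rightarrow> (real \<Rightarrow> ennreal) \<Rightarrow> real \<Rightarrow> ennreal" where
  "sob_H n A s = ennpowr (\<integral>\<^sup>+\<tau>\<in>{0..s}. ennpowr (ennreal \<tau> / A \<tau>) (1 / (real n - 1)) \<partial>lborel)
     (1 / (real n / (real n - 1)))"

definition conj_of :: "nat \<Rightarrow> (real \<Rightarrow> ennreal) \<Rightarrow> real \<Rightarrow> ennreal" where
  "conj_of n A t = (let s = left_inverse (sob_H n A) t in if s = \<infinity> then \<infinity> else A (enn2real s))"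

lemma left_inverse_le: "0 \<le> s \<Longrightarrow> ennreal t \<le> A s \<Longrightarrow> left_inverse A t \<le> ennreal s"
  unfolding left_inverse_def by (intro Inf_lower) auto

lemma left_inverse_mono: "t \<le> t' \<Longrightarrow> left_inverse A t \<le> left_inverse A t'"
  unfolding left_inverse_def using ennreal_leI order_trans by (intro Inf_superset_mono) blast

context
  fixes A :: "real \<Rightarrow> ennreal" and n :: nat
  assumes A: "young_normal A" and n2: "n \<ge> 2"
begin

lemma H_int_le: assumes "0 \<le> s" shows "H_int n A s \<le> ennreal s"
proof -
  have "H_int n A s \<le> (\<integral>\<^sup>+\<tau>. indicator {0..s} \<tau> \<partial>lborel)"
    unfolding H_int_def using conj_weight_le_1[OF A _ n2]
    by (intro nn_integral_mono) (auto simp: indicator_def)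
  thus ?thesis using assms by simp
qed

lemma H_int_add:
  assumes "0 \<le> s" "s \<le> t" shows "H_int n A t \<le> H_int n A s + ennreal (t - s)"
proof -
  note [measurable] = conj_weight_measurable[OF A]
  have "H_int n A t \<le> (\<integral>\<^sup>+\<tau>. ennreal (conj_weight n A (max 0 \<tau>)) * indicator {0..s} \<tau> + indicator {s..t} \<tau> \<partial>lborel)"
    unfolding H_int_eq[OF A] using conj_weight_le_1[OF A _ n2] assms
    by (intro nn_integral_mono) (auto simp: indicator_def)
  also have "\<dots> = H_int n A s + ennreal (t - s)"
    unfolding H_int_eq[OF A] using assms by (subst nn_integral_add) auto
  finally show ?thesis .
qed

lemma H_int_mono: assumes "s \<le> t" shows "H_int n A s \<le> H_int n A t"
  unfolding H_int_def using assms by (intro nn_integral_mono) (auto simp: indicator_def)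

lemma H_int_finite: "0 \<le> s \<Longrightarrow> H_int n A s < \<infinity>"
  using H_int_le[of s] by (auto intro: le_less_trans)

lemma H_int_0: "H_int n A 0 = 0"
  using H_int_le[of 0] by simp

text \<open>The integrand is at most 1, so that the integral is Lipschitz continuous in \<open>s\<close>.\<close>

lemma H_int_IVT:
  assumes "0 \<le> s" "0 \<le> v" "ennreal v \<le> H_int n A s"
  shows "\<exists>s'. 0 \<le> s' \<and> s' \<le> s \<and> H_int n A s' = ennreal v"
proof -
  define h where "h = (\<lambda>s. enn2real (H_int n A s))"
  have hH: "H_int n A t = ennreal (h t)" if "0 \<le> t" for t
    using H_int_finite[OF that] by (simp add: h_def less_top)
  have h0: "0 \<le> h t" for t by (simp add: h_def)
  have lip: "\<bar>h t - h t'\<bar> \<le> \<bar>t - t'\<bar>" if "0 \<le> t" "0 \<le> t'" for t t'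
  proof -
    have *: "h t \<le> h t' \<and> h t' \<le> h t + (t' - t)" if "0 \<le> t" "t \<le> t'" for t t'
    proof
      have "ennreal (h t) \<le> ennreal (h t')" using H_int_mono[of t t'] that by (simp add: hH)
      thus "h t \<le> h t'" using h0[of t'] by simp
      have "ennreal (h t') \<le> ennreal (h t) + ennreal (t' - t)" using H_int_add[of t t'] that by (simp add: hH)
      thus "h t' \<le> h t + (t' - t)" using that h0[of t] by (simp flip: ennreal_plus)
    qed
    show ?thesis using *[of t t'] *[of t' t] that by (cases "t \<le> t'") auto
  qed
  have "continuous_on {0..s} h"
    unfolding continuous_on_iff dist_real_def
  proof (intro ballI allI impI)
    fix t e :: real assume "t \<in> {0..s}" "0 < e"
    thus "\<exists>d>0. \<forall>t'\<in>{0..s}. \<bar>t' - t\<bar> < d \<longrightarrow> \<bar>h t' - h t\<bar> < e"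
      using le_less_trans[OF lip] by (intro exI[of _ e]) auto
  qed
  moreover have "v \<le> h s" using assms hH[of s] h0[of s] by simp
  moreover have "h 0 = 0" by (simp add: h_def H_int_0)
  ultimately have "\<exists>x\<ge>0. x \<le> s \<and> h x = v" using assms by (intro IVT') auto
  thus ?thesis using hH by blast
qed

lemma sob_H_eq: assumes "0 \<le> s"
  shows "sob_H n A s = ennreal (enn2real (H_int n A s) powr ((real n - 1) / real n))"
proof -
  have "(\<integral>\<^sup>+\<tau>\<in>{0..s}. ennpowr (ennreal \<tau> / A \<tau>) (1 / (real n - 1)) \<partial>lborel) = H_int n A s"
    unfolding H_int_def
  proof (intro nn_integral_cong)
    fix \<tau> :: real
    show "ennpowr (ennreal \<tau> / A \<tau>) (1 / (real n - 1)) * indicator {0..s} \<tau> = ennreal (conj_weight n A \<tau>) * indicator {0..s} \<tau>"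
    proof (cases "\<tau> \<in> {0..s}")
      case True
      hence "ennreal \<tau> / A \<tau> \<noteq> \<infinity>" using ratio_le_1[OF A, of \<tau>] by (auto simp: top_unique)
      thus ?thesis by (simp add: ennpowr_def conj_weight_def)
    qed simp
  qed
  thus ?thesis using H_int_finite[OF assms] unfolding sob_H_def ennpowr_def by auto
qed

lemma sob_H_ge_iff:
  assumes "0 \<le> s" "0 < t"
  shows "ennreal t \<le> sob_H n A s \<longleftrightarrow> ennreal (t powr (real n / (real n - 1))) \<le> H_int n A s"
proof -
  define h where "h = enn2real (H_int n A s)"
  have hH: "H_int n A s = ennreal h" using H_int_finite[OF assms(1)] by (simp add: h_def less_top)
  have h0: "0 \<le> h" by (simp add: h_def)
  define q where "q = (real n - 1) / real n"
  have q: "q > 0" "real n / (real n - 1) = 1 / q" using n2 by (auto simp: q_def)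
  have "ennreal t \<le> sob_H n A s \<longleftrightarrow> t \<le> h powr q"
    unfolding sob_H_eq[OF assms(1)] h_def[symmetric] q_def[symmetric] using assms by simp
  also have "\<dots> \<longleftrightarrow> t powr (1 / q) \<le> h"
  proof
    assume "t \<le> h powr q"
    hence "t powr (1 / q) \<le> (h powr q) powr (1 / q)" using assms q by (intro powr_mono2) auto
    thus "t powr (1 / q) \<le> h" using q h0 by (simp add: powr_powr)
  next
    assume "t powr (1 / q) \<le> h"
    hence "(t powr (1 / q)) powr q \<le> h powr q" using assms q by (intro powr_mono2) auto
    thus "t \<le> h powr q" using q assms by (simp add: powr_powr)
  qed
  also have "\<dots> \<longleftrightarrow> ennreal (t powr (real n / (real n - 1))) \<le> H_int n A s"
    unfolding hH q(2) using h0 by simp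
  finally show ?thesis .
qed

lemma conj_of_le:
  assumes "0 \<le> s" "0 < t" "ennreal (t powr (real n / (real n - 1))) \<le> H_int n A s"
  shows "conj_of n A t \<le> A s"
proof -
  have le: "left_inverse (sob_H n A) t \<le> ennreal s"
    using assms sob_H_ge_iff by (intro left_inverse_le) auto
  hence "left_inverse (sob_H n A) t \<noteq> \<infinity>" by (auto simp: top_unique)
  moreover have "enn2real (left_inverse (sob_H n A) t) \<le> s"
    using enn2real_mono[OF le] assms by simp
  ultimately show ?thesis
    unfolding conj_of_def Let_def by (simp add: young_normal_mono[OF A])
qed

lemma conj_of_mono: assumes "t \<le> t'" shows "conj_of n A t \<le> conj_of n A t'"
proof (cases "left_inverse (sob_H n A) t' = \<infinity>")
  case False
  have le: "left_inverse (sob_H n A) t \<le> left_inverse (sob_H n A) t'"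
    by (rule left_inverse_mono[OF assms])
  hence "left_inverse (sob_H n A) t \<noteq> \<infinity>" using False by (auto simp: top_unique)
  moreover have "enn2real (left_inverse (sob_H n A) t) \<le> enn2real (left_inverse (sob_H n A) t')"
    using le False by (intro enn2real_mono) (auto simp: less_top)
  ultimately show ?thesis using False
    unfolding conj_of_def Let_def by (simp add: young_normal_mono[OF A])
qed (simp add: conj_of_def)

lemma conj_of_0: "conj_of n A 0 = 0"
proof -
  have "left_inverse (sob_H n A) 0 \<le> ennreal 0" by (intro left_inverse_le) auto
  hence "left_inverse (sob_H n A) 0 = 0" by simp
  thus ?thesis using young_normal_small[OF A, of 0] by (simp add: conj_of_def)
qed

text \<open>In the second case the conjugate is infinite at the level that corresponds to \<open>v\<close>: either \<open>A\<close>
  is already infinite wherever \<^const>\<open>H_int\<close> reaches \<open>v\<close>, or \<open>v\<close> is never reached. In both situations the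
  continuity of \<open>A\<close> provides admissible points with arbitrarily large finite values of \<open>A\<close>.\<close>

lemma conj_level_cases:
  assumes v: "v > 0"
  obtains (attained) s where "s > 0" "A s < \<infinity>" "H_int n A s = ennreal v"
    | (unattained) "\<And>m::real. m \<ge> 1 \<Longrightarrow> \<exists>s>0. A s = ennreal m \<and> H_int n A s \<le> ennreal v"
proof (cases "\<exists>s\<ge>0. A s < \<infinity> \<and> H_int n A s = ennreal v")
  case True
  then obtain s where s: "s \<ge> 0" "A s < \<infinity>" "H_int n A s = ennreal v" by blast
  moreover have "s \<noteq> 0" using s H_int_0 v by auto
  ultimately show thesis using attained[of s] by simp
next
  case False
  have "\<exists>s>0. A s = ennreal m \<and> H_int n A s \<le> ennreal v" if m: "m \<ge> 1" for m :: real
  proof -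
    have "\<exists>s0\<ge>0. ennreal m \<le> A s0 \<and> H_int n A s0 \<le> ennreal v"
    proof (cases "\<exists>s\<ge>0. ennreal v \<le> H_int n A s")
      case True
      then obtain s where s: "s \<ge> 0" "ennreal v \<le> H_int n A s" by blast
      then obtain s0 where s0: "0 \<le> s0" "H_int n A s0 = ennreal v"
        using H_int_IVT[of s v] v by auto
      hence "\<not> A s0 < \<infinity>" using False by blast
      hence "A s0 = \<infinity>" by (simp add: less_top[symmetric])
      thus ?thesis using s0 by (intro exI[of _ s0]) auto
    next
      case no: False
      have "ennreal m \<le> A m" using m by (intro young_normal_ge[OF A]) auto
      moreover have "H_int n A m \<le> ennreal v" using no m by (meson less_imp_le not_le order_trans zero_le_one)
      ultimately show ?thesis using m by (intro exI[of _ m]) auto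
    qed
    then obtain s0 where s0: "s0 \<ge> 0" "ennreal m \<le> A s0" "H_int n A s0 \<le> ennreal v" by blast
    then obtain s where s: "0 \<le> s" "s \<le> s0" "A s = ennreal m" using young_normal_IVT[OF A s0(1,2)] by blast
    moreover have "s \<noteq> 0" using s m young_normal_small[OF A, of 0] by (auto simp: ennreal_eq_0_iff)
    ultimately show ?thesis using H_int_mono[OF s(2)] s0(3) by (intro exI[of _ s]) auto
  qed
  thus thesis by (rule unattained)
qed

end

text \<open>The substitution \<open>\<tau> = \<sigma> / D\<close>; the power of \<open>D\<close> collects the Jacobian and the numerator \<open>\<tau>\<close>. After
  the outer power \<open>1 / n'\<close> it becomes \<open>1 / D\<close>.\<close>

lemma H_int_dilate:
  assumes A: "young_normal A" and B: "young_normal B" and n: "n \<ge> 2" and D: "D \<ge> 1" and s: "s \<ge> 0"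
    and fin: "A s < \<infinity>" and le: "\<And>\<sigma>. 0 \<le> \<sigma> \<Longrightarrow> \<sigma> \<le> s \<Longrightarrow> B (\<sigma> / D) \<le> A \<sigma>"
  shows "ennreal (D powr (- (real n / (real n - 1)))) * H_int n A s \<le> H_int n B (s / D)"
proof -
  note [measurable] = conj_weight_measurable[OF A] conj_weight_measurable[OF B]
  define p where "p = 1 / (real n - 1)"
  have p: "p > 0" "real n / (real n - 1) = 1 + p" using n by (auto simp: p_def field_simps)
  have D0: "D > 0" using D by simp
  have w: "D powr (- p) * conj_weight n A \<sigma> \<le> conj_weight n B (\<sigma> / D)" if \<sigma>: "0 < \<sigma>" "\<sigma> \<le> s" for \<sigma>
  proof -
    have fA: "A \<sigma> < \<infinity>" using young_normal_mono[OF A, of \<sigma> s] \<sigma> fin by (auto intro: le_less_trans)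
    hence fB: "B (\<sigma> / D) < \<infinity>" using le[of \<sigma>] \<sigma> by (auto intro: le_less_trans)
    obtain a where a: "a \<ge> 0" "A \<sigma> = ennreal a" using fA by (cases "A \<sigma>") auto
    obtain b where b: "b \<ge> 0" "B (\<sigma> / D) = ennreal b" using fB by (cases "B (\<sigma> / D)") auto
    have "b \<le> a" using le[of \<sigma>] \<sigma> a b by simp
    have "\<sigma> / D \<le> b" using young_normal_ge[OF B, of "\<sigma> / D"] \<sigma> D b by simp
    hence "b > 0" using \<sigma> D0 by (smt (verit) divide_pos_pos)
    have "D powr (- p) * conj_weight n A \<sigma> = (inverse D * (\<sigma> / a)) powr p"
      unfolding powr_mult using \<open>b > 0\<close> \<open>b \<le> a\<close> \<sigma> D0
      by (simp add: conj_weight_def p_def[symmetric] a divide_ennreal powr_minus inverse_powr)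
    also have "\<dots> \<le> (\<sigma> / D / b) powr p"
      using \<open>b > 0\<close> \<open>b \<le> a\<close> \<sigma> D0 p by (intro powr_mono2) (auto simp: field_simps)
    also have "\<dots> = conj_weight n B (\<sigma> / D)"
      using \<open>b > 0\<close> \<sigma> D0 by (simp add: conj_weight_def p_def[symmetric] b divide_ennreal)
    finally show ?thesis .
  qed
  have "H_int n B (s / D) = (\<integral>\<^sup>+\<sigma>. ennreal (1 / D) * (ennreal (conj_weight n B (max 0 (\<sigma> / D))) * indicator {0..s / D} (\<sigma> / D)) \<partial>lborel)"
  proof -
    have "H_int n B (s / D) = \<bar>1 / D\<bar> * (\<integral>\<^sup>+\<sigma>. ennreal (conj_weight n B (max 0 (0 + 1 / D * \<sigma>))) * indicator {0..s / D} (0 + 1 / D * \<sigma>) \<partial>lborel)"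
      unfolding H_int_eq[OF B] using D0 by (intro nn_integral_real_affine) auto
    thus ?thesis using D0 by (subst nn_integral_cmult) auto
  qed
  also have "\<dots> \<ge> (\<integral>\<^sup>+\<sigma>. ennreal (D powr (- (1 + p))) * (ennreal (conj_weight n A (max 0 \<sigma>)) * indicator {0..s} \<sigma>) \<partial>lborel)"
  proof (rule nn_integral_mono_AE)
    have "AE \<sigma> in lborel. \<sigma> \<noteq> (0::real)" by (rule AE_lborel_singleton)
    thus "AE \<sigma> in lborel. ennreal (D powr (- (1 + p))) * (ennreal (conj_weight n A (max 0 \<sigma>)) * indicator {0..s} \<sigma>)
        \<le> ennreal (1 / D) * (ennreal (conj_weight n B (max 0 (\<sigma> / D))) * indicator {0..s / D} (\<sigma> / D))"
    proof eventually_elim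
      case (elim \<sigma>)
      show ?case
      proof (cases "\<sigma> \<in> {0..s}")
        case True
        hence \<sigma>: "0 < \<sigma>" "\<sigma> \<le> s" using elim by auto
        have "D powr (- (1 + p)) = 1 / D * D powr (- p)"
          using D0 by (simp add: powr_diff powr_minus powr_add field_simps)
        hence "D powr (- (1 + p)) * conj_weight n A \<sigma> \<le> 1 / D * conj_weight n B (\<sigma> / D)"
          using mult_left_mono[OF w[OF \<sigma>], of "1 / D"] D0 by (simp add: mult.assoc)
        hence "ennreal (D powr (- (1 + p))) * ennreal (conj_weight n A \<sigma>) \<le> ennreal (1 / D) * ennreal (conj_weight n B (\<sigma> / D))"
          using D0 conj_weight_nonneg[OF A] conj_weight_nonneg[OF B] by (simp flip: ennreal_mult)
        thus ?thesis using \<sigma> D0 by (simp add: divide_right_mono)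
      qed simp
    qed
  qed
  also have "(\<integral>\<^sup>+\<sigma>. ennreal (D powr (- (1 + p))) * (ennreal (conj_weight n A (max 0 \<sigma>)) * indicator {0..s} \<sigma>) \<partial>lborel)
     = ennreal (D powr (- (1 + p))) * H_int n A s"
    unfolding H_int_eq[OF A] by (intro nn_integral_cmult) measurable
  finally show ?thesis by (simp add: p(2))
qed

section \<open>The weak type inequality\<close>

text \<open>A maximal function estimate for a bound \<open>h\<close> that depends on the point. There is no weak type bound
  for \<open>{M g > h}\<close> with variable \<open>h\<close>, but selecting disjoint balls provides a function that is at
  least \<open>h\<close> at the centre of some enlarged ball around each point; comparing \<open>h\<close> at the two
  points is left to the application.\<close>

lemma vitali_weighted:
  fixes g :: "real^'n \<Rightarrow> ennreal" and h r :: "real^'n \<Rightarrow> real"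
  assumes [measurable]: "g \<in> borel_measurable borel"
    and r: "\<And>x. x \<in> K \<Longrightarrow> 0 < r x \<and> r x \<le> B" and h: "\<And>x. x \<in> K \<Longrightarrow> 0 \<le> h x"
    and mass: "\<And>x. x \<in> K \<Longrightarrow> ennreal (h x * r x ^ CARD('n)) \<le> (\<integral>\<^sup>+y. indicator (ball x (r x)) y * g y \<partial>lborel)"
  obtains G where "G \<in> borel_measurable borel"
    "\<And>y. y \<in> K \<Longrightarrow> \<exists>x\<in>K. y \<in> ball x (5 * r x) \<and> ennreal (h x) \<le> G y"
    "(\<integral>\<^sup>+y. G y \<partial>lborel) \<le> ennreal (5 ^ CARD('n) * unit_ball_vol (real CARD('n))) * (\<integral>\<^sup>+y. g y \<partial>lborel)"
proof -
  let ?C = "5 ^ CARD('n) * unit_ball_vol (real CARD('n))"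
  obtain C where C: "countable C" "C \<subseteq> K"
     "pairwise (\<lambda>i j. disjnt (ball i (r i)) (ball j (r j))) C"
     "K \<subseteq> (\<Union>i\<in>C. ball i (5 * r i))"
    using Vitali_covering_lemma_balls[where S = K and K = K and a = "\<lambda>x. x" and r = r and B = B] r by force
  define G where "G = (\<lambda>y. SUP x\<in>C. ennreal (h x) * indicator (ball x (5 * r x)) y)"
  have [measurable]: "G \<in> borel_measurable borel"
    unfolding G_def using C(1) by (intro borel_measurable_SUP) auto
  have G_ge: "\<exists>x\<in>K. y \<in> ball x (5 * r x) \<and> ennreal (h x) \<le> G y" if y: "y \<in> K" for y
  proof -
    obtain x where x: "x \<in> C" "y \<in> ball x (5 * r x)" using C(4) y by auto
    have "ennreal (h x) * indicator (ball x (5 * r x)) y \<le> G y"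
      unfolding G_def using x(1) by (intro SUP_upper)
    thus ?thesis using x C(2) by auto
  qed
  have "G y \<le> (\<integral>\<^sup>+x. ennreal (h x) * indicator (ball x (5 * r x)) y \<partial>count_space C)" for y
    unfolding G_def by (intro SUP_least nn_integral_ge_point)
  hence "(\<integral>\<^sup>+y. G y \<partial>lborel) \<le> (\<integral>\<^sup>+y. (\<integral>\<^sup>+x. ennreal (h x) * indicator (ball x (5 * r x)) y \<partial>count_space C) \<partial>lborel)"
    by (intro nn_integral_mono)
  also have "\<dots> = (\<integral>\<^sup>+x. (\<integral>\<^sup>+y. ennreal (h x) * indicator (ball x (5 * r x)) y \<partial>lborel) \<partial>count_space C)"
    using C(1) by (intro nn_integral_count_space_nn_integral) auto
  also have "\<dots> \<le> (\<integral>\<^sup>+x. ennreal ?C * emeasure (density lborel g) (ball x (r x)) \<partial>count_space C)"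
  proof (intro nn_integral_mono)
    fix x assume "x \<in> space (count_space C)"
    hence x: "x \<in> K" using C by auto
    have "(\<integral>\<^sup>+y. ennreal (h x) * indicator (ball x (5 * r x)) y \<partial>lborel) = ennreal (h x) * ennreal (unit_ball_vol (real CARD('n)) * (5 * r x) ^ CARD('n))"
      using r[OF x] by (simp add: nn_integral_cmult_indicator emeasure_ball)
    also have "\<dots> = ennreal ?C * ennreal (h x * r x ^ CARD('n))"
      using r[OF x] h[OF x] by (simp add: power_mult_distrib mult_ac flip: ennreal_mult)
    also have "\<dots> \<le> ennreal ?C * (\<integral>\<^sup>+y. indicator (ball x (r x)) y * g y \<partial>lborel)"
      by (intro mult_left_mono mass x) auto
    also have "(\<integral>\<^sup>+y. indicator (ball x (r x)) y * g y \<partial>lborel) = emeasure (density lborel g) (ball x (r x))"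
      by (simp add: emeasure_density mult.commute)
    finally show "(\<integral>\<^sup>+y. ennreal (h x) * indicator (ball x (5 * r x)) y \<partial>lborel) \<le> ennreal ?C * emeasure (density lborel g) (ball x (r x))" .
  qed
  also have "\<dots> = ennreal ?C * (\<integral>\<^sup>+x. emeasure (density lborel g) (ball x (r x)) \<partial>count_space C)"
    by (intro nn_integral_cmult) auto
  also have "(\<integral>\<^sup>+x. emeasure (density lborel g) (ball x (r x)) \<partial>count_space C) = emeasure (density lborel g) (\<Union>x\<in>C. ball x (r x))"
    using C(1,3) by (intro emeasure_UN_countable[symmetric])
      (auto simp: disjoint_family_on_def pairwise_def disjnt_def)
  also have "\<dots> \<le> emeasure (density lborel g) (space (density lborel g))"
    by (rule emeasure_space)
  also have "\<dots> = (\<integral>\<^sup>+y. g y \<partial>lborel)"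
    by (simp add: emeasure_density)
  finally show thesis using G_ge by (intro that[of G]) (auto simp: mult_left_mono)
qed

definition potential_const :: "nat \<Rightarrow> real" where
  "potential_const n = real n * unit_ball_vol (real n) + 1 + real n"

definition covering_const :: "nat \<Rightarrow> real" where
  "covering_const n = 5 ^ n * unit_ball_vol (real n)"

text \<open>Condition (A1) for the normalized functions. The restriction to levels below \<open>\<bar>x - y\<bar>\<^sup>-\<^sup>n\<close>, up to a
  constant, replaces the balls. The number 6 exceeds the factor 5 of Vitali's lemma, which leaves
  room for the strict inequality in \<open>compare_reverse\<close>.\<close>

definition comparable_family :: "real \<Rightarrow> (real^'n) set \<Rightarrow> (real^'n \<Rightarrow> real \<Rightarrow> ennreal) \<Rightarrow> bool" where
  "comparable_family D N \<Phi> \<longleftrightarrow> 1 \<le> D \<and> (AE x in lborel. x \<notin> N) \<and> (\<forall>x. x \<notin> N \<longrightarrow> young_normal (\<Phi> x)) \<and>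
     (\<forall>x y l. x \<notin> N \<longrightarrow> y \<notin> N \<longrightarrow> 0 \<le> l \<longrightarrow>
        \<Phi> x l * ennreal (dist x y ^ CARD('n)) \<le> ennreal (6 ^ CARD('n)) \<longrightarrow> \<Phi> x l \<le> \<Phi> y (D * l))"

context
  fixes \<Phi> :: "real^'n \<Rightarrow> real \<Rightarrow> ennreal" and N :: "(real^'n) set" and D :: real
  assumes n2: "CARD('n) \<ge> 2" and fam: "comparable_family D N \<Phi>"
begin

lemma dilation_ge_1: "1 \<le> D" and dilation_pos: "0 < D" and AE_comparable: "AE x in lborel. x \<notin> N"
  using fam by (auto simp: comparable_family_def)

lemma comparable_young_normal: "x \<notin> N \<Longrightarrow> young_normal (\<Phi> x)"
  using fam by (auto simp: comparable_family_def)

lemma comparable: "x \<notin> N \<Longrightarrow> y \<notin> N \<Longrightarrow> 0 \<le> l \<Longrightarrow>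
    \<Phi> x l * ennreal (dist x y ^ CARD('n)) \<le> ennreal (6 ^ CARD('n)) \<Longrightarrow> \<Phi> x l \<le> \<Phi> y (D * l)"
  using fam by (auto simp: comparable_family_def)

text \<open>The comparability is assumed where the smaller function is evaluated at a controlled level. If the
  opposite comparison failed, the intermediate value theorem would provide an argument at which
  \<open>\<Phi>\<close> at \<open>y\<close> has a controlled value slightly above \<open>\<Phi> x l\<close>, to which the assumption applies.\<close>

lemma compare_reverse:
  assumes x: "x \<notin> N" and y: "y \<notin> N" and l: "0 \<le> l" and R: "R > 0" and yx: "y \<in> ball x (5 * R)"
    and h: "\<Phi> x l * ennreal (R ^ CARD('n)) \<le> 1"
  shows "\<Phi> y (l / D) \<le> \<Phi> x l"
proof (rule ccontr)
  define n where "n = CARD('n)"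
  have n: "n > 0" by (simp add: n_def)
  assume "\<not> \<Phi> y (l / D) \<le> \<Phi> x l"
  hence gt: "\<Phi> x l < \<Phi> y (l / D)" by simp
  have fin: "\<Phi> x l < \<infinity>" using gt by (auto intro: less_le_trans)
  then obtain v where v: "v \<ge> 0" "\<Phi> x l = ennreal v" by (cases "\<Phi> x l") auto
  define d where "d = dist x y"
  have d: "0 \<le> d" "d < 5 * R" using yx by (auto simp: d_def)
  have vR: "v * R ^ n \<le> 1" using h v R by (simp add: n_def flip: ennreal_mult)
  have "d ^ n \<le> (5 * R) ^ n" using d by (intro power_mono) auto
  hence "v * d ^ n \<le> 5 ^ n * (v * R ^ n)" using v mult_left_mono[of "d ^ n" "(5 * R) ^ n" v] by (simp add: power_mult_distrib mult_ac)
  also have "\<dots> \<le> 5 ^ n * 1" using vR by (intro mult_left_mono) auto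
  also have "(5::real) ^ n * 1 < 6 ^ n" using n by (simp add: power_strict_mono)
  finally have vd: "v * d ^ n < 6 ^ n" .
  \<comment> \<open>The largest excess that keeps the level \<open>v + \<epsilon>\<close> admissible, with \<open>d ^ n + 1\<close> in place of
    \<open>d ^ n\<close> to allow \<open>d = 0\<close>.\<close>
  define \<epsilon> where "\<epsilon> = (6 ^ n - v * d ^ n) / (d ^ n + 1)"
  have dn: "0 \<le> d ^ n" using d by simp
  have \<epsilon>: "\<epsilon> > 0" using vd dn by (simp add: \<epsilon>_def)
  have "(v + \<epsilon>) * d ^ n \<le> 6 ^ n"
  proof -
    have "\<epsilon> * (d ^ n + 1) = 6 ^ n - v * d ^ n" using dn by (simp add: \<epsilon>_def)
    thus ?thesis using \<epsilon> by (simp add: algebra_simps)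
  qed
  hence bound: "ennreal (v + \<epsilon>) * ennreal (dist y x ^ CARD('n)) \<le> ennreal (6 ^ CARD('n))"
    using v \<epsilon> d by (subst ennreal_mult[symmetric]) (auto simp: d_def n_def dist_commute intro!: ennreal_leI)
  define w where "w = min (ennreal (v + \<epsilon>)) (\<Phi> y (l / D))"
  have w: "\<Phi> x l < w" "w \<le> \<Phi> y (l / D)" "w \<le> ennreal (v + \<epsilon>)"
    using gt v \<epsilon> by (auto simp: w_def ennreal_less_iff)
  obtain l' where l': "0 \<le> l'" "l' \<le> l / D" "\<Phi> y l' = w"
    using young_normal_IVT[OF comparable_young_normal[OF y] _ w(2)] l dilation_pos by auto
  have "\<Phi> y l' * ennreal (dist y x ^ CARD('n)) \<le> ennreal (v + \<epsilon>) * ennreal (dist y x ^ CARD('n))"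
    unfolding l'(3) by (intro mult_right_mono w) auto
  hence "\<Phi> y l' \<le> \<Phi> x (D * l')" using bound by (intro comparable x y l') auto
  also have "\<dots> \<le> \<Phi> x l" using l' dilation_pos by (intro young_normal_mono[OF comparable_young_normal[OF x]]) (auto simp: field_simps)
  finally show False using w l' by simp
qed

text \<open>Comparability of the functions below the level \<open>\<Phi> x s\<close> gives a lower bound for \<^const>\<open>H_int\<close> at \<open>y\<close>,
  and hence an upper bound for the conjugate at \<open>y\<close>.\<close>

lemma conj_transfer:
  assumes x: "x \<notin> N" and y: "y \<notin> N" and s: "s > 0" and fin: "\<Phi> x s < \<infinity>" and t: "t > 0"
    and H: "H_int CARD('n) (\<Phi> x) s = ennreal (t powr (real CARD('n) / (real CARD('n) - 1)))"
    and R: "R > 0" "y \<in> ball x (5 * R)" and h: "\<Phi> x s * ennreal (R ^ CARD('n)) \<le> 1"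
  shows "conj_of CARD('n) (\<Phi> y) (t / D) \<le> \<Phi> x s"
proof -
  let ?q = "real CARD('n) / (real CARD('n) - 1)"
  have le: "\<Phi> y (\<sigma> / D) \<le> \<Phi> x \<sigma>" if "0 \<le> \<sigma>" "\<sigma> \<le> s" for \<sigma>
  proof (rule compare_reverse[OF x y that(1) R])
    have "\<Phi> x \<sigma> * ennreal (R ^ CARD('n)) \<le> \<Phi> x s * ennreal (R ^ CARD('n))"
      using that by (intro mult_right_mono young_normal_mono[OF comparable_young_normal[OF x]]) auto
    thus "\<Phi> x \<sigma> * ennreal (R ^ CARD('n)) \<le> 1" using h by simp
  qed
  have "ennreal ((t / D) powr ?q) = ennreal (D powr (- ?q)) * ennreal (t powr ?q)"
  proof -
    have "(t / D) powr ?q = D powr (- ?q) * t powr ?q"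
      using t dilation_pos by (simp add: powr_divide powr_minus_divide)
    thus ?thesis by (simp add: ennreal_mult)
  qed
  also have "\<dots> = ennreal (D powr (- ?q)) * H_int CARD('n) (\<Phi> x) s" by (simp add: H)
  also have "\<dots> \<le> H_int CARD('n) (\<Phi> y) (s / D)"
    using s fin le by (intro H_int_dilate comparable_young_normal x y n2 dilation_ge_1) auto
  finally have "conj_of CARD('n) (\<Phi> y) (t / D) \<le> \<Phi> y (s / D)"
    using s t dilation_pos by (intro conj_of_le comparable_young_normal y n2) auto
  also have "\<dots> \<le> \<Phi> x s" using le[of s] s by auto
  finally show ?thesis .
qed

text \<open>The contraposition of \<open>far_near_estimate\<close>: a large potential forces the density \<open>g\<close> to
  concentrate on some ball around \<open>x\<close>.\<close>

lemma concentration: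
  fixes f :: "real^'n \<Rightarrow> real" and g :: "real^'n \<Rightarrow> ennreal"
  assumes x: "x \<notin> N" and t: "t > 0" and s: "s > 0" "\<Phi> x s < \<infinity>"
    and H: "H_int CARD('n) (\<Phi> x) s \<le> ennreal (t powr (real CARD('n) / (real CARD('n) - 1)))"
    and [measurable]: "f \<in> borel_measurable borel" "g \<in> borel_measurable borel"
    and f0: "\<And>y. 0 \<le> f y" and g1: "(\<integral>\<^sup>+y. g y \<partial>lborel) \<le> 1"
    and g: "AE y in lborel. \<Phi> y (D * f y) \<le> g y"
    and big: "ennreal (potential_const CARD('n) * t) < (\<integral>\<^sup>+y. ennreal (f y) * ennreal (riesz (y - x)) \<partial>lborel)"
  obtains r where "r > 0" "\<Phi> x s * ennreal (r ^ CARD('n)) \<le> 1"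
    "\<Phi> x s * ennreal (r ^ CARD('n)) \<le> (\<integral>\<^sup>+y. indicator (ball x r) y * g y \<partial>lborel)"
proof -
  have fg: "AE y in lborel. ennreal (f y) \<le> g y \<and>
        (\<forall>l\<ge>0. l < f y \<longrightarrow> \<Phi> x l * ennreal (norm (y - x) ^ CARD('n)) \<le> 1 \<longrightarrow> ennreal (f y) * \<Phi> x l \<le> ennreal l * g y)"
    using g AE_comparable
  proof eventually_elim
    case (elim y)
    note yny = comparable_young_normal[OF elim(2)]
    have "ennreal (f y) \<le> ennreal (D * f y)" using mult_right_mono[OF dilation_ge_1 f0[of y]] by (intro ennreal_leI) simp
    also have "\<dots> \<le> \<Phi> y (D * f y)" using dilation_pos f0[of y] by (intro young_normal_ge[OF yny]) simp
    also note elim(1)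
    finally have 1: "ennreal (f y) \<le> g y" .
    have "ennreal (f y) * \<Phi> x l \<le> ennreal l * g y"
      if l: "0 \<le> l" "l < f y" and d: "\<Phi> x l * ennreal (norm (y - x) ^ CARD('n)) \<le> 1" for l
    proof -
      have "\<Phi> x l * ennreal (dist x y ^ CARD('n)) \<le> ennreal (6 ^ CARD('n))"
      proof -
        have "\<Phi> x l * ennreal (dist x y ^ CARD('n)) \<le> 1"
          using d by (simp add: dist_norm norm_minus_commute)
        also have "\<dots> \<le> ennreal (6 ^ CARD('n))"
          using ennreal_leI[of 1 "6 ^ CARD('n)"] by simp
        finally show ?thesis .
      qed
      hence "\<Phi> x l \<le> \<Phi> y (D * l)" by (intro comparable x elim(2) l)
      also have "\<dots> = \<Phi> y ((l / f y) * (D * f y))" using l by (simp add: mult.commute)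
      also have "\<dots> \<le> ennreal (l / f y) * \<Phi> y (D * f y)" using l dilation_pos by (intro young_normal_scale[OF yny]) auto
      also have "\<dots> \<le> ennreal (l / f y) * g y" using elim(1) by (intro mult_left_mono) auto
      finally have "ennreal (f y) * \<Phi> x l \<le> ennreal (f y) * (ennreal (l / f y) * g y)"
        by (intro mult_left_mono) auto
      also have "\<dots> = ennreal l * g y" using l by (simp add: mult.assoc[symmetric] flip: ennreal_mult)
      finally show ?thesis .
    qed
    with 1 show ?case by blast
  qed
  have "\<not> (\<forall>\<sigma>. 0 < \<sigma> \<longrightarrow> \<Phi> x s * ennreal (\<sigma> ^ CARD('n)) \<le> 1 \<longrightarrow>
        (\<integral>\<^sup>+y. indicator (ball x \<sigma>) y * g y \<partial>lborel) \<le> \<Phi> x s * ennreal (\<sigma> ^ CARD('n)))"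
    using far_near_estimate[OF comparable_young_normal[OF x] n2 t s H _ _ f0 g1 fg] big
    unfolding potential_const_def[symmetric] by (auto simp: not_le[symmetric])
  then obtain r where "0 < r" "\<Phi> x s * ennreal (r ^ CARD('n)) \<le> 1"
      "\<not> (\<integral>\<^sup>+y. indicator (ball x r) y * g y \<partial>lborel) \<le> \<Phi> x s * ennreal (r ^ CARD('n))" by blast
  thus thesis using that[of r] by (simp add: not_le less_imp_le)
qed

text \<open>The points where the potential is large are covered by balls on which \<open>g\<close> concentrates. Where the
  conjugate is finite, the covering lemma and \<open>conj_transfer\<close> give the majorant \<open>G\<close>. Where it is
  infinite, \<open>g\<close> concentrates with arbitrarily large density, so that these points form a null set.
  The majorant \<open>G\<close> is measurable, while the conjugate need not be measurable in \<open>x\<close>.\<close>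

lemma weak_type:
  fixes f :: "real^'n \<Rightarrow> real" and g :: "real^'n \<Rightarrow> ennreal"
  assumes t: "t > 0"
    and fm [measurable]: "f \<in> borel_measurable borel" and gm [measurable]: "g \<in> borel_measurable borel"
    and f0: "\<And>y. 0 \<le> f y" and g1: "(\<integral>\<^sup>+y. g y \<partial>lborel) \<le> 1"
    and g: "AE y in lborel. \<Phi> y (D * f y) \<le> g y"
  obtains G where "G \<in> borel_measurable borel"
    "AE x in lborel. ennreal (potential_const CARD('n) * t) < (\<integral>\<^sup>+y. ennreal (f y) * ennreal (riesz (y - x)) \<partial>lborel) \<longrightarrow>
        conj_of CARD('n) (\<Phi> x) (t / D) \<le> G x"
    "(\<integral>\<^sup>+y. G y \<partial>lborel) \<le> ennreal (covering_const CARD('n)) * (\<integral>\<^sup>+y. g y \<partial>lborel)"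
proof -
  define n where "n = CARD('n)"
  have n: "n > 0" by (simp add: n_def)
  define v where "v = t powr (real CARD('n) / (real CARD('n) - 1))"
  have v: "v > 0" using t by (simp add: v_def)
  define E where "E = {x. x \<notin> N \<and> ennreal (potential_const CARD('n) * t) < (\<integral>\<^sup>+y. ennreal (f y) * ennreal (riesz (y - x)) \<partial>lborel)}"
  define att where "att = (\<lambda>x s. s > 0 \<and> \<Phi> x s < \<infinity> \<and> H_int CARD('n) (\<Phi> x) s = ennreal v)"
  define E1 where "E1 = {x\<in>E. \<exists>s. att x s}"
  define E2 where "E2 = E - E1"
  have cover: "\<exists>r h. 0 < r \<and> 0 \<le> h \<and> ennreal h = \<Phi> x s \<and> h * r ^ n \<le> 1 \<and>
      ennreal (h * r ^ n) \<le> (\<integral>\<^sup>+y. indicator (ball x r) y * g y \<partial>lborel)"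
    if hyp: "x \<in> E" "s > 0" "\<Phi> x s < \<infinity>" "H_int CARD('n) (\<Phi> x) s \<le> ennreal v" for x s
  proof -
    obtain r where r: "r > 0" "\<Phi> x s * ennreal (r ^ CARD('n)) \<le> 1"
      "\<Phi> x s * ennreal (r ^ CARD('n)) \<le> (\<integral>\<^sup>+y. indicator (ball x r) y * g y \<partial>lborel)"
      using concentration[of x t s f g] hyp t f0 g1 g by (auto simp: E_def v_def)
    obtain h where h: "h \<ge> 0" "\<Phi> x s = ennreal h" using hyp(3) by (cases "\<Phi> x s") auto
    have "ennreal (h * r ^ n) = \<Phi> x s * ennreal (r ^ CARD('n))"
      using r h by (simp add: n_def ennreal_mult)
    with r(2,3) have "ennreal (h * r ^ n) \<le> 1" "ennreal (h * r ^ n) \<le> (\<integral>\<^sup>+y. indicator (ball x r) y * g y \<partial>lborel)"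
      by simp_all
    moreover from this have "h * r ^ n \<le> 1" by simp
    ultimately show ?thesis using r(1) h(1) h(2)[symmetric] by blast
  qed
  define Q where "Q = (\<lambda>x s r h. att x s \<and> 0 < r \<and> 0 \<le> h \<and> ennreal h = \<Phi> x s \<and> h * r ^ n \<le> 1 \<and>
      ennreal (h * r ^ n) \<le> (\<integral>\<^sup>+y. indicator (ball x r) y * g y \<partial>lborel))"
  have "\<exists>s r h. Q x s r h" if x: "x \<in> E1" for x
  proof -
    obtain s where s: "x \<in> E" "att x s" using x by (auto simp: E1_def)
    show ?thesis using cover[of x s] s unfolding Q_def by (auto simp: att_def)
  qed
  then obtain s r h where "\<And>x. x \<in> E1 \<Longrightarrow> Q x (s x) (r x) (h x)" by metis
  note srh = this[unfolded Q_def]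
  \<comment> \<open>A uniform bound on the radii, as required for the covering lemma.\<close>
  have r_bd: "r x \<le> max 1 (1 / v)" if "x \<in> E1" for x
  proof -
    have xN: "x \<notin> N" using that by (auto simp: E1_def E_def)
    have "ennreal v \<le> ennreal (s x)"
      using H_int_le[OF comparable_young_normal[OF xN] n2, of "s x"] srh[OF that] by (auto simp: att_def)
    also have "\<dots> \<le> ennreal (h x)" using young_normal_ge[OF comparable_young_normal[OF xN], of "s x"] srh[OF that] by (auto simp: att_def)
    finally have "v \<le> h x" by (subst (asm) ennreal_le_iff) (use srh[OF that] in auto)
    hence "v * r x ^ n \<le> h x * r x ^ n" using srh[OF that] by (intro mult_right_mono) auto
    hence "v * r x ^ n \<le> 1" using srh[OF that] by linarith
    hence rn: "r x ^ n \<le> 1 / v" using v by (simp add: field_simps)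
    show ?thesis
    proof (cases "r x \<le> 1")
      case False
      hence "r x ^ 1 \<le> r x ^ n" using n by (intro power_increasing) auto
      thus ?thesis using rn by simp
    qed simp
  qed
  obtain G where G: "G \<in> borel_measurable borel"
    "\<And>y. y \<in> E1 \<Longrightarrow> \<exists>x\<in>E1. y \<in> ball x (5 * r x) \<and> ennreal (h x) \<le> G y"
    "(\<integral>\<^sup>+y. G y \<partial>lborel) \<le> ennreal (covering_const CARD('n)) * (\<integral>\<^sup>+y. g y \<partial>lborel)"
    using vitali_weighted[OF gm, of E1 r "max 1 (1 / v)" h] srh r_bd by (auto simp: n_def covering_const_def)
  have on_E1: "conj_of CARD('n) (\<Phi> y) (t / D) \<le> G y" if y: "y \<in> E1" for y
  proof -
    obtain x where x: "x \<in> E1" "y \<in> ball x (5 * r x)" "ennreal (h x) \<le> G y" using G(2)[OF y] by blast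
    have "conj_of CARD('n) (\<Phi> y) (t / D) \<le> \<Phi> x (s x)"
    proof (rule conj_transfer[OF _ _ _ _ t _ _ x(2)])
      show "x \<notin> N" "y \<notin> N" using x y by (auto simp: E1_def E_def)
      have "ennreal (h x) * ennreal (r x ^ CARD('n)) = ennreal (h x * r x ^ n)"
        using srh[OF x(1)] by (simp add: n_def ennreal_mult)
      also have "\<dots> \<le> 1" using srh[OF x(1)] by simp
      finally show "\<Phi> x (s x) * ennreal (r x ^ CARD('n)) \<le> 1" using srh[OF x(1)] by simp
    qed (use srh[OF x(1)] in \<open>auto simp: att_def v_def\<close>)
    thus ?thesis using x(3) srh[OF x(1)] by simp
  qed
  have E2_levels: "\<exists>S. S \<in> sets borel \<and> E2 \<subseteq> S \<and> emeasure lborel S \<le> ennreal (covering_const CARD('n) / m)" if m: "m \<ge> 1" for m :: real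
  proof -
    have "\<forall>x\<in>E2. \<exists>r. 0 < r \<and> m * r ^ n \<le> 1 \<and> ennreal (m * r ^ n) \<le> (\<integral>\<^sup>+y. indicator (ball x r) y * g y \<partial>lborel)"
    proof
      fix x assume x: "x \<in> E2"
      hence xN: "x \<notin> N" and xE: "x \<in> E" and "\<nexists>s. att x s" by (auto simp: E2_def E1_def E_def)
      have "\<exists>s>0. \<Phi> x s = ennreal m \<and> H_int CARD('n) (\<Phi> x) s \<le> ennreal v"
      proof (cases rule: conj_level_cases[OF comparable_young_normal[OF xN] n2 v, case_names attained unattained])
        case (attained s)
        thus ?thesis using \<open>\<nexists>s. att x s\<close> by (auto simp: att_def)
      next
        case unattained
        thus ?thesis using m by blast
      qed
      then obtain s where s: "s > 0" "\<Phi> x s = ennreal m" "H_int CARD('n) (\<Phi> x) s \<le> ennreal v" by blast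
      obtain r h where "0 < r" "0 \<le> h" "ennreal h = \<Phi> x s" "h * r ^ n \<le> 1"
          "ennreal (h * r ^ n) \<le> (\<integral>\<^sup>+y. indicator (ball x r) y * g y \<partial>lborel)"
        using cover[OF xE s(1) _ s(3)] s(2) by auto
      moreover have "h = m" using calculation s m by simp
      ultimately show "\<exists>r. 0 < r \<and> m * r ^ n \<le> 1 \<and> ennreal (m * r ^ n) \<le> (\<integral>\<^sup>+y. indicator (ball x r) y * g y \<partial>lborel)"
        by blast
    qed
    then obtain r where r: "\<And>x. x \<in> E2 \<Longrightarrow> 0 < r x \<and> m * r x ^ n \<le> 1 \<and>
        ennreal (m * r x ^ n) \<le> (\<integral>\<^sup>+y. indicator (ball x (r x)) y * g y \<partial>lborel)"
      by (auto simp: bchoice_iff)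
    have r1: "r x \<le> 1" if "x \<in> E2" for x
    proof (rule ccontr)
      assume "\<not> r x \<le> 1"
      hence "1 < r x ^ n" using n by (intro one_less_power) auto
      moreover have "1 * r x ^ n \<le> m * r x ^ n" using m r[OF that] by (intro mult_right_mono) auto
      ultimately show False using r[OF that] by linarith
    qed
    obtain G' where G': "G' \<in> borel_measurable borel"
      "\<And>y. y \<in> E2 \<Longrightarrow> \<exists>x\<in>E2. y \<in> ball x (5 * r x) \<and> ennreal m \<le> G' y"
      "(\<integral>\<^sup>+y. G' y \<partial>lborel) \<le> ennreal (covering_const CARD('n)) * (\<integral>\<^sup>+y. g y \<partial>lborel)"
      using vitali_weighted[OF gm, of E2 r 1 "\<lambda>_. m"] r r1 m by (auto simp: n_def covering_const_def)
    note [measurable] = G'(1)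
    define S where "S = {y. ennreal m \<le> G' y}"
    have [measurable]: "S \<in> sets borel" unfolding S_def by measurable
    have "ennreal m * emeasure lborel S = (\<integral>\<^sup>+y. ennreal m * indicator S y \<partial>lborel)"
      by (simp add: nn_integral_cmult_indicator)
    also have "\<dots> \<le> (\<integral>\<^sup>+y. G' y \<partial>lborel)"
      by (intro nn_integral_mono) (auto simp: S_def indicator_def)
    also have "\<dots> \<le> ennreal (covering_const CARD('n)) * 1"
      using G'(3) mult_left_mono[OF g1, of "ennreal (covering_const CARD('n))"] by (auto intro: order_trans)
    finally have "ennreal (1 / m) * (ennreal m * emeasure lborel S) \<le> ennreal (1 / m) * ennreal (covering_const CARD('n))"
      by (intro mult_left_mono) auto
    hence "emeasure lborel S \<le> ennreal (covering_const CARD('n) / m)"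
      using m by (simp add: mult.assoc[symmetric] covering_const_def flip: ennreal_mult)
    thus ?thesis using G'(2) by (intro exI[of _ S]) (auto simp: S_def)
  qed
  have "AE x in lborel. x \<notin> E2"
  proof -
    have "\<forall>j. \<exists>S. S \<in> sets borel \<and> E2 \<subseteq> S \<and> emeasure lborel S \<le> ennreal (covering_const CARD('n) / real (Suc j))"
      using E2_levels by (metis One_nat_def Suc_le_mono le0 of_nat_1 of_nat_le_iff)
    then obtain S where S: "\<And>j. S j \<in> sets borel" "\<And>j. E2 \<subseteq> S j" "\<And>j. emeasure lborel (S j) \<le> ennreal (covering_const CARD('n) / real (Suc j))"
      by (auto simp: choice_iff)
    have "emeasure lborel (\<Inter>j. S j) \<le> 0"
    proof (rule tendsto_lowerbound)
      have "(\<lambda>j. covering_const CARD('n) / real (Suc j)) \<longlonglongrightarrow> 0"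
        by (rule LIMSEQ_Suc[OF lim_const_over_n])
      thus "(\<lambda>j. ennreal (covering_const CARD('n) / real (Suc j))) \<longlonglongrightarrow> 0"
        using tendsto_ennrealI by fastforce
      show "\<forall>\<^sub>F j in sequentially. emeasure lborel (\<Inter>j. S j) \<le> ennreal (covering_const CARD('n) / real (Suc j))"
      proof (intro always_eventually allI)
        fix j
        have "emeasure lborel (\<Inter>j. S j) \<le> emeasure lborel (S j)" using S(1) by (intro emeasure_mono) auto
        also note S(3)[of j]
        finally show "emeasure lborel (\<Inter>j. S j) \<le> ennreal (covering_const CARD('n) / real (Suc j))" .
      qed
    qed simp
    hence "(\<Inter>j. S j) \<in> null_sets lborel" using S(1) by auto
    from AE_not_in[OF this] show ?thesis by eventually_elim (use S(2) in auto)
  qed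
  with AE_comparable have "AE x in lborel. ennreal (potential_const CARD('n) * t) < (\<integral>\<^sup>+y. ennreal (f y) * ennreal (riesz (y - x)) \<partial>lborel) \<longrightarrow>
        conj_of CARD('n) (\<Phi> x) (t / D) \<le> G x"
  proof eventually_elim
    case (elim x)
    thus ?case using on_E1[of x] by (auto simp: E2_def E_def)
  qed
  thus thesis using G by (intro that[of G])
qed

end

section \<open>From weak to strong type by truncation\<close>

lemma pos_part_square_deriv:
  "((\<lambda>w::real. (max 0 w)\<^sup>2) has_real_derivative 2 * max 0 w) (at w)"
proof -
  consider "w > 0" | "w < 0" | "w = 0" by linarith
  thus ?thesis
  proof cases
    case 1
    have "((\<lambda>w::real. w\<^sup>2) has_real_derivative 2 * max 0 w) (at w)"
      using 1 by (auto intro!: derivative_eq_intros)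
    moreover have "eventually (\<lambda>s. s\<^sup>2 = (max 0 s)\<^sup>2) (nhds w)"
      using eventually_nhds_in_open[of "{0<..}" w] 1 by (auto elim: eventually_mono)
    ultimately show ?thesis
      using DERIV_cong_ev[of w w "\<lambda>s. s\<^sup>2" "\<lambda>s. (max 0 s)\<^sup>2"] by auto
  next
    case 2
    have "eventually (\<lambda>s. 0 = (max 0 s)\<^sup>2) (nhds w)"
      using eventually_nhds_in_open[of "{..<0}" w] 2 by (auto elim: eventually_mono)
    thus ?thesis
      using DERIV_cong_ev[of w w "\<lambda>s. 0" "\<lambda>s. (max 0 s)\<^sup>2" 0 0] 2 by simp
  next
    case 3
    have "((\<lambda>h. (max 0 h)\<^sup>2 / h) \<longlongrightarrow> (0::real)) (at 0)"
    proof (rule Lim_null_comparison)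
      show "((\<lambda>h::real. \<bar>h\<bar>) \<longlongrightarrow> 0) (at 0)" by (auto intro!: tendsto_eq_intros)
      show "eventually (\<lambda>h::real. norm ((max 0 h)\<^sup>2 / h) \<le> \<bar>h\<bar>) (at 0)"
        by (intro always_eventually allI) (auto simp: max_def power2_eq_square)
    qed
    thus ?thesis by (simp add: DERIV_def 3)
  qed
qed

text \<open>A \<open>C\<^sup>1\<close> step from 0 to 1 on the unit interval, as a quadratic spline.\<close>

definition step :: "real \<Rightarrow> real" where
  "step w = 2 * ((max 0 w)\<^sup>2 - 2 * (max 0 (w - 1/2))\<^sup>2 + (max 0 (w - 1))\<^sup>2)"

definition dstep :: "real \<Rightarrow> real" where
  "dstep w = 4 * (max 0 w - 2 * max 0 (w - 1/2) + max 0 (w - 1))"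

lemma step_deriv: "(step has_real_derivative dstep w) (at w)"
proof -
  have sh: "((\<lambda>w. (max 0 (w - c))\<^sup>2) has_real_derivative 2 * max 0 (w - c)) (at w)" for c :: real
  proof -
    have "((\<lambda>w. w - c) has_real_derivative 1) (at w)" by (auto intro!: derivative_eq_intros)
    from DERIV_chain2[where f = "\<lambda>w. (max 0 w)\<^sup>2", OF pos_part_square_deriv this] show ?thesis by simp
  qed
  have "((\<lambda>w. 2 * ((max 0 w)\<^sup>2 - 2 * (max 0 (w - 1/2))\<^sup>2 + (max 0 (w - 1))\<^sup>2)) has_real_derivative
      2 * (2 * max 0 w - 2 * (2 * max 0 (w - 1/2)) + 2 * max 0 (w - 1))) (at w)"
    by (intro DERIV_cmult DERIV_add DERIV_diff sh pos_part_square_deriv)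
  thus ?thesis unfolding step_def[abs_def] dstep_def by (simp add: algebra_simps)
qed

lemma step_0: "w \<le> 0 \<Longrightarrow> step w = 0" and step_1: "w \<ge> 1 \<Longrightarrow> step w = 1"
  by (auto simp: step_def max_def power2_eq_square field_simps)

lemma dstep_bounds: "0 \<le> dstep w" "dstep w \<le> 2" "w \<le> 0 \<or> 1 \<le> w \<Longrightarrow> dstep w = 0"
  by (auto simp: dstep_def max_def field_simps)

lemma dstep_cont: "continuous_on UNIV dstep"
  unfolding dstep_def by (intro continuous_intros)

text \<open>Squaring the argument makes the truncation even, so that both signs are treated at once.\<close>

definition ramp :: "real \<Rightarrow> real \<Rightarrow> real" where
  "ramp a s = step ((s\<^sup>2 - a\<^sup>2) / (3 * a\<^sup>2))"

definition dramp :: "real \<Rightarrow> real \<Rightarrow> real" where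
  "dramp a s = dstep ((s\<^sup>2 - a\<^sup>2) / (3 * a\<^sup>2)) * (2 * s / (3 * a\<^sup>2))"

lemma ramp_deriv: "(ramp a has_real_derivative dramp a s) (at s)"
  unfolding ramp_def[abs_def] dramp_def
  by (rule DERIV_chain2[OF step_deriv DERIV_cdivide]) (auto intro!: derivative_eq_intros)

lemma dramp_cont: "continuous_on UNIV (dramp a)"
  unfolding dramp_def divide_inverse
  by (intro continuous_intros continuous_on_compose2[OF dstep_cont]) auto

lemma ramp_values:
  assumes a: "a > 0"
  shows "ramp a 0 = 0" "2 * a \<le> \<bar>s\<bar> \<Longrightarrow> ramp a s = 1"
proof -
  show "ramp a 0 = 0" unfolding ramp_def using a by (intro step_0) (auto simp: divide_le_0_iff)
  assume "2 * a \<le> \<bar>s\<bar>"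
  hence "(2 * a)\<^sup>2 \<le> \<bar>s\<bar>\<^sup>2" using a by (intro power_mono) auto
  thus "ramp a s = 1" unfolding ramp_def using a by (intro step_1) (simp add: field_simps power_mult_distrib)
qed

lemma dramp_bound:
  assumes a: "a > 0"
  shows "\<bar>dramp a s\<bar> \<le> 3 / a * indicator {a<..<2 * a} \<bar>s\<bar>"
proof (cases "a < \<bar>s\<bar> \<and> \<bar>s\<bar> < 2 * a")
  case True
  have "\<bar>dramp a s\<bar> = dstep ((s\<^sup>2 - a\<^sup>2) / (3 * a\<^sup>2)) * (2 * \<bar>s\<bar> / (3 * a\<^sup>2))"
    using dstep_bounds(1) by (simp add: dramp_def abs_mult)
  also have "\<dots> \<le> 2 * (2 * (2 * a) / (3 * a\<^sup>2))"
    using True a dstep_bounds by (intro mult_mono divide_right_mono) auto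
  also have "\<dots> = (8 / 3) / a" using a by (simp add: power2_eq_square field_simps)
  also have "\<dots> \<le> 3 / a" using a by (intro divide_right_mono) auto
  finally show ?thesis using True by simp
next
  case False
  have "(s\<^sup>2 - a\<^sup>2) / (3 * a\<^sup>2) \<le> 0 \<or> 1 \<le> (s\<^sup>2 - a\<^sup>2) / (3 * a\<^sup>2)"
  proof (cases "\<bar>s\<bar> \<le> a")
    case True
    hence "\<bar>s\<bar>\<^sup>2 \<le> a\<^sup>2" by (intro power_mono) auto
    thus ?thesis using a by (auto simp: divide_le_0_iff)
  next
    case 2: False
    hence "2 * a \<le> \<bar>s\<bar>" using False by auto
    hence "(2 * a)\<^sup>2 \<le> \<bar>s\<bar>\<^sup>2" using a by (intro power_mono) auto
    thus ?thesis using a by (simp add: field_simps power_mult_distrib)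
  qed
  hence "dramp a s = 0" unfolding dramp_def using dstep_bounds(3) by auto
  thus ?thesis using False by (auto simp: indicator_def)
qed

text \<open>Where \<open>\<bar>u\<bar> \<ge> 2 a\<close> the truncated function equals 1, while on a large ball it vanishes on at least
  half of the volume. The radius, which depends on the support, cancels.\<close>

lemma level_potential:
  fixes u :: "real^'n \<Rightarrow> real"
  assumes n2: "CARD('n) \<ge> 2" and ug: "weak_pair u g"
    and supp: "emeasure lborel {x. u x \<noteq> 0} < \<infinity>" and a: "a > 0"
  shows "AE x in lborel. 2 * a \<le> \<bar>u x\<bar> \<longrightarrow>
     ennreal (real CARD('n) * unit_ball_vol (real CARD('n)) * a / 6)
       \<le> (\<integral>\<^sup>+y. ennreal (indicator {a<..<2 * a} \<bar>u y\<bar> * norm (g y)) * ennreal (riesz (y - x)) \<partial>lborel)"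
proof -
  define n where "n = CARD('n)"
  define \<omega> where "\<omega> = unit_ball_vol (real n)"
  have n: "real n > 0" "n > 0" by (auto simp: n_def)
  have \<omega>: "\<omega> > 0" by (simp add: \<omega>_def)
  have [measurable]: "u \<in> borel_measurable borel" "g \<in> borel_measurable borel"
    using ug by (auto simp: weak_pair_def loc_integrable_def)
  obtain m where m: "m \<ge> 0" "emeasure lborel {x. u x \<noteq> 0} = ennreal m"
    using supp by (cases "emeasure lborel {x. u x \<noteq> 0}") auto
  define R where "R = max 1 (2 * m / \<omega>)"
  have R: "R \<ge> 1" by (simp add: R_def)
  have "2 * m / \<omega> \<le> R ^ 1" by (simp add: R_def)
  also have "\<dots> \<le> R ^ n" using R n by (intro power_increasing) auto
  finally have mR: "m \<le> \<omega> * R ^ n / 2" using \<omega> by (simp add: field_simps)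
  have "\<bar>dramp a t\<bar> \<le> 3 / a" for t
  proof -
    have "3 / a * indicator {a<..<2 * a} \<bar>t\<bar> \<le> 3 / a * 1"
      using a by (intro mult_left_mono) (auto simp: indicator_def)
    thus ?thesis using dramp_bound[OF a, of t] by linarith
  qed
  from weak_potential_estimate[OF n2 ug _ ramp_deriv dramp_cont this, of R]
  have "AE x in lborel. (\<integral>\<^sup>+z. indicator (ball x R) z * ennreal \<bar>ramp a (u z) - ramp a (u x)\<bar> \<partial>lborel)
     \<le> ennreal (R ^ n / real n) *
       (\<integral>\<^sup>+y. indicator (ball x R) y * (ennreal (\<bar>dramp a (u y)\<bar> * norm (g y)) * ennreal (riesz (y - x))) \<partial>lborel)"
    using R by (simp add: n_def)
  thus ?thesis
  proof eventually_elim
    case (elim x)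
    define P where "P = (\<integral>\<^sup>+y. ennreal (indicator {a<..<2 * a} \<bar>u y\<bar> * norm (g y)) * ennreal (riesz (y - x)) \<partial>lborel)"
    show ?case
    proof
      assume big: "2 * a \<le> \<bar>u x\<bar>"
      have "emeasure lborel (ball x R) \<le> emeasure lborel ((ball x R \<inter> {z. u z = 0}) \<union> {z. u z \<noteq> 0})"
        by (intro emeasure_mono) auto
      also have "\<dots> \<le> emeasure lborel (ball x R \<inter> {z. u z = 0}) + emeasure lborel {z. u z \<noteq> 0}"
        by (intro emeasure_subadditive) auto
      finally have le: "ennreal (\<omega> * R ^ n) \<le> emeasure lborel (ball x R \<inter> {z. u z = 0}) + ennreal m"
        using R m by (simp add: emeasure_ball \<omega>_def n_def)
      have "emeasure lborel (ball x R \<inter> {z. u z = 0}) \<le> emeasure lborel (ball x R)"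
        by (intro emeasure_mono) auto
      also have "\<dots> < top" using R by (simp add: emeasure_ball)
      finally obtain z where z: "z \<ge> 0" "emeasure lborel (ball x R \<inter> {z. u z = 0}) = ennreal z"
        by (cases "emeasure lborel (ball x R \<inter> {z. u z = 0})") auto
      have "ennreal (\<omega> * R ^ n) \<le> ennreal (z + m)" using le z m by simp
      hence "\<omega> * R ^ n \<le> z + m" using z m by (subst (asm) ennreal_le_iff) auto
      hence "\<omega> * R ^ n / 2 \<le> z" using mR by linarith
      hence "ennreal (\<omega> * R ^ n / 2) \<le> emeasure lborel (ball x R \<inter> {z. u z = 0})" using z by (simp add: ennreal_leI)
      also have "\<dots> = (\<integral>\<^sup>+z. indicator (ball x R \<inter> {z. u z = 0}) z \<partial>lborel)" by simp
      also have "\<dots> \<le> (\<integral>\<^sup>+z. indicator (ball x R) z * ennreal \<bar>ramp a (u z) - ramp a (u x)\<bar> \<partial>lborel)"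
        using ramp_values[OF a] big by (intro nn_integral_mono) (auto simp: indicator_def)
      also note elim
      also have "(\<integral>\<^sup>+y. indicator (ball x R) y * (ennreal (\<bar>dramp a (u y)\<bar> * norm (g y)) * ennreal (riesz (y - x))) \<partial>lborel)
        \<le> (\<integral>\<^sup>+y. ennreal (3 / a) * (ennreal (indicator {a<..<2 * a} \<bar>u y\<bar> * norm (g y)) * ennreal (riesz (y - x))) \<partial>lborel)"
      proof (intro nn_integral_mono)
        fix y
        have "\<bar>dramp a (u y)\<bar> * norm (g y) \<le> 3 / a * indicator {a<..<2 * a} \<bar>u y\<bar> * norm (g y)"
          by (intro mult_right_mono dramp_bound a) auto
        hence "ennreal (\<bar>dramp a (u y)\<bar> * norm (g y)) \<le> ennreal (3 / a) * ennreal (indicator {a<..<2 * a} \<bar>u y\<bar> * norm (g y))"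
          using a by (simp add: mult.assoc ennreal_leI flip: ennreal_mult)
        hence "ennreal (\<bar>dramp a (u y)\<bar> * norm (g y)) * ennreal (riesz (y - x))
           \<le> ennreal (3 / a) * ennreal (indicator {a<..<2 * a} \<bar>u y\<bar> * norm (g y)) * ennreal (riesz (y - x))"
          by (intro mult_right_mono) auto
        thus "indicator (ball x R) y * (ennreal (\<bar>dramp a (u y)\<bar> * norm (g y)) * ennreal (riesz (y - x)))
          \<le> ennreal (3 / a) * (ennreal (indicator {a<..<2 * a} \<bar>u y\<bar> * norm (g y)) * ennreal (riesz (y - x)))"
          by (cases "y \<in> ball x R") (auto simp: mult.assoc)
      qed
      also have "\<dots> = ennreal (3 / a) * P" unfolding P_def by (intro nn_integral_cmult) measurable
      finally have "ennreal (\<omega> * R ^ n / 2) \<le> ennreal (R ^ n / real n) * (ennreal (3 / a) * P)"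
        by (simp add: mult_left_mono)
      hence "ennreal (real n * a / (3 * R ^ n)) * ennreal (\<omega> * R ^ n / 2) \<le> ennreal (real n * a / (3 * R ^ n)) * (ennreal (R ^ n / real n) * (ennreal (3 / a) * P))"
        by (rule mult_left_mono) simp
      moreover have "ennreal (real n * a / (3 * R ^ n)) * ennreal (\<omega> * R ^ n / 2) = ennreal (real n * \<omega> * a / 6)"
        using R a \<omega> by (simp add: mult_ac flip: ennreal_mult)
      moreover have "ennreal (real n * a / (3 * R ^ n)) * (ennreal (R ^ n / real n) * (ennreal (3 / a) * P)) = P"
        using R a n by (simp add: mult.assoc[symmetric] flip: ennreal_mult)
      ultimately show "ennreal (real CARD('n) * unit_ball_vol (real CARD('n)) * a / 6)
       \<le> (\<integral>\<^sup>+y. ennreal (indicator {a<..<2 * a} \<bar>u y\<bar> * norm (g y)) * ennreal (riesz (y - x)) \<partial>lborel)"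
        by (simp add: P_def n_def \<omega>_def)
    qed
  qed
qed

definition emb_const :: "real \<Rightarrow> 'n::finite itself \<Rightarrow> real" where
  "emb_const D _ = real CARD('n) * unit_ball_vol (real CARD('n)) /
     (48 * potential_const CARD('n) * D)"

text \<open>The weak type inequality for the truncations at the levels \<open>2\<^sup>k\<close>, with \<open>k \<in> \<int>\<close>. The functions for
  different \<open>k\<close> live on disjoint sets, so that their modulars add up to the full modular.\<close>

lemma conjugate_modular_bound:
  fixes u :: "real^'n \<Rightarrow> real" and G0 :: "real^'n \<Rightarrow> ennreal"
  assumes n2: "CARD('n) \<ge> 2" and fam: "comparable_family D N \<Phi>" and ug: "weak_pair u g"
    and supp: "emeasure lborel {x. u x \<noteq> 0} < \<infinity>"
    and Gm [measurable]: "G0 \<in> borel_measurable borel" and G0: "AE y in lborel. u y \<noteq> 0 \<longrightarrow> \<Phi> y (D * norm (g y)) \<le> G0 y"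
    and G1: "(\<integral>\<^sup>+y. G0 y \<partial>lborel) \<le> 1"
  shows "(\<integral>\<^sup>+y. conj_of CARD('n) (\<Phi> y) (emb_const D TYPE('n) * \<bar>u y\<bar>) \<partial>lborel)
     \<le> ennreal (covering_const CARD('n)) * (\<integral>\<^sup>+y. G0 y \<partial>lborel)"
proof -
  let ?n = "CARD('n)"
  let ?C = "ennreal (covering_const ?n)"
  define nw where "nw = real ?n * unit_ball_vol (real ?n)"
  have nw: "nw > 0" by (simp add: nw_def)
  define K where "K = potential_const ?n"
  have K: "K > 0" unfolding K_def potential_const_def nw_def[symmetric] using nw by linarith
  define c where "c = emb_const D TYPE('n)"
  have D0: "D > 0" by (rule dilation_pos[OF n2 fam])
  have c: "c = nw / (48 * K * D)" by (simp add: c_def emb_const_def nw_def K_def)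
  have [measurable]: "u \<in> borel_measurable borel" "g \<in> borel_measurable borel"
    using ug by (auto simp: weak_pair_def loc_integrable_def)
  define a where "a = (\<lambda>j. 2 powr real_of_int (int_decode j))"
  have a: "a j > 0" for j by (simp add: a_def)
  define A where "A = (\<lambda>j. {y. a j < \<bar>u y\<bar> \<and> \<bar>u y\<bar> < 2 * a j})"
  have A_sets [measurable]: "A j \<in> sets borel" for j unfolding A_def by measurable
  have key: "A i \<inter> A j = {}" if "int_decode i < int_decode j" for i j
  proof -
    have "2 * a i = 2 powr (real_of_int (int_decode i) + 1)" by (simp add: a_def powr_add)
    also have "\<dots> \<le> a j" unfolding a_def using that by (intro powr_mono) auto
    finally have "2 * a i \<le> a j" .
    thus ?thesis unfolding A_def by fastforce
  qed
  have S1: "(\<Sum>j. emeasure (density lborel G0) (A j)) \<le> (\<integral>\<^sup>+y. G0 y \<partial>lborel)"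
  proof -
    have disj: "disjoint_family A"
      unfolding disjoint_family_on_def
    proof (intro ballI impI)
      fix i j :: nat assume "i \<noteq> j"
      hence "int_decode i \<noteq> int_decode j" by (simp add: int_decode_eq)
      hence "int_decode i < int_decode j \<or> int_decode j < int_decode i" by linarith
      thus "A i \<inter> A j = {}"
      proof
        assume "int_decode i < int_decode j" thus ?thesis by (rule key)
      next
        assume "int_decode j < int_decode i"
        from key[OF this] show ?thesis by (simp only: Int_commute)
      qed
    qed
    have "range A \<subseteq> sets (density lborel G0)" using A_sets by auto
    from suminf_emeasure[OF this disj]
    have "(\<Sum>j. emeasure (density lborel G0) (A j)) = emeasure (density lborel G0) (\<Union>j. A j)" .
    also have "\<dots> \<le> emeasure (density lborel G0) (space (density lborel G0))" by (rule emeasure_space)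
    also have "\<dots> = (\<integral>\<^sup>+y. G0 y \<partial>lborel)" by (simp add: emeasure_density)
    finally show ?thesis .
  qed
  define t where "t = (\<lambda>j. nw * a j / (12 * K))"
  have t: "t j > 0" for j using nw K a by (simp add: t_def)
  define Q where "Q = (\<lambda>j G. G \<in> borel_measurable borel \<and>
     (AE x in lborel. 2 * a j \<le> \<bar>u x\<bar> \<longrightarrow> conj_of ?n (\<Phi> x) (t j / D) \<le> G x) \<and>
     (\<integral>\<^sup>+y. G y \<partial>lborel) \<le> ?C * (\<integral>\<^sup>+y. G0 y * indicator (A j) y \<partial>lborel))"
  have "\<exists>G. Q j G" for j
  proof -
    define f where "f = (\<lambda>y. indicator {a j<..<2 * a j} \<bar>u y\<bar> * norm (g y))"
    have fm [measurable]: "f \<in> borel_measurable borel" unfolding f_def by measurable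
    have gm: "(\<lambda>y. G0 y * indicator (A j) y) \<in> borel_measurable borel" by measurable
    have "(\<integral>\<^sup>+y. G0 y * indicator (A j) y \<partial>lborel) \<le> (\<integral>\<^sup>+y. G0 y \<partial>lborel)"
      by (intro nn_integral_mono) (auto simp: indicator_def)
    hence g1: "(\<integral>\<^sup>+y. G0 y * indicator (A j) y \<partial>lborel) \<le> 1" using G1 by simp
    have ae: "AE y in lborel. \<Phi> y (D * f y) \<le> G0 y * indicator (A j) y"
      using G0 AE_comparable[OF n2 fam]
    proof eventually_elim
      case (elim y)
      show ?case
      proof (cases "y \<in> A j")
        case True
        hence "u y \<noteq> 0" using a[of j] by (auto simp: A_def)
        thus ?thesis using True elim by (simp add: A_def f_def)
      next
        case False
        hence "f y = 0" by (auto simp: f_def A_def indicator_def)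
        thus ?thesis using False young_normal_small[OF comparable_young_normal[OF n2 fam elim(2)], of 0] by simp
      qed
    qed
    obtain G where G: "G \<in> borel_measurable borel"
      "AE x in lborel. ennreal (K * t j) < (\<integral>\<^sup>+y. ennreal (f y) * ennreal (riesz (y - x)) \<partial>lborel) \<longrightarrow>
          conj_of ?n (\<Phi> x) (t j / D) \<le> G x"
      "(\<integral>\<^sup>+y. G y \<partial>lborel) \<le> ?C * (\<integral>\<^sup>+y. G0 y * indicator (A j) y \<partial>lborel)"
      using weak_type[OF n2 fam t fm gm _ g1 ae] unfolding K_def by (auto simp: f_def)
    have "AE x in lborel. 2 * a j \<le> \<bar>u x\<bar> \<longrightarrow> conj_of ?n (\<Phi> x) (t j / D) \<le> G x"
      using G(2) level_potential[OF n2 ug supp a[of j]]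
    proof eventually_elim
      case (elim x)
      have "ennreal (K * t j) < ennreal (nw * a j / 6)"
        using K nw a[of j] by (simp add: t_def ennreal_less_iff)
      thus ?case using elim by (auto simp: nw_def f_def intro: less_le_trans)
    qed
    thus ?thesis unfolding Q_def using G by blast
  qed
  then obtain G where "\<And>j. Q j (G j)" by metis
  hence G: "\<And>j. G j \<in> borel_measurable borel"
    "\<And>j. AE x in lborel. 2 * a j \<le> \<bar>u x\<bar> \<longrightarrow> conj_of ?n (\<Phi> x) (t j / D) \<le> G j x"
    "\<And>j. (\<integral>\<^sup>+y. G j y \<partial>lborel) \<le> ?C * (\<integral>\<^sup>+y. G0 y * indicator (A j) y \<partial>lborel)"
    unfolding Q_def by blast+
  note [measurable] = G(1)
  have "AE x in lborel. \<forall>j. 2 * a j \<le> \<bar>u x\<bar> \<longrightarrow> conj_of ?n (\<Phi> x) (t j / D) \<le> G j x"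
    using G(2) by (simp add: AE_all_countable)
  hence "AE y in lborel. conj_of ?n (\<Phi> y) (c * \<bar>u y\<bar>) \<le> (\<Sum>j. G j y)"
    using AE_comparable[OF n2 fam]
  proof eventually_elim
    case (elim y)
    note yny = comparable_young_normal[OF n2 fam elim(2)]
    show ?case
    proof (cases "u y = 0")
      case True thus ?thesis using conj_of_0[OF yny n2] by simp
    next
      case False
      \<comment> \<open>The dyadic level with \<open>2 * 2\<^sup>k \<le> \<bar>u y\<bar> < 4 * 2\<^sup>k\<close>.\<close>
      define k where "k = \<lfloor>log 2 \<bar>u y\<bar>\<rfloor> - 1"
      define j where "j = int_encode k"
      have aj: "a j = 2 powr real_of_int k" by (simp add: a_def j_def)
      have "2 powr (real_of_int k + 1) \<le> 2 powr log 2 \<bar>u y\<bar>" unfolding k_def by (intro powr_mono) auto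
      hence lo: "2 * a j \<le> \<bar>u y\<bar>" using False by (simp add: aj powr_add mult.commute)
      have "2 powr log 2 \<bar>u y\<bar> \<le> 2 powr (real_of_int k + 2)" unfolding k_def by (intro powr_mono) (auto, linarith)
      hence hi: "\<bar>u y\<bar> \<le> 4 * a j" using False by (simp add: aj powr_add mult.commute)
      have "c * \<bar>u y\<bar> \<le> c * (4 * a j)" using hi nw K D0 by (intro mult_left_mono) (auto simp: c)
      also have "\<dots> = t j / D" using K D0 by (simp add: c t_def field_simps)
      finally have "conj_of ?n (\<Phi> y) (c * \<bar>u y\<bar>) \<le> conj_of ?n (\<Phi> y) (t j / D)"
        by (rule conj_of_mono[OF yny n2])
      also have "\<dots> \<le> G j y" using elim lo by blast
      also have "\<dots> \<le> (\<Sum>j. G j y)" using sum_le_suminf[of "\<lambda>j. G j y" "{j}"] by simp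
      finally show ?thesis .
    qed
  qed
  hence "(\<integral>\<^sup>+y. conj_of ?n (\<Phi> y) (c * \<bar>u y\<bar>) \<partial>lborel) \<le> (\<integral>\<^sup>+y. (\<Sum>j. G j y) \<partial>lborel)"
    by (rule nn_integral_mono_AE)
  also have "\<dots> = (\<Sum>j. \<integral>\<^sup>+y. G j y \<partial>lborel)" by (intro nn_integral_suminf) measurable
  also have "\<dots> \<le> (\<Sum>j. ?C * emeasure (density lborel G0) (A j))"
    using G(3) by (intro suminf_le) (auto simp: emeasure_density)
  also have "\<dots> = ?C * (\<Sum>j. emeasure (density lborel G0) (A j))"
    by (rule ennreal_suminf_cmult)
  also have "\<dots> \<le> ?C * (\<integral>\<^sup>+y. G0 y \<partial>lborel)"
    by (rule mult_left_mono[OF S1]) simp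
  finally show ?thesis unfolding c_def .
qed

section \<open>The normalization of a Young function\<close>

lemma tendsto_diff_const_ennreal:
  fixes f :: "'a \<Rightarrow> ennreal"
  assumes f: "(f \<longlongrightarrow> l) F" and c: "c \<noteq> top"
  shows "((\<lambda>x. f x - c) \<longlongrightarrow> l - c) F"
proof (cases "l = top")
  case False
  then obtain r where r: "l = ennreal r" "0 \<le> r" by (cases l) auto
  obtain d where d: "c = ennreal d" "0 \<le> d" using c by (cases c) auto
  have "eventually (\<lambda>x. f x < ennreal (r + 1)) F"
    using r by (intro order_tendstoD(2)[OF f]) (auto simp: ennreal_less_iff)
  hence "eventually (\<lambda>x. f x - c = ennreal (enn2real (f x) - d)) F"
  proof eventually_elim
    case (elim x)
    hence "f x < top" using ennreal_less_top order.strict_trans by blast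
    hence "f x = ennreal (enn2real (f x))" by simp
    thus ?case using d by (metis ennreal_minus)
  qed
  moreover have "((\<lambda>x. ennreal (enn2real (f x) - d)) \<longlongrightarrow> ennreal (r - d)) F"
    using f r by (intro tendsto_intros) auto
  ultimately show ?thesis using r d by (simp add: tendsto_cong ennreal_minus)
next
  case True
  obtain d where d: "c = ennreal d" "0 \<le> d" using c by (cases c) auto
  have "((\<lambda>x. f x - c) \<longlongrightarrow> top) F"
    unfolding tendsto_top_iff_ennreal
  proof (intro allI impI)
    fix m :: real assume "0 \<le> m"
    have "eventually (\<lambda>x. ennreal (m + d) < f x) F"
      using True f by (intro order_tendstoD(1)) auto
    thus "eventually (\<lambda>x. ennreal m < f x - c) F"
    proof eventually_elim
      case (elim x)
      show ?case
      proof (cases "f x")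
        case (real z)
        have "ennreal (m + d) < ennreal z" using elim unfolding \<open>f x = ennreal z\<close> .
        hence "m + d < z" by (subst (asm) ennreal_less_iff) (use \<open>0 \<le> m\<close> d in auto)
        thus ?thesis using real d \<open>0 \<le> m\<close> by (simp add: ennreal_minus ennreal_less_iff)
      qed (use d in auto)
    qed
  qed
  thus ?thesis using True c by (simp add: ennreal_top_minus)
qed

context
  fixes A :: "real \<Rightarrow> ennreal"
  assumes A: "young_function A"
begin

lemma young_0: "A 0 = 0"
  using A by (simp add: young_function_def)

lemma young_convex: "0 \<le> s \<Longrightarrow> 0 \<le> t \<Longrightarrow> 0 \<le> l \<Longrightarrow> l \<le> 1 \<Longrightarrow>
    A ((1 - l) * s + l * t) \<le> ennreal (1 - l) * A s + ennreal l * A t"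
  using A by (simp add: young_function_def)

lemma young_cont: "continuous_on {0..} A"
  using A by (simp add: young_function_def)

lemma young_scale: "0 \<le> t \<Longrightarrow> 0 \<le> l \<Longrightarrow> l \<le> 1 \<Longrightarrow> A (l * t) \<le> ennreal l * A t"
  using young_convex[of 0 t l] by (simp add: young_0)

lemma young_mono: assumes "0 \<le> s" "s \<le> t" shows "A s \<le> A t"
proof (cases "t = 0")
  case False
  hence t: "t > 0" using assms by auto
  have "A ((s / t) * t) \<le> ennreal (s / t) * A t" using t assms by (intro young_scale) auto
  also have "\<dots> \<le> 1 * A t" using t assms by (intro mult_right_mono) auto
  finally show ?thesis using t by simp
qed (use assms in auto)

text \<open>By continuity the infimum is a minimum.\<close>

lemma left_inverse_attained:
  assumes inv: "left_inverse A t = ennreal a" and a: "a \<ge> 0"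
  shows "ennreal t \<le> A a" and "0 \<le> \<tau> \<Longrightarrow> \<tau> < a \<Longrightarrow> A \<tau> < ennreal t"
proof -
  show lt: "A \<tau> < ennreal t" if "0 \<le> \<tau>" "\<tau> < a" for \<tau>
  proof (rule ccontr)
    assume "\<not> A \<tau> < ennreal t"
    hence "left_inverse A t \<le> ennreal \<tau>" using that by (intro left_inverse_le) auto
    thus False using inv that by simp
  qed
  show "ennreal t \<le> A a"
  proof (rule ccontr)
    assume "\<not> ennreal t \<le> A a"
    hence "A a < ennreal t" by simp
    moreover have "(A \<longlongrightarrow> A a) (at a within {0..})"
      using young_cont a by (auto simp: continuous_on_def)
    ultimately have "eventually (\<lambda>\<tau>. A \<tau> < ennreal t) (at a within {0..})"
      by (intro order_tendstoD(2))
    then obtain d where d: "d > 0" "\<And>\<tau>. \<tau> \<ge> 0 \<Longrightarrow> \<tau> \<noteq> a \<Longrightarrow> dist \<tau> a < d \<Longrightarrow> A \<tau> < ennreal t"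
      by (auto simp: eventually_at)
    have "A (a + d / 2) < ennreal t" using d(1) a by (intro d(2)) (auto simp: dist_real_def)
    hence "ennreal (a + d / 2) \<le> left_inverse A t"
      unfolding left_inverse_def
    proof (intro Inf_greatest, clarify)
      fix \<tau> :: real assume \<tau>: "0 \<le> \<tau>" "ennreal t \<le> A \<tau>"
      have "\<not> \<tau> \<le> a + d / 2"
        using young_mono[of \<tau> "a + d / 2"] \<tau> \<open>A (a + d / 2) < ennreal t\<close> by (auto simp: not_le[symmetric])
      thus "ennreal (a + d / 2) \<le> ennreal \<tau>" by (intro ennreal_leI) simp
    qed
    thus False using inv d(1) a by simp
  qed
qed

lemma value_at_left_inverse:
  assumes inv: "left_inverse A t = ennreal a" and a: "a > 0"
  shows "A a = ennreal t"
proof (rule antisym)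
  show "ennreal t \<le> A a" using left_inverse_attained[OF inv] a by simp
  have "(A \<longlongrightarrow> A a) (at a within {0..})"
    using young_cont a by (auto simp: continuous_on_def)
  hence "(A \<longlongrightarrow> A a) (at a within {0<..<a})"
    by (rule tendsto_within_subset) auto
  moreover have "at a within {0<..<a} \<noteq> bot"
    using a by (simp add: trivial_limit_within islimpt_greaterThanLessThan2)
  moreover have "eventually (\<lambda>\<tau>. A \<tau> \<le> ennreal t) (at a within {0<..<a})"
    unfolding eventually_at_filter
    using left_inverse_attained(2)[OF inv] a by (intro always_eventually) (auto intro: less_imp_le)
  ultimately show "A a \<le> ennreal t" by (intro tendsto_upperbound)
qed

end

text \<open>The graph of the new function consists of the diagonal on the unit interval and a convex
  function on \<open>[1, \<infinity>)\<close> that starts with slope at least 4. Hence its quotient by \<open>t\<close> is nondecreasing.\<close>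

lemma young_normal_normalization:
  assumes A: "young_function A" and a: "a > 0" and A1: "A a = 1"
  shows "young_normal (\<lambda>t. if 1 \<le> t then 2 * max (A (a * t)) (ennreal (2 * t - 1)) - 1 else ennreal t)"
    (is "young_normal ?B")
proof -
  define B where "B = ?B"
  define P where "P = (\<lambda>t. max (A (a * t)) (ennreal (2 * t - 1)))"
  have B1: "B t = 2 * P t - 1" if "1 \<le> t" for t using that by (simp add: B_def P_def)
  have B_small: "B t = ennreal t" if "0 \<le> t" "t \<le> 1" for t
  proof (cases "t = 1")
    case True
    have "2 * P 1 - 1 = (2 :: ennreal) - 1" by (simp add: P_def A1)
    also have "\<dots> = 1" by (metis ennreal_1 ennreal_minus ennreal_numeral numeral_le_one_iff one_add_one add_diff_cancel_right' zero_le_one)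
    finally show ?thesis using True B1[of 1] by simp
  qed (use that in \<open>auto simp: B_def\<close>)
  have scale: "B (l * t) \<le> ennreal l * B t" if l: "0 \<le> l" "l \<le> 1" and t: "0 \<le> t" for l t
  proof (cases "t \<le> 1")
    case True
    moreover have "l * t \<le> 1" using mult_mono[of l 1 t 1] True l t by simp
    ultimately show ?thesis using B_small[of t] B_small[of "l * t"] l t by (simp add: ennreal_mult)
  next
    case False
    hence t1: "t > 1" by simp
    show ?thesis
    proof (cases "P t = top \<or> l = 0")
      case True
      thus ?thesis
      proof
        assume "P t = top"
        hence "B t = top" using t1 B1[of t] by (simp add: ennreal_mult_eq_top_iff ennreal_top_minus)
        thus ?thesis using B_small[of 0] l by (cases "l = 0") (auto simp: ennreal_mult_eq_top_iff ennreal_mult_top)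
      next
        assume "l = 0"
        thus ?thesis using B_small[of 0] by simp
      qed
    next
      case False
      then obtain p where p: "0 \<le> p" "P t = ennreal p" by (cases "P t") auto
      have pt: "2 * t - 1 \<le> p"
      proof -
        have "ennreal (2 * t - 1) \<le> ennreal p" unfolding p(2)[symmetric] P_def by simp
        thus ?thesis using p by simp
      qed
      have twice: "2 * ennreal q - 1 = ennreal (2 * q - 1)" if "q \<ge> 0" for q
        using that by (metis ennreal_1 ennreal_minus ennreal_mult ennreal_numeral zero_le_numeral zero_le_one)
      have Bt: "B t = ennreal (2 * p - 1)" using B1[of t] t1 p by (simp add: twice)
      have l0: "l > 0" using False l by auto
      show ?thesis
      proof (cases "l * t \<le> 1")
        case True
        have "t \<le> 2 * p - 1" using pt t1 by simp
        hence "ennreal (l * t) \<le> ennreal (l * (2 * p - 1))" using l0 by (intro ennreal_leI mult_left_mono) auto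
        also have "\<dots> = ennreal l * ennreal (2 * p - 1)" using l0 pt t1 by (intro ennreal_mult) auto
        finally show ?thesis using B_small[of "l * t"] True l t Bt by simp
      next
        case False
        define s where "s = l * t"
        have s: "1 < s" "s \<le> t" using False t l mult_left_le_one_le[of t l] by (auto simp: s_def)
        define m where "m = (s - 1) / (t - 1)"
        have m: "0 \<le> m" "m \<le> 1" using s t1 by (auto simp: m_def)
        have sm: "s = (1 - m) * 1 + m * t"
        proof -
          have "m * (t - 1) = s - 1" using t1 by (simp add: m_def)
          thus ?thesis by (simp add: algebra_simps)
        qed
        have "A (a * s) = A ((1 - m) * a + m * (a * t))" unfolding sm by (simp add: algebra_simps)
        also have "\<dots> \<le> ennreal (1 - m) * A a + ennreal m * A (a * t)"
          using a t m by (intro young_convex[OF A]) auto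
        also have "\<dots> \<le> ennreal (1 - m) * 1 + ennreal m * ennreal p"
          unfolding A1 by (intro add_left_mono mult_left_mono) (auto simp: p(2)[symmetric] P_def)
        also have "\<dots> = ennreal ((1 - m) + m * p)" using m p by (simp flip: ennreal_mult ennreal_plus)
        finally have "A (a * s) \<le> ennreal ((1 - m) + m * p)" .
        moreover have "2 * s - 1 \<le> (1 - m) + m * p"
        proof -
          have "m * (2 * t - 1) \<le> m * p" using m pt by (intro mult_left_mono) auto
          thus ?thesis by (subst sm) (simp add: algebra_simps)
        qed
        ultimately have "P s \<le> ennreal ((1 - m) + m * p)" unfolding P_def by (simp add: ennreal_leI)
        hence "2 * P s - 1 \<le> 2 * ennreal ((1 - m) + m * p) - 1"
          by (intro ennreal_minus_mono mult_left_mono) auto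
        also have "\<dots> = ennreal (2 * ((1 - m) + m * p) - 1)" using m p by (intro twice) auto
        also have "\<dots> \<le> ennreal (l * (2 * p - 1))"
        proof (rule ennreal_leI)
          have "m \<le> l"
          proof -
            have "(s - 1) * t \<le> s * (t - 1)" using s by (simp add: algebra_simps)
            hence "m \<le> s / t" using t1 by (simp add: m_def field_simps)
            thus ?thesis using t1 by (simp add: s_def)
          qed
          hence "m * (p - (2 * t - 1)) \<le> l * (p - (2 * t - 1))" using pt by (intro mult_right_mono) auto
          moreover have "m * (t - 1) = s - 1" using t1 by (simp add: m_def)
          ultimately show "2 * ((1 - m) + m * p) - 1 \<le> l * (2 * p - 1)"
            using l(2) unfolding s_def by (simp add: algebra_simps)
        qed
        also have "\<dots> = ennreal l * ennreal (2 * p - 1)" using l0 pt t1 by (intro ennreal_mult) auto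
        finally show ?thesis using B1[of s] s Bt by (simp add: s_def)
      qed
    qed
  qed
  have cont: "continuous_on {0..} B"
  proof -
    have c1: "continuous_on {0..1} B"
      by (rule continuous_on_eq[of _ "\<lambda>t. ennreal t"]) (use B_small in \<open>auto intro!: continuous_on_ennreal continuous_on_id\<close>)
    have cP: "continuous_on {1..} P"
      unfolding P_def using a
      by (intro continuous_intros continuous_on_ennreal continuous_on_compose2[OF young_cont[OF A]]) auto
    have "continuous_on {1..} (\<lambda>t. 2 * P t - 1)"
      unfolding continuous_on_def
      by (intro ballI tendsto_diff_const_ennreal ennreal_tendsto_cmult cP[unfolded continuous_on_def, rule_format]) auto
    hence c2: "continuous_on {1..} B"
      by (rule continuous_on_eq) (use B1 in auto)
    have "continuous_on ({0..1} \<union> {1..}) B"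
      by (intro continuous_on_closed_Un c1 c2) auto
    moreover have "{0..1} \<union> {1..} = {0::real..}" by auto
    ultimately show ?thesis by simp
  qed
  have "young_normal B" unfolding young_normal_def
    using B_small scale cont by auto
  thus ?thesis unfolding B_def .
qed

text \<open>The almost everywhere conditions at a single point.\<close>

definition good_point :: "real \<Rightarrow> (real \<Rightarrow> ennreal) \<Rightarrow> bool" where
  "good_point \<beta> A \<longleftrightarrow> young_function A \<and> ennreal \<beta> \<le> left_inverse A 1 \<and> left_inverse A 1 \<le> ennreal (1 / \<beta>)"

lemma good_point_scale:
  assumes g: "good_point \<beta> A" and \<beta>: "0 < \<beta>"
  obtains a where "\<beta> \<le> a" "a \<le> 1 / \<beta>" "left_inverse A 1 = ennreal a" "A a = 1"
proof -
  have "left_inverse A 1 < top" using g by (auto simp: good_point_def intro: le_less_trans)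
  then obtain a where a: "0 \<le> a" "left_inverse A 1 = ennreal a" by (cases "left_inverse A 1") auto
  have b: "\<beta> \<le> a" "a \<le> 1 / \<beta>"
    using g a(1) \<beta> unfolding good_point_def a(2) by simp_all
  have y: "young_function A" using g by (simp add: good_point_def)
  have a0: "0 < a" using b(1) \<beta> by linarith
  have "A a = ennreal 1" by (rule value_at_left_inverse[OF y a(2) a0])
  hence "A a = 1" by simp
  thus thesis by (rule that[OF b a(2)])
qed

lemma phi_hat_eq:
  assumes "left_inverse (\<phi> x) 1 = ennreal a" "0 \<le> a"
  shows "phi_hat \<phi> x = (\<lambda>t. if 1 \<le> t then 2 * max (\<phi> x (a * t)) (ennreal (2 * t - 1)) - 1 else ennreal t)"
  using assms by (auto simp: phi_hat_def phi0_def)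

lemma phi_hat_young_normal:
  assumes g: "good_point \<beta> (\<phi> x)" and \<beta>: "0 < \<beta>"
  shows "young_normal (phi_hat \<phi> x)"
proof -
  obtain a where a: "\<beta> \<le> a" "a \<le> 1 / \<beta>" "left_inverse (\<phi> x) 1 = ennreal a" "\<phi> x a = 1"
    using good_point_scale[OF g \<beta>] .
  have "0 \<le> a" "0 < a" using a \<beta> by auto
  show ?thesis
    unfolding phi_hat_eq[of \<phi> x a, OF a(3) \<open>0 \<le> a\<close>]
    by (rule young_normal_normalization) (use a \<open>0 < a\<close> g in \<open>auto simp: good_point_def\<close>)
qed

lemma double_minus_one:
  fixes z :: ennreal assumes "1 \<le> z" shows "z \<le> 2 * z - 1"
proof (cases z)
  case (real r)
  have "1 \<le> r" using assms real by simp
  have "2 * z = ennreal (2 * r)" using real by (simp add: ennreal_mult)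
  hence "2 * z - 1 = ennreal (2 * r - 1)" by (metis ennreal_1 ennreal_minus zero_le_one)
  thus ?thesis using real \<open>1 \<le> r\<close> by (simp add: ennreal_leI)
qed (simp add: ennreal_mult_top ennreal_top_minus)

lemma phi_hat_le:
  assumes g: "good_point \<beta> (\<phi> x)" and \<beta>: "0 < \<beta>" "\<beta> \<le> 1" and t: "0 \<le> t"
  shows "phi_hat \<phi> x (\<beta> * t) \<le> 1 + 4 * \<phi> x t"
proof -
  obtain a where a: "\<beta> \<le> a" "a \<le> 1 / \<beta>" "left_inverse (\<phi> x) 1 = ennreal a" "\<phi> x a = 1"
    using good_point_scale[OF g \<beta>(1)] .
  have yf: "young_function (\<phi> x)" using g by (simp add: good_point_def)
  have a0: "a > 0" using a \<beta> by linarith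
  show ?thesis
  proof (cases "\<beta> * t < 1")
    case True
    hence "phi_hat \<phi> x (\<beta> * t) = ennreal (\<beta> * t)" by (simp add: phi_hat_def)
    also have "\<dots> \<le> 1" using True by (simp flip: ennreal_1)
    also have "\<dots> \<le> 1 + 4 * \<phi> x t" by simp
    finally show ?thesis .
  next
    case False
    have "1 / \<beta> \<le> t" using False \<beta> by (simp add: field_simps)
    hence "a \<le> t" using a by linarith
    have m1: "\<phi> x (a * (\<beta> * t)) \<le> \<phi> x t"
    proof (rule young_mono[OF yf])
      have "a * \<beta> \<le> 1" using a \<beta> by (simp add: field_simps)
      thus "a * (\<beta> * t) \<le> t" using t mult_right_mono[of "a * \<beta>" 1 t] by (simp add: mult.assoc)
    qed (use a0 \<beta> t in auto)
    have "1 = \<phi> x ((a / t) * t)" using a \<open>a \<le> t\<close> a0 by simp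
    also have "\<dots> \<le> ennreal (a / t) * \<phi> x t" using a0 \<open>a \<le> t\<close> by (intro young_scale[OF yf]) auto
    finally have "ennreal (t / a) * 1 \<le> ennreal (t / a) * (ennreal (a / t) * \<phi> x t)" by (intro mult_left_mono) auto
    also have "\<dots> = \<phi> x t" using a0 \<open>a \<le> t\<close> by (simp add: mult.assoc[symmetric] flip: ennreal_mult)
    finally have ta: "ennreal (t / a) \<le> \<phi> x t" by simp
    have "\<beta> * t \<le> t / a" using a0 a \<beta> t mult_right_mono[of "a * \<beta>" 1 t] by (simp add: field_simps)
    hence bt: "ennreal (\<beta> * t) \<le> \<phi> x t" using ta ennreal_leI order_trans by blast
    have "ennreal (2 * (\<beta> * t) - 1) \<le> ennreal (2 * (\<beta> * t))" by (intro ennreal_leI) simp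
    also have "\<dots> = 2 * ennreal (\<beta> * t)" by (simp add: ennreal_mult')
    also have "\<dots> \<le> 2 * \<phi> x t" using bt by (intro mult_left_mono) auto
    finally have m2: "ennreal (2 * (\<beta> * t) - 1) \<le> 2 * \<phi> x t" .
    have "\<phi> x t \<le> 2 * \<phi> x t" by (simp add: mult_2)
    hence "max (\<phi> x (a * (\<beta> * t))) (ennreal (2 * (\<beta> * t) - 1)) \<le> 2 * \<phi> x t" using m1 m2 by auto
    hence "2 * max (\<phi> x (a * (\<beta> * t))) (ennreal (2 * (\<beta> * t) - 1)) \<le> 2 * (2 * \<phi> x t)"
      by (intro mult_left_mono) auto
    hence "phi_hat \<phi> x (\<beta> * t) \<le> 2 * (2 * \<phi> x t)"
      using False a0 by (subst phi_hat_eq[of \<phi> x a, OF a(3)]) (auto intro: order_trans[OF diff_le_self_ennreal])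
    also have "\<dots> = 4 * \<phi> x t" by (simp add: mult.assoc[symmetric])
    also have "\<dots> \<le> 1 + 4 * \<phi> x t" by simp
    finally show ?thesis .
  qed
qed

section \<open>Condition (A1) off a null set\<close>

text \<open>Condition (A1) is an iterated almost everywhere statement for each ball. Let \<open>m\<close> be the essential
  infimum of \<open>left_inverse (\<phi> y) t\<close> over \<open>y\<close> in a ball. Almost every point \<open>x\<close> of the ball satisfies both
  \<open>\<beta> left_inverse (\<phi> x) t \<le> m\<close>, by (A1), and \<open>m \<le> left_inverse (\<phi> x) t\<close>. The exceptional set no longer
  involves a second point, and countably many balls and levels yield a single null set off which
  the comparison holds in both directions.\<close>

lemma A1_pointwise:
  fixes \<phi> :: "real^'n \<Rightarrow> real \<Rightarrow> ennreal"
  assumes A1: "cond_A1 \<beta> \<phi>"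
  obtains N where "AE x in lebesgue. x \<notin> N"
    "\<And>x y t. x \<notin> N \<Longrightarrow> y \<notin> N \<Longrightarrow> x \<noteq> y \<Longrightarrow> t \<in> \<rat> \<Longrightarrow> 1 \<le> t \<Longrightarrow>
       t * (unit_ball_vol (real CARD('n)) * (4 * dist x y) ^ CARD('n)) \<le> 1 \<Longrightarrow>
       ennreal \<beta> * left_inverse (\<phi> x) t \<le> left_inverse (\<phi> y) t"
proof -
  define \<omega> where "\<omega> = unit_ball_vol (real CARD('n))"
  have \<omega>: "\<omega> > 0" by (simp add: \<omega>_def)
  define V where "V = (\<lambda>\<rho>. \<omega> * \<rho> ^ CARD('n))"
  have V_ball: "measure lebesgue (ball z \<rho>) = V \<rho>" if "\<rho> > 0" for z :: "real^'n" and \<rho>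
    using that by (simp add: measure_completion content_ball V_def \<omega>_def)
  obtain S :: "(real^'n) set" where S: "countable S" "\<And>X. open X \<Longrightarrow> X \<noteq> {} \<Longrightarrow> \<exists>d\<in>S. d \<in> X"
    by (rule countable_dense_setE) blast
  define m where "m = (\<lambda>z \<rho> t. Sup {c. AE y in lebesgue_on (ball z \<rho>). c \<le> left_inverse (\<phi> y) t})"
  define Idx where "Idx = {(z, \<rho>, t). z \<in> S \<and> \<rho> \<in> \<rat> \<and> t \<in> \<rat> \<and> 0 < \<rho> \<and> 1 \<le> t \<and> t * V \<rho> \<le> 1}"
  have "countable Idx"
    by (rule countable_subset[of _ "S \<times> \<rat> \<times> \<rat>"]) (auto simp: Idx_def S countable_rat intro!: countable_SIGMA)
  have good: "AE x in lebesgue. x \<in> ball z \<rho> \<longrightarrow> ennreal \<beta> * left_inverse (\<phi> x) t \<le> m z \<rho> t \<and> m z \<rho> t \<le> left_inverse (\<phi> x) t"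
    if "(z, \<rho>, t) \<in> Idx" for z \<rho> t
  proof -
    have \<rho>: "0 < \<rho>" "1 \<le> t" "t * V \<rho> \<le> 1" using that by (auto simp: Idx_def)
    have V0: "V \<rho> > 0" using \<omega> \<rho> by (simp add: V_def)
    have "V \<rho> * 1 \<le> V \<rho> * t" using V0 \<rho> by (intro mult_left_mono) auto
    hence V1: "V \<rho> \<le> 1" using \<rho> by (simp add: mult.commute)
    have t: "t \<in> {1..1 / measure lebesgue (ball z \<rho>)}"
      unfolding V_ball[OF \<rho>(1)] using \<rho> V0 by (simp add: field_simps)
    let ?C = "{c. AE y in lebesgue_on (ball z \<rho>). c \<le> left_inverse (\<phi> y) t}"
    have "AE x in lebesgue_on (ball z \<rho>). AE y in lebesgue_on (ball z \<rho>).
        \<forall>t\<in>{1..1 / measure lebesgue (ball z \<rho>)}. ennreal \<beta> * left_inverse (\<phi> x) t \<le> left_inverse (\<phi> y) t"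
    proof -
      have "0 < \<rho> \<and> measure lebesgue (ball z \<rho>) \<le> 1" unfolding V_ball[OF \<rho>(1)] using \<rho>(1) V1 by simp
      thus ?thesis using A1 unfolding cond_A1_def by blast
    qed
    hence up: "AE x in lebesgue_on (ball z \<rho>). ennreal \<beta> * left_inverse (\<phi> x) t \<le> m z \<rho> t"
    proof eventually_elim
      case (elim x)
      have "ennreal \<beta> * left_inverse (\<phi> x) t \<in> ?C"
        unfolding mem_Collect_eq using elim by eventually_elim (use t in auto)
      thus ?case unfolding m_def by (rule Sup_upper)
    qed
    have "0 \<in> ?C" by simp
    hence "?C \<noteq> {}" by blast
    from ennreal_Sup_countable_SUP[OF this] obtain f :: "nat \<Rightarrow> ennreal" where
      f: "range f \<subseteq> ?C" "m z \<rho> t = (SUP i. f i)" unfolding m_def by blast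
    have "AE y in lebesgue_on (ball z \<rho>). \<forall>i. f i \<le> left_inverse (\<phi> y) t"
      unfolding AE_all_countable using f(1) by auto
    hence low: "AE y in lebesgue_on (ball z \<rho>). m z \<rho> t \<le> left_inverse (\<phi> y) t"
      by eventually_elim (auto simp: f(2) intro: SUP_least)
    from up low have "AE x in lebesgue_on (ball z \<rho>). ennreal \<beta> * left_inverse (\<phi> x) t \<le> m z \<rho> t \<and> m z \<rho> t \<le> left_inverse (\<phi> x) t"
      by eventually_elim simp
    thus ?thesis by (subst (asm) AE_restrict_space_iff) auto
  qed
  define N where "N = {x. \<exists>(z, \<rho>, t)\<in>Idx. x \<in> ball z \<rho> \<and> \<not> (ennreal \<beta> * left_inverse (\<phi> x) t \<le> m z \<rho> t \<and> m z \<rho> t \<le> left_inverse (\<phi> x) t)}"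
  have "AE x in lebesgue. \<forall>p\<in>Idx. case p of (z, \<rho>, t) \<Rightarrow> x \<in> ball z \<rho> \<longrightarrow> ennreal \<beta> * left_inverse (\<phi> x) t \<le> m z \<rho> t \<and> m z \<rho> t \<le> left_inverse (\<phi> x) t"
    using good \<open>countable Idx\<close> by (subst AE_ball_countable) auto
  hence N: "AE x in lebesgue. x \<notin> N"
    by eventually_elim (auto simp: N_def)
  show thesis
  proof (rule that[OF N])
    fix x y t assume xy: "x \<notin> N" "y \<notin> N" "x \<noteq> y" and t: "t \<in> \<rat>" "1 \<le> t"
      and tV: "t * (unit_ball_vol (real CARD('n)) * (4 * dist x y) ^ CARD('n)) \<le> 1"
    define d where "d = dist x y"
    have d: "d > 0" using xy by (simp add: d_def)
    obtain z where z: "z \<in> S" "z \<in> ball x (d / 2)" using S(2)[of "ball x (d / 2)"] d by auto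
    \<comment> \<open>A rational ball that contains both points and has radius below \<open>4 d\<close>.\<close>
    obtain \<rho> where \<rho>: "\<rho> \<in> \<rat>" "2 * d < \<rho>" "\<rho> < 3 * d" using Rats_dense_in_real[of "2 * d" "3 * d"] d by auto
    have "t * V \<rho> \<le> t * V (4 * d)"
      unfolding V_def using \<omega> t \<rho> d by (intro mult_left_mono power_mono) auto
    also have "\<dots> \<le> 1" using tV by (simp add: V_def \<omega>_def d_def)
    finally have idx: "(z, \<rho>, t) \<in> Idx" using z \<rho> t d by (simp add: Idx_def)
    have "x \<in> ball z \<rho>" using z \<rho> d by (auto simp: dist_commute)
    moreover have "y \<in> ball z \<rho>"
      using z \<rho> d dist_triangle[of z y x] by (auto simp: d_def dist_commute)
    ultimately have "ennreal \<beta> * left_inverse (\<phi> x) t \<le> m z \<rho> t" "m z \<rho> t \<le> left_inverse (\<phi> y) t"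
      using xy idx unfolding N_def by blast+
    thus "ennreal \<beta> * left_inverse (\<phi> x) t \<le> left_inverse (\<phi> y) t" by (rule order_trans)
  qed
qed

definition scale_const :: "nat \<Rightarrow> real" where
  "scale_const n = min (1/2) (1 / (unit_ball_vol (real n) * 24 ^ n))"

definition compare_const :: "real \<Rightarrow> nat \<Rightarrow> real" where
  "compare_const \<beta> n = 2 / (scale_const n * \<beta> ^ 3)"

text \<open>Let \<open>v = phi_hat \<phi> x l\<close>. If \<open>v\<close> is at most a multiple of \<open>l\<close>, or bounded, linear growth of the normalized
  function suffices. Otherwise \<open>v\<close> is comparable to \<open>\<phi> x (a l)\<close>, and (A1) at a rational level \<open>t\<close> between
  \<open>\<kappa> v / 2\<close> and \<open>\<kappa> v\<close> shows that \<open>\<phi> y\<close> reaches that level at an argument comparable to \<open>l\<close>. The factor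
  \<open>\<kappa>\<close> brings the level into the range of (A1); it is compensated by the homogeneity of \<^const>\<open>young_normal\<close>.\<close>

lemma phi_hat_compare:
  fixes \<phi> :: "real^'n \<Rightarrow> real \<Rightarrow> ennreal"
  assumes \<beta>: "0 < \<beta>" "\<beta> \<le> 1" and gx: "good_point \<beta> (\<phi> x)" and gy: "good_point \<beta> (\<phi> y)"
    and l: "0 \<le> l" and d: "phi_hat \<phi> x l * ennreal (dist x y ^ CARD('n)) \<le> ennreal (6 ^ CARD('n))"
    and A1: "\<And>t. x \<noteq> y \<Longrightarrow> t \<in> \<rat> \<Longrightarrow> 1 \<le> t \<Longrightarrow>
       t * (unit_ball_vol (real CARD('n)) * (4 * dist x y) ^ CARD('n)) \<le> 1 \<Longrightarrow>
       ennreal \<beta> * left_inverse (\<phi> y) t \<le> left_inverse (\<phi> x) t"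
  shows "phi_hat \<phi> x l \<le> phi_hat \<phi> y (compare_const \<beta> CARD('n) * l)"
proof -
  let ?n = "CARD('n)"
  define \<omega> where "\<omega> = unit_ball_vol (real ?n)"
  have \<omega>: "\<omega> > 0" by (simp add: \<omega>_def)
  define \<kappa> where "\<kappa> = scale_const ?n"
  have \<kappa>: "\<kappa> > 0" "\<kappa> \<le> 1/2" "\<kappa> * (\<omega> * 24 ^ ?n) \<le> 1"
  proof -
    have "\<kappa> \<le> 1 / (\<omega> * 24 ^ ?n)" by (simp add: \<kappa>_def scale_const_def \<omega>_def)
    thus "\<kappa> * (\<omega> * 24 ^ ?n) \<le> 1" using \<omega> by (simp add: field_simps)
  qed (use \<omega> in \<open>auto simp: \<kappa>_def scale_const_def \<omega>_def\<close>)
  define D where "D = compare_const \<beta> ?n"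
  have D: "D = 2 / \<kappa> * (1 / \<beta> ^ 3)" by (simp add: D_def compare_const_def \<kappa>_def)
  have b3: "1 \<le> 1 / \<beta> ^ 3" using \<beta> by (simp add: power_le_one)
  have D2: "2 / \<kappa> \<le> D" unfolding D using b3 \<kappa> mult_left_mono[OF b3, of "2 / \<kappa>"] by simp
  have D4: "4 \<le> D"
  proof -
    have "4 \<le> 2 / \<kappa>" using \<kappa> by (simp add: field_simps)
    thus ?thesis using D2 by simp
  qed
  note ynx = phi_hat_young_normal[of \<beta> \<phi> x, OF gx \<beta>(1)] and yny = phi_hat_young_normal[of \<beta> \<phi> y, OF gy \<beta>(1)]
  have goal: "phi_hat \<phi> x l \<le> phi_hat \<phi> y (D * l)"
  proof (cases "x = y \<or> l \<le> 1")
    case True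
    have "l \<le> D * l" using D4 l mult_right_mono[of 1 D l] by simp
    show ?thesis
    proof (cases "x = y")
      case True
      thus ?thesis using young_normal_mono[OF yny l \<open>l \<le> D * l\<close>] by simp
    next
      case False
      have "phi_hat \<phi> x l = ennreal l" using True False l by (intro young_normal_small[OF ynx]) auto
      also have "\<dots> \<le> phi_hat \<phi> y l" by (rule young_normal_ge[OF yny l])
      also have "\<dots> \<le> phi_hat \<phi> y (D * l)" by (rule young_normal_mono[OF yny l \<open>l \<le> D * l\<close>])
      finally show ?thesis .
    qed
  next
    case False
    hence xy: "x \<noteq> y" and l1: "l > 1" by auto
    define dn where "dn = dist x y ^ ?n"
    have dn: "dn > 0" using xy by (simp add: dn_def)
    have "phi_hat \<phi> x l \<noteq> top"
      using d dn by (auto simp: dn_def[symmetric] ennreal_top_mult top_unique)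
    then obtain v where v: "0 \<le> v" "phi_hat \<phi> x l = ennreal v" by (cases "phi_hat \<phi> x l") auto
    have vd: "v * dn \<le> 6 ^ ?n" using d v dn by (simp add: dn_def[symmetric] flip: ennreal_mult)
    have large: ?thesis if "v \<le> D * l"
    proof -
      have "ennreal v \<le> ennreal (D * l)" using that by (rule ennreal_leI)
      also have "\<dots> \<le> phi_hat \<phi> y (D * l)" using D4 l by (intro young_normal_ge[OF yny]) auto
      finally show ?thesis by (simp add: v)
    qed
    obtain a where a: "\<beta> \<le> a" "a \<le> 1 / \<beta>" "left_inverse (\<phi> x) 1 = ennreal a" "\<phi> x a = 1"
      using good_point_scale[OF gx \<beta>(1)] .
    obtain b where b: "\<beta> \<le> b" "b \<le> 1 / \<beta>" "left_inverse (\<phi> y) 1 = ennreal b" "\<phi> y b = 1"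
      using good_point_scale[OF gy \<beta>(1)] .
    have a0: "a > 0" and b0: "b > 0" using a b \<beta> by auto
    have yfx: "young_function (\<phi> x)" and yfy: "young_function (\<phi> y)" using gx gy by (auto simp: good_point_def)
    have v_le: "ennreal v \<le> 2 * max (\<phi> x (a * l)) (ennreal (2 * l - 1))"
      unfolding v(2)[symmetric] using l1 a0 by (subst phi_hat_eq[of \<phi> x a, OF a(3)]) (auto simp: diff_le_self_ennreal)
    show ?thesis
    proof (cases "v \<le> 4 * l \<or> \<kappa> * v \<le> 2")
      case True
      hence "v \<le> D * l"
      proof
        assume "v \<le> 4 * l"
        also have "\<dots> \<le> D * l" using D4 l by (intro mult_right_mono) auto
        finally show ?thesis .
      next
        assume "\<kappa> * v \<le> 2"
        hence "v \<le> 2 / \<kappa>" using \<kappa> by (simp add: field_simps)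
        also have "\<dots> \<le> D * 1" using D2 by simp
        also have "\<dots> \<le> D * l" using D4 l1 by (intro mult_left_mono) auto
        finally show ?thesis .
      qed
      thus ?thesis by (rule large)
    next
      case False
      hence v4: "4 * l < v" and \<kappa>v: "2 < \<kappa> * v" by auto
      have "\<not> ennreal v \<le> 2 * ennreal (2 * l - 1)"
      proof
        assume "ennreal v \<le> 2 * ennreal (2 * l - 1)"
        also have "\<dots> = ennreal (2 * (2 * l - 1))" using l1 by (subst ennreal_mult) auto
        finally show False using v4 l1 by simp
      qed
      hence v2p: "ennreal v \<le> 2 * \<phi> x (a * l)" using v_le by (auto simp: max_def split: if_splits)
      obtain t where t: "t \<in> \<rat>" "\<kappa> * v / 2 < t" "t < \<kappa> * v"
        using Rats_dense_in_real[of "\<kappa> * v / 2" "\<kappa> * v"] \<kappa>v by auto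
      have t1: "1 \<le> t" using t \<kappa>v by simp
      have tp: "ennreal t \<le> \<phi> x (a * l)"
      proof -
        have "\<kappa> * v \<le> 1/2 * v" using \<kappa> v by (intro mult_right_mono) auto
        hence "t \<le> v / 2" using t by simp
        hence "ennreal t \<le> ennreal (1/2 * v)" by (intro ennreal_leI) simp
        also have "\<dots> = ennreal (1/2) * ennreal v" by (rule ennreal_mult) (use v in auto)
        also have "\<dots> \<le> ennreal (1/2) * (2 * \<phi> x (a * l))" by (intro mult_left_mono v2p) auto
        also have "\<dots> = (ennreal (1/2) * ennreal 2) * \<phi> x (a * l)" by (simp add: mult.assoc)
        also have "ennreal (1/2) * ennreal 2 = 1" by (subst ennreal_mult[symmetric]) auto
        finally show ?thesis by simp
      qed
      have tV: "t * (\<omega> * (4 * dist x y) ^ ?n) \<le> 1"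
      proof -
        have "t * (\<omega> * (4 * dist x y) ^ ?n) \<le> (\<kappa> * v) * (\<omega> * (4 * dist x y) ^ ?n)"
          using t \<omega> by (intro mult_right_mono) auto
        also have "\<dots> = \<kappa> * \<omega> * 4 ^ ?n * (v * dn)" by (simp add: power_mult_distrib dn_def mult_ac)
        also have "\<dots> \<le> \<kappa> * \<omega> * 4 ^ ?n * 6 ^ ?n" using vd \<kappa> \<omega> by (intro mult_left_mono) auto
        also have "\<dots> = \<kappa> * (\<omega> * 24 ^ ?n)" by (simp add: mult.assoc flip: power_mult_distrib)
        also have "\<dots> \<le> 1" by (rule \<kappa>)
        finally show ?thesis .
      qed
      have "ennreal \<beta> * left_inverse (\<phi> y) t \<le> left_inverse (\<phi> x) t"
        using A1[OF xy t(1) t1] tV by (simp add: \<omega>_def)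
      also have "\<dots> \<le> ennreal (a * l)" using tp a0 l by (intro left_inverse_le) auto
      also have "\<dots> \<le> ennreal (l / \<beta>)" using a(2) l mult_right_mono[OF a(2) l] by (intro ennreal_leI) simp
      finally have "ennreal (1 / \<beta>) * (ennreal \<beta> * left_inverse (\<phi> y) t) \<le> ennreal (1 / \<beta>) * ennreal (l / \<beta>)"
        by (intro mult_left_mono) auto
      hence inv_y: "left_inverse (\<phi> y) t \<le> ennreal (l / \<beta>\<^sup>2)"
        using \<beta> l by (simp add: mult.assoc[symmetric] power2_eq_square flip: ennreal_mult)
      have "left_inverse (\<phi> y) t < top" using inv_y by (auto intro: le_less_trans)
      then obtain c where c: "0 \<le> c" "left_inverse (\<phi> y) t = ennreal c" by (cases "left_inverse (\<phi> y) t") auto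
      have c_le: "c \<le> l / \<beta>\<^sup>2" using inv_y c l \<beta> by simp
      also have "\<dots> = \<beta> * (l / \<beta> ^ 3)" using \<beta> by (simp add: power2_eq_square power3_eq_cube)
      also have "\<dots> \<le> b * (l / \<beta> ^ 3)" using b \<beta> l by (intro mult_right_mono) auto
      finally have c_le': "c \<le> b * (l / \<beta> ^ 3)" .
      have l3: "1 \<le> l / \<beta> ^ 3" using b3 l1 mult_mono[of 1 l 1 "1 / \<beta> ^ 3"] by simp
      have "ennreal t \<le> \<phi> y c" by (rule left_inverse_attained(1)[OF yfy c(2) c(1)])
      also have "\<dots> \<le> \<phi> y (b * (l / \<beta> ^ 3))" by (rule young_mono[OF yfy c(1) c_le'])
      also have "\<dots> \<le> max (\<phi> y (b * (l / \<beta> ^ 3))) (ennreal (2 * (l / \<beta> ^ 3) - 1))" by simp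
      also have "\<dots> \<le> 2 * max (\<phi> y (b * (l / \<beta> ^ 3))) (ennreal (2 * (l / \<beta> ^ 3) - 1)) - 1"
      proof (rule double_minus_one)
        have "1 \<le> ennreal (2 * (l / \<beta> ^ 3) - 1)" using l3 by (simp flip: ennreal_1)
        thus "1 \<le> max (\<phi> y (b * (l / \<beta> ^ 3))) (ennreal (2 * (l / \<beta> ^ 3) - 1))" by (simp add: le_max_iff_disj)
      qed
      also have "\<dots> = phi_hat \<phi> y (l / \<beta> ^ 3)" using l3 b0 by (subst phi_hat_eq[of \<phi> y b, OF b(3)]) auto
      finally have ty: "ennreal t \<le> phi_hat \<phi> y (l / \<beta> ^ 3)" .
      have "ennreal v \<le> ennreal (2 / \<kappa>) * ennreal t"
        using t \<kappa> v by (subst ennreal_mult[symmetric]) (auto simp: field_simps intro!: ennreal_leI)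
      also have "\<dots> \<le> ennreal (2 / \<kappa>) * phi_hat \<phi> y (l / \<beta> ^ 3)" by (intro mult_left_mono ty) auto
      also have "phi_hat \<phi> y (l / \<beta> ^ 3) = phi_hat \<phi> y ((\<kappa> / 2) * (D * l))"
        using \<kappa> by (simp add: D field_simps)
      also have "\<dots> \<le> ennreal (\<kappa> / 2) * phi_hat \<phi> y (D * l)"
        using \<kappa> D4 l by (intro young_normal_scale[OF yny]) auto
      finally have "ennreal v \<le> ennreal (2 / \<kappa>) * (ennreal (\<kappa> / 2) * phi_hat \<phi> y (D * l))"
        by (simp add: mult_left_mono)
      also have "\<dots> = phi_hat \<phi> y (D * l)" using \<kappa> by (simp add: mult.assoc[symmetric] flip: ennreal_mult)
      finally show ?thesis by (simp add: v)
    qed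
  qed
  thus ?thesis by (simp add: D_def)
qed

lemma compare_const_ge_1: assumes "0 < \<beta>" "\<beta> \<le> 1" shows "1 \<le> compare_const \<beta> n"
proof -
  have k: "0 < scale_const n" "scale_const n \<le> 1/2" by (auto simp: scale_const_def)
  have "scale_const n * \<beta> ^ 3 \<le> 1/2 * 1" using k assms by (intro mult_mono power_le_one) auto
  thus ?thesis using k assms by (simp add: compare_const_def field_simps)
qed

lemma phi_hat_comparable_family:
  fixes \<phi> :: "real^'n \<Rightarrow> real \<Rightarrow> ennreal"
  assumes \<beta>: "0 < \<beta>" "\<beta> \<le> 1" and gyf: "generalized_young_function \<phi>"
    and A0: "cond_A0 \<beta> \<phi>" and A1: "cond_A1 \<beta> \<phi>"
  obtains N where "comparable_family (compare_const \<beta> CARD('n)) N (phi_hat \<phi>)"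
    "\<And>x. x \<notin> N \<Longrightarrow> good_point \<beta> (\<phi> x)"
proof -
  obtain N0 where N0: "AE x in lebesgue. x \<notin> N0"
    "\<And>x y t. x \<notin> N0 \<Longrightarrow> y \<notin> N0 \<Longrightarrow> x \<noteq> y \<Longrightarrow> t \<in> \<rat> \<Longrightarrow> 1 \<le> t \<Longrightarrow>
       t * (unit_ball_vol (real CARD('n)) * (4 * dist x y) ^ CARD('n)) \<le> 1 \<Longrightarrow>
       ennreal \<beta> * left_inverse (\<phi> x) t \<le> left_inverse (\<phi> y) t"
    using A1_pointwise[OF A1] by blast
  define N where "N = N0 \<union> {x. \<not> good_point \<beta> (\<phi> x)}"
  have "AE x in lebesgue. young_function (\<phi> x)" using gyf by (simp add: generalized_young_function_def)
  moreover have "AE x in lebesgue. ennreal \<beta> \<le> left_inverse (\<phi> x) 1 \<and> left_inverse (\<phi> x) 1 \<le> ennreal (1 / \<beta>)"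
    using A0 by (simp add: cond_A0_def)
  ultimately have "AE x in lebesgue. x \<notin> N" using N0(1)
    by eventually_elim (simp add: N_def good_point_def)
  hence AE: "AE x in lborel. x \<notin> N" by (simp add: AE_completion_iff)
  have "comparable_family (compare_const \<beta> CARD('n)) N (phi_hat \<phi>)"
    unfolding comparable_family_def
  proof (intro conjI allI impI AE compare_const_ge_1 \<beta>)
    fix x assume "x \<notin> N"
    thus "young_normal (phi_hat \<phi> x)" using \<beta> by (intro phi_hat_young_normal) (auto simp: N_def)
  next
    fix x y l assume "x \<notin> N" "y \<notin> N" "0 \<le> l"
      "phi_hat \<phi> x l * ennreal (dist x y ^ CARD('n)) \<le> ennreal (6 ^ CARD('n))"
    thus "phi_hat \<phi> x l \<le> phi_hat \<phi> y (compare_const \<beta> CARD('n) * l)"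
      using \<beta> N0(2)[of y x] by (intro phi_hat_compare) (auto simp: N_def dist_commute)
  qed
  thus thesis by (rule that) (simp add: N_def)
qed

section \<open>Weak gradients\<close>

lemma borel_measurable_vec_nth [measurable (raw)]:
  fixes f :: "'a \<Rightarrow> real^'n"
  assumes "f \<in> borel_measurable M"
  shows "(\<lambda>x. f x $ i) \<in> borel_measurable M"
  using assms by (rule measurable_compose)
    (intro borel_measurable_continuous_onI continuous_on_component continuous_on_id)

text \<open>Componentwise from the scalar case.\<close>

lemma lebesgue_borel_version:
  fixes f :: "real^'n \<Rightarrow> 'b::euclidean_space"
  assumes "f \<in> borel_measurable lebesgue"
  obtains f' where "f' \<in> borel_measurable borel" "AE x in lebesgue. f x = f' x"
proof -
  have "\<exists>h. h \<in> borel_measurable lborel \<and> (AE x in lborel. f x \<bullet> b = h x)" for b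
    using completion_ex_borel_measurable_real[of "\<lambda>x. f x \<bullet> b" lborel] assms by auto
  then obtain h where h: "\<And>b. h b \<in> borel_measurable lborel" "\<And>b. AE x in lborel. f x \<bullet> b = h b x" by metis
  define f' where "f' = (\<lambda>x. \<Sum>b\<in>Basis. h b x *\<^sub>R b)"
  have [measurable]: "h b \<in> borel_measurable borel" for b using h(1) by simp
  have "f' \<in> borel_measurable borel" unfolding f'_def by measurable
  moreover have "AE x in lborel. \<forall>b\<in>(Basis :: 'b set). f x \<bullet> b = h b x"
    using h(2) by (subst AE_ball_countable) (auto intro: countable_finite)
  hence "AE x in lborel. f x = f' x"
  proof eventually_elim
    case (elim x)
    have "f x = (\<Sum>b\<in>Basis. (f x \<bullet> b) *\<^sub>R b)" by (simp add: euclidean_representation)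
    also have "\<dots> = f' x" unfolding f'_def using elim by (intro sum.cong) auto
    finally show ?case .
  qed
  hence "AE x in lebesgue. f x = f' x" by (simp add: AE_completion_iff)
  ultimately show thesis by (rule that)
qed

lemma L1_loc_measurable:
  fixes f :: "real^'n \<Rightarrow> 'b::euclidean_space"
  assumes "L1_loc UNIV f" shows "f \<in> borel_measurable lebesgue"
proof (rule borel_measurable_LIMSEQ_metric)
  fix k :: nat
  have "set_integrable lebesgue (cball 0 (real k)) f" using assms by (simp add: L1_loc_def)
  thus "(\<lambda>x. indicator (cball 0 (real k)) x *\<^sub>R f x) \<in> borel_measurable lebesgue"
    unfolding set_integrable_def by (rule borel_measurable_integrable)
next
  fix x :: "real^'n"
  have "eventually (\<lambda>k. norm x < real k) sequentially"
    using eventually_gt_at_top[of "nat \<lceil>norm x\<rceil>"] by eventually_elim linarith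
  hence "eventually (\<lambda>k. indicator (cball 0 (real k)) x *\<^sub>R f x = f x) sequentially"
    by eventually_elim simp
  thus "(\<lambda>k. indicator (cball 0 (real k)) x *\<^sub>R f x) \<longlonglongrightarrow> f x" by (rule tendsto_eventually)
qed

lemma L1_loc_borel_version:
  fixes f :: "real^'n \<Rightarrow> 'b::euclidean_space"
  assumes f: "L1_loc UNIV f"
  obtains f' where "loc_integrable f'" "AE x in lebesgue. f x = f' x"
proof -
  obtain f' where f': "f' \<in> borel_measurable borel" "AE x in lebesgue. f x = f' x"
    using lebesgue_borel_version[OF L1_loc_measurable[OF f]] .
  have "integrable lborel (\<lambda>x. indicator (ball 0 K) x *\<^sub>R f' x)" for K :: real
  proof -
    have "set_integrable lebesgue (cball 0 K) f" using f by (simp add: L1_loc_def)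
    hence "set_integrable lebesgue (ball 0 K) f" by (rule set_integrable_subset) auto
    hence i: "integrable lebesgue (\<lambda>x. indicator (ball 0 K) x *\<^sub>R f x)" by (simp add: set_integrable_def)
    have fm: "(\<lambda>x. indicator (ball 0 K) x *\<^sub>R f' x) \<in> borel_measurable borel"
      using f'(1) by (intro borel_measurable_scaleR borel_measurable_indicator) auto
    have ae: "AE x in lebesgue. indicator (ball 0 K) x *\<^sub>R f x = indicator (ball 0 K) x *\<^sub>R f' x"
      using f'(2) by eventually_elim simp
    have "(\<lambda>x. indicator (ball 0 K) x *\<^sub>R f' x) \<in> borel_measurable lebesgue"
      using fm by (intro measurable_completion) simp
    from integrable_cong_AE_imp[OF i this ae]
    have "integrable lebesgue (\<lambda>x. indicator (ball 0 K) x *\<^sub>R f' x)" .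
    thus ?thesis using fm by (subst (asm) integrable_completion) auto
  qed
  thus thesis using f' by (intro that[of f']) (auto simp: loc_integrable_def)
qed

lemma integral_borel_version:
  fixes h h' c :: "real^'n \<Rightarrow> real"
  assumes "h \<in> borel_measurable lebesgue" and h': "h' \<in> borel_measurable borel"
    and c: "c \<in> borel_measurable borel" and "AE x in lebesgue. h x = h' x"
  shows "(LINT y|lebesgue. h y * c y) = (LINT y|lborel. h' y * c y)"
proof -
  have cl: "c \<in> borel_measurable lebesgue" "h' \<in> borel_measurable lebesgue"
    using c h' by (auto intro: measurable_completion)
  have "(LINT y|lebesgue. h y * c y) = (LINT y|lebesgue. h' y * c y)"
  proof (rule integral_cong_AE)
    show "AE y in lebesgue. h y * c y = h' y * c y" using assms(4) by eventually_elim simp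
  qed (use assms(1) cl in \<open>auto intro: borel_measurable_times\<close>)
  also have "\<dots> = (LINT y|lborel. h' y * c y)"
    using h' c by (intro integral_completion) simp
  finally show ?thesis .
qed

lemma bounded_scaleR_integrable:
  fixes f :: "real^'n \<Rightarrow> 'b::euclidean_space" and c :: "real^'n \<Rightarrow> real"
  assumes f: "integrable M f" and c: "c \<in> borel_measurable M" and bd: "\<And>y. \<bar>c y\<bar> \<le> B"
  shows "integrable M (\<lambda>y. c y *\<^sub>R f y)"
proof (rule Bochner_Integration.integrable_bound)
  show "integrable M (\<lambda>y. B *\<^sub>R f y)" using f by (rule integrable_scaleR_right)
  show "(\<lambda>y. c y *\<^sub>R f y) \<in> borel_measurable M" using f c by (intro borel_measurable_scaleR) auto
  have B0: "0 \<le> B" using bd[of 0] by linarith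
  show "AE y in M. norm (c y *\<^sub>R f y) \<le> norm (B *\<^sub>R f y)"
    using bd B0 by (intro AE_I2) (auto intro!: mult_right_mono)
qed

lemma weak_gradient_imp_weak_pair:
  fixes u u' :: "real^'n \<Rightarrow> real"
  assumes u: "L1_loc UNIV u" and wg: "has_weak_gradient UNIV u g" and u': "loc_integrable u'" and g': "loc_integrable g'"
    and uu: "AE x in lebesgue. u x = u' x" and gg: "AE x in lebesgue. g x = g' x"
  shows "weak_pair u' g'"
  unfolding weak_pair_def
proof (intro conjI allI impI u' g')
  fix d :: real and a :: "real^'n" assume d: "d > 0"
  note [measurable] = loc_integrable_measurable[OF u'] loc_integrable_measurable[OF g']
  have um: "u \<in> borel_measurable lebesgue" by (rule L1_loc_measurable[OF u])
  have gm: "g \<in> borel_measurable lebesgue" using wg by (intro L1_loc_measurable) (simp add: has_weak_gradient_def)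
  obtain B where B: "\<And>x :: real^'n. norm (dbump d x) \<le> B" using dbump_bounded[OF d] by blast
  define K where "K = norm a + d"
  have off: "d \<le> norm (a - y)" if "y \<notin> ball 0 K" for y
    using that norm_triangle_ineq2[of y a] by (simp add: K_def norm_minus_commute)
  have iu: "integrable lborel (\<lambda>y. u' y *\<^sub>R dbump d (a - y))"
  proof (rule Bochner_Integration.integrable_bound)
    show "integrable lborel (\<lambda>y. B *\<^sub>R indicator (ball 0 K) y *\<^sub>R u' y)"
      by (intro integrable_scaleR_right loc_integrableD u')
    have B0: "0 \<le> B" using B[of 0] norm_ge_zero order_trans by blast
    show "AE y in lborel. norm (u' y *\<^sub>R dbump d (a - y)) \<le> norm (B *\<^sub>R indicator (ball 0 K) y *\<^sub>R u' y)"
    proof (rule AE_I2)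
      fix y
      show "norm (u' y *\<^sub>R dbump d (a - y)) \<le> norm (B *\<^sub>R indicator (ball 0 K) y *\<^sub>R u' y)"
        using mult_right_mono[OF B[of "a - y"], of "\<bar>u' y\<bar>"] B0 dbump_eq_0[OF d off[of y]]
        by (cases "y \<in> ball 0 K") (auto simp: abs_mult mult.commute)
    qed
  qed measurable
  have "integrable lborel (\<lambda>y. bump d (a - y) *\<^sub>R (indicator (ball 0 K) y *\<^sub>R g' y))"
  proof (rule bounded_scaleR_integrable[OF loc_integrableD[OF g']])
    show "\<bar>bump d (a - y)\<bar> \<le> 1" for y using bump_nonneg[of d "a - y"] bump_le_1[of d "a - y"] by simp
  qed measurable
  moreover have "bump d (a - y) *\<^sub>R (indicator (ball 0 K) y *\<^sub>R g' y) = bump d (a - y) *\<^sub>R g' y" for y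
    using bump_eq_0[OF d off[of y]] by (cases "y \<in> ball 0 K") auto
  ultimately have ig: "integrable lborel (\<lambda>y. bump d (a - y) *\<^sub>R g' y)" by (simp only:)
  have tf: "test_function UNIV (\<lambda>y. bump d (a - y))" using d by (intro test_function_bump) auto
  show "(LINT y|lborel. u' y *\<^sub>R dbump d (a - y)) = (LINT y|lborel. bump d (a - y) *\<^sub>R g' y)"
  proof (subst vec_eq_iff, rule allI)
    fix i
    have uu': "(LINT y|lebesgue. u y * - (dbump d (a - y) $ i)) = (LINT y|lborel. u' y * - (dbump d (a - y) $ i))"
      by (rule integral_borel_version[OF um _ _ uu]) measurable
    have gi: "(\<lambda>y. g y $ i) \<in> borel_measurable lebesgue"
      using gm by (rule borel_measurable_vec_nth)
    have ae: "AE y in lebesgue. g y $ i = g' y $ i" using gg by eventually_elim simp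
    have gg': "(LINT y|lebesgue. g y $ i * bump d (a - y)) = (LINT y|lborel. g' y $ i * bump d (a - y))"
      by (rule integral_borel_version[OF gi _ _ ae]) measurable
    have "(LINT x:UNIV|lebesgue. u x * partial_deriv i (\<lambda>y. bump d (a - y)) x) = - (LINT x:UNIV|lebesgue. (g x $ i) * bump d (a - x))"
      using wg tf unfolding has_weak_gradient_def by blast
    hence "(LINT y|lebesgue. u y * - (dbump d (a - y) $ i)) = - (LINT y|lebesgue. g y $ i * bump d (a - y))"
      by (simp add: set_lebesgue_integral_def partial_deriv_bump)
    hence eq: "(LINT y|lborel. u' y * (dbump d (a - y) $ i)) = (LINT y|lborel. g' y $ i * bump d (a - y))"
      unfolding uu' gg' by simp
    have "(LINT y|lborel. u' y *\<^sub>R dbump d (a - y)) $ i = (LINT y|lborel. u' y * (dbump d (a - y) $ i))"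
      using integral_bounded_linear[OF bounded_linear_vec_nth[of i] iu] by simp
    also have "\<dots> = (LINT y|lborel. bump d (a - y) *\<^sub>R g' y) $ i"
      using integral_bounded_linear[OF bounded_linear_vec_nth[of i] ig] eq by (simp add: mult.commute)
    finally show "(LINT y|lborel. u' y *\<^sub>R dbump d (a - y)) $ i = (LINT y|lborel. bump d (a - y) *\<^sub>R g' y) $ i" .
  qed
qed

text \<open>The mollifications of the difference vanish near the centre, since the bumps are test functions,
  and they converge to the difference in \<open>L\<^sup>1\<close>.\<close>

lemma weak_gradient_unique_ball:
  fixes u :: "real^'n \<Rightarrow> real"
  assumes g: "has_weak_gradient S u g" and g': "has_weak_gradient S u g'" and r: "r > 0" and sub: "cball x0 r \<subseteq> S"
  shows "AE x in lebesgue. x \<in> ball x0 (r / 2) \<longrightarrow> g x = g' x"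
proof -
  let ?B = "cball x0 r"
  have ig: "integrable lebesgue (\<lambda>x. indicator ?B x *\<^sub>R g x)" and ig': "integrable lebesgue (\<lambda>x. indicator ?B x *\<^sub>R g' x)"
    using g g' sub by (auto simp: has_weak_gradient_def L1_loc_def set_integrable_def)
  define F where "F = (\<lambda>x. indicator ?B x *\<^sub>R g x - indicator ?B x *\<^sub>R g' x)"
  have iF: "integrable lebesgue F" unfolding F_def using ig ig' by (rule Bochner_Integration.integrable_diff)
  obtain H where H: "H \<in> borel_measurable borel" "AE x in lebesgue. F x = H x"
    using lebesgue_borel_version[of F] iF by auto
  have "integrable lebesgue H"
  proof (rule integrable_cong_AE_imp[OF iF _ H(2)])
    show "H \<in> borel_measurable lebesgue" using H(1) by (intro measurable_completion) simp
  qed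
  hence iH: "integrable lborel H" using H(1) by (subst (asm) integrable_completion) auto
  have zero: "mollify d H x = 0" if d: "0 < d" "d < r / 2" and x: "x \<in> ball x0 (r / 2)" for d x
  proof -
    have xd: "cball x d \<subseteq> ?B"
    proof
      fix y assume "y \<in> cball x d"
      thus "y \<in> ?B" using d x dist_triangle[of x0 y x] by auto
    qed
    have off: "bump d (x - y) = 0" if "y \<notin> ?B" for y
      using that xd by (intro bump_eq_0 d) (force simp: dist_norm not_le[symmetric])
    have tf: "test_function S (\<lambda>y. bump d (x - y))" using d xd sub by (intro test_function_bump) auto
    have bm: "(\<lambda>y. bump d (x - y)) \<in> borel_measurable lebesgue"
      by (intro measurable_completion) measurable
    have bb: "\<bar>bump d (x - y)\<bar> \<le> 1" for y using bump_nonneg[of d "x - y"] bump_le_1[of d "x - y"] by simp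
    have ibg: "integrable lebesgue (\<lambda>y. bump d (x - y) *\<^sub>R (indicator ?B y *\<^sub>R g y))"
      and ibg': "integrable lebesgue (\<lambda>y. bump d (x - y) *\<^sub>R (indicator ?B y *\<^sub>R g' y))"
      by (rule bounded_scaleR_integrable[OF ig bm bb], rule bounded_scaleR_integrable[OF ig' bm bb])
    have comp: "(LINT y|lebesgue. bump d (x - y) *\<^sub>R (indicator ?B y *\<^sub>R h y)) $ i = (LINT y:S|lebesgue. h y $ i * bump d (x - y))"
      if "integrable lebesgue (\<lambda>y. bump d (x - y) *\<^sub>R (indicator ?B y *\<^sub>R h y))" for h :: "real^'n \<Rightarrow> real^'n" and i
    proof -
      have "(LINT y|lebesgue. bump d (x - y) *\<^sub>R (indicator ?B y *\<^sub>R h y)) $ i = (LINT y|lebesgue. (bump d (x - y) *\<^sub>R (indicator ?B y *\<^sub>R h y)) $ i)"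
        using integral_bounded_linear[OF bounded_linear_vec_nth[of i] that] by simp
      also have "\<dots> = (LINT y:S|lebesgue. h y $ i * bump d (x - y))"
        unfolding set_lebesgue_integral_def
      proof (intro Bochner_Integration.integral_cong refl)
        fix y
        show "(bump d (x - y) *\<^sub>R (indicator ?B y *\<^sub>R h y)) $ i = indicator S y *\<^sub>R (h y $ i * bump d (x - y))"
        proof (cases "y \<in> ?B")
          case True
          hence "y \<in> S" using sub by blast
          thus ?thesis using True by (simp add: indicator_def mult.commute)
        qed (use off[of y] in simp)
      qed
      finally show ?thesis .
    qed
    have "(LINT y:S|lebesgue. g y $ i * bump d (x - y)) = (LINT y:S|lebesgue. g' y $ i * bump d (x - y))" for i
    proof -
      have "(LINT y:S|lebesgue. u y * partial_deriv i (\<lambda>y. bump d (x - y)) y) = - (LINT y:S|lebesgue. g y $ i * bump d (x - y))"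
        "(LINT y:S|lebesgue. u y * partial_deriv i (\<lambda>y. bump d (x - y)) y) = - (LINT y:S|lebesgue. g' y $ i * bump d (x - y))"
        using g g' tf unfolding has_weak_gradient_def by blast+
      thus ?thesis by simp
    qed
    hence "(LINT y|lebesgue. bump d (x - y) *\<^sub>R (indicator ?B y *\<^sub>R g y)) = (LINT y|lebesgue. bump d (x - y) *\<^sub>R (indicator ?B y *\<^sub>R g' y))"
      unfolding vec_eq_iff by (simp only: comp[OF ibg] comp[OF ibg'] simp_thms)
    hence F0: "(LINT y|lebesgue. bump d (x - y) *\<^sub>R F y) = 0"
      unfolding F_def scaleR_diff_right using ibg ibg' by (subst Bochner_Integration.integral_diff) auto
    have "(LINT y|lborel. bump d (x - y) *\<^sub>R H y) = (LINT y|lebesgue. bump d (x - y) *\<^sub>R H y)"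
      using H(1) by (intro integral_completion[symmetric]) simp
    also have "\<dots> = (LINT y|lebesgue. bump d (x - y) *\<^sub>R F y)"
    proof (rule integral_cong_AE)
      show "AE y in lebesgue. bump d (x - y) *\<^sub>R H y = bump d (x - y) *\<^sub>R F y" using H(2) by eventually_elim simp
    qed (use H(1) iF bm in \<open>auto intro!: borel_measurable_scaleR measurable_completion\<close>)
    finally have "(LINT y|lborel. bump d (x - y) *\<^sub>R H y) = 0" using F0 by simp
    moreover have "mollify d H x = (1 / (LINT y|lborel. bump d (y :: real^'n))) *\<^sub>R (LINT y|lborel. bump d (x - y) *\<^sub>R H y)"
      unfolding mollify_def mollifier_def by (subst integral_scaleR_right[symmetric]) simp
    ultimately show ?thesis by simp
  qed
  have le: "(\<integral>\<^sup>+x. indicator (ball x0 (r / 2)) x * ennreal (norm (H x)) \<partial>lborel) \<le> 0 + ennreal e" if e: "e > 0" for e :: real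
  proof -
    obtain d0 where d0: "d0 > 0" "\<And>d. 0 < d \<Longrightarrow> d < d0 \<Longrightarrow> (\<integral>\<^sup>+x. ennreal (norm (mollify d H x - H x)) \<partial>lborel) \<le> ennreal e"
      using L1_mollify[OF iH e] by blast
    define d where "d = min d0 (r / 2) / 2"
    have d: "0 < d" "d < d0" "d < r / 2" using d0(1) r by (auto simp: d_def)
    have "(\<integral>\<^sup>+x. indicator (ball x0 (r / 2)) x * ennreal (norm (H x)) \<partial>lborel) \<le> (\<integral>\<^sup>+x. ennreal (norm (mollify d H x - H x)) \<partial>lborel)"
      using zero[OF d(1,3)] by (intro nn_integral_mono) (auto simp: indicator_def)
    also note d0(2)[OF d(1,2)]
    finally show ?thesis by simp
  qed
  have "(\<integral>\<^sup>+x. indicator (ball x0 (r / 2)) x * ennreal (norm (H x)) \<partial>lborel) \<le> 0"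
    by (rule ennreal_le_epsilon) (rule le)
  hence "AE x in lborel. indicator (ball x0 (r / 2)) x * ennreal (norm (H x)) = 0"
    using H(1) by (subst (asm) le_zero_eq, subst (asm) nn_integral_0_iff_AE) auto
  hence "AE x in lebesgue. indicator (ball x0 (r / 2)) x * ennreal (norm (H x)) = 0"
    by (simp add: AE_completion_iff)
  thus ?thesis using H(2)
  proof eventually_elim
    case (elim x)
    show ?case
    proof
      assume x: "x \<in> ball x0 (r / 2)"
      hence "H x = 0" using elim by simp
      moreover have "x \<in> ?B" using x r zero_le_dist[of x0 x] by (simp del: zero_le_dist)
      ultimately show "g x = g' x" using elim(2) by (simp add: F_def)
    qed
  qed
qed

lemma weak_gradient_unique:
  assumes S: "open S" and g: "has_weak_gradient S u g" and g': "has_weak_gradient S u g'"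
  shows "AE x in lebesgue. x \<in> S \<longrightarrow> g x = g' x"
proof -
  define \<F> where "\<F> = {ball x0 (r / 2) | x0 r. 0 < r \<and> cball x0 r \<subseteq> S}"
  have "\<And>B. B \<in> \<F> \<Longrightarrow> open B" by (auto simp: \<F>_def)
  from Lindelof[OF this] obtain \<G> where \<G>: "\<G> \<subseteq> \<F>" "countable \<G>" "\<Union>\<G> = \<Union>\<F>" by blast
  have "AE x in lebesgue. \<forall>B\<in>\<G>. x \<in> B \<longrightarrow> g x = g' x"
    using \<G>(1) weak_gradient_unique_ball[OF g g'] by (subst AE_ball_countable[OF \<G>(2)]) (auto simp: \<F>_def)
  moreover have "S \<subseteq> \<Union>\<G>"
  proof
    fix x assume "x \<in> S"
    then obtain r where r: "r > 0" "cball x r \<subseteq> S" using S open_contains_cball by blast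
    have "ball x (r / 2) \<in> \<F>" using r by (auto simp: \<F>_def)
    moreover have "x \<in> ball x (r / 2)" using r by simp
    ultimately show "x \<in> \<Union>\<G>" unfolding \<G>(3) by blast
  qed
  ultimately show ?thesis by (auto elim!: eventually_mono)
qed

lemma has_weak_gradient_restrict:
  assumes "has_weak_gradient UNIV (\<lambda>x. if x \<in> S then u x else 0) g"
  shows "has_weak_gradient S u g"
  unfolding has_weak_gradient_def
proof (intro conjI allI impI)
  show "L1_loc S g" using assms by (auto simp: has_weak_gradient_def L1_loc_def)
  fix \<psi> i assume t: "test_function S \<psi>"
  hence t': "test_function UNIV \<psi>" by (simp add: test_function_def)
  have off: "\<psi> x = 0" if "x \<notin> S" for x
    using t that closure_subset[of "{x. \<psi> x \<noteq> 0}"] by (auto simp: test_function_def)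
  have "(LINT x:S|lebesgue. u x * partial_deriv i \<psi> x) = (LINT x:UNIV|lebesgue. (if x \<in> S then u x else 0) * partial_deriv i \<psi> x)"
    unfolding set_lebesgue_integral_def by (intro Bochner_Integration.integral_cong refl) (auto simp: indicator_def)
  also have "\<dots> = - (LINT x:UNIV|lebesgue. (g x $ i) * \<psi> x)"
    using assms t' unfolding has_weak_gradient_def by blast
  also have "(LINT x:UNIV|lebesgue. (g x $ i) * \<psi> x) = (LINT x:S|lebesgue. (g x $ i) * \<psi> x)"
    unfolding set_lebesgue_integral_def using off by (intro Bochner_Integration.integral_cong refl) (auto simp: indicator_def)
  finally show "(LINT x:S|lebesgue. u x * partial_deriv i \<psi> x) = - (LINT x:S|lebesgue. (g x $ i) * \<psi> x)" .
qed

section \<open>The Sobolev embedding\<close>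

lemma sobolev_conjugate_eq:
  "sobolev_conjugate \<phi> (x :: real^'n) t = conj_of CARD('n) (phi_hat \<phi> x) t"
proof -
  have "H_diamond \<phi> x = sob_H CARD('n) (phi_hat \<phi> x)"
    by (rule ext) (simp add: H_diamond_def sob_H_def Let_def)
  thus ?thesis by (simp add: sobolev_conjugate_def conj_of_def)
qed

lemma modular_eq:
  fixes S :: "(real^'n) set"
  assumes "S \<in> sets lebesgue"
  shows "modular \<phi> S u = (\<integral>\<^sup>+x. \<phi> x \<bar>u x\<bar> * indicator S x \<partial>lborel)"
  using assms unfolding modular_def
  by (subst nn_integral_restrict_space) (auto simp: nn_integral_completion)

text \<open>By continuity in the second argument, \<open>\<phi> x (f x)\<close> is a limit of the functions obtained when \<open>f\<close> is
  rounded to multiples of \<open>2\<^sup>-\<^sup>k\<close>; these take countably many values.\<close>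

lemma caratheodory_borel_version:
  fixes \<phi> :: "real^'n \<Rightarrow> real \<Rightarrow> ennreal"
  assumes gyf: "generalized_young_function \<phi>"
    and [measurable]: "f \<in> borel_measurable borel" and f0: "\<And>x. 0 \<le> f x"
  obtains P where "P \<in> borel_measurable borel" "AE x in lborel. \<phi> x (f x) = P x"
proof -
  have yf: "AE x in lebesgue. young_function (\<phi> x)" and \<phi>m: "\<And>t. 0 \<le> t \<Longrightarrow> (\<lambda>x. \<phi> x t) \<in> borel_measurable lebesgue"
    using gyf by (auto simp: generalized_young_function_def)
  define q where "q = (\<lambda>k x. nat \<lfloor>2 ^ k * f x\<rfloor>)"
  have qm: "q k \<in> measurable lebesgue (count_space UNIV)" for k :: nat
    unfolding q_def by (intro measurable_completion) measurable
  define h where "h = (\<lambda>x. liminf (\<lambda>k. \<phi> x (real (q k x) / 2 ^ k)))"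
  have "(\<lambda>x. \<phi> x (real (q k x) / 2 ^ k)) \<in> borel_measurable lebesgue" for k
  proof (rule measurable_compose_countable[where f = "\<lambda>i x. \<phi> x (real i / 2 ^ k)" and g = "q k", OF _ qm])
    show "(\<lambda>x. \<phi> x (real i / 2 ^ k)) \<in> borel_measurable lebesgue" for i :: nat by (rule \<phi>m) simp
  qed
  hence hm: "h \<in> borel_measurable lebesgue" unfolding h_def by (intro borel_measurable_liminf)
  have q_lim: "(\<lambda>k. real (q k x) / 2 ^ k) \<longlonglongrightarrow> f x" for x
  proof (rule real_tendsto_sandwich)
    have le: "real (q k x) \<le> 2 ^ k * f x" "2 ^ k * f x - 1 \<le> real (q k x)" for k
    proof -
      have "0 \<le> 2 ^ k * f x" using f0[of x] by simp
      hence "real (q k x) = of_int \<lfloor>2 ^ k * f x\<rfloor>" by (simp add: q_def)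
      thus "real (q k x) \<le> 2 ^ k * f x" "2 ^ k * f x - 1 \<le> real (q k x)" by linarith+
    qed
    show "eventually (\<lambda>k. f x - (1/2) ^ k \<le> real (q k x) / 2 ^ k) sequentially"
    proof (intro always_eventually allI)
      fix k
      have "f x - (1/2) ^ k = (2 ^ k * f x - 1) / 2 ^ k" by (simp add: diff_divide_distrib power_one_over)
      also have "\<dots> \<le> real (q k x) / 2 ^ k" by (intro divide_right_mono le(2)) simp
      finally show "f x - (1/2) ^ k \<le> real (q k x) / 2 ^ k" .
    qed
    show "eventually (\<lambda>k. real (q k x) / 2 ^ k \<le> f x) sequentially"
      using le(1) by (intro always_eventually allI) (simp add: field_simps)
    have "(\<lambda>k. f x - (1/2) ^ k) \<longlonglongrightarrow> f x - 0" by (intro tendsto_intros LIMSEQ_realpow_zero) auto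
    thus "(\<lambda>k. f x - (1/2) ^ k) \<longlonglongrightarrow> f x" by simp
  qed simp
  have "AE x in lborel. \<phi> x (f x) = h x"
    using yf unfolding AE_completion_iff
  proof eventually_elim
    case (elim x)
    have "(\<lambda>k. \<phi> x (real (q k x) / 2 ^ k)) \<longlonglongrightarrow> \<phi> x (f x)"
      by (rule continuous_on_tendsto_compose[OF young_cont[OF elim] q_lim]) (use f0 in auto)
    thus ?case unfolding h_def by (intro lim_imp_Liminf[symmetric]) auto
  qed
  moreover obtain P where "P \<in> borel_measurable lborel" "AE x in lborel. h x = P x"
    using completion_ex_borel_measurable[OF hm] by auto
  ultimately show thesis
    by (intro that[of P]) (auto elim: eventually_elim2)
qed

lemma weak_pair_scale: assumes "weak_pair u g" shows "weak_pair (\<lambda>x. s * u x) (\<lambda>x. s *\<^sub>R g x)"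
proof -
  have li: "loc_integrable (\<lambda>x. s *\<^sub>R f x)" if f: "loc_integrable f" for f :: "real^'n \<Rightarrow> 'b::euclidean_space"
    unfolding loc_integrable_def
  proof (intro conjI allI)
    show "(\<lambda>x. s *\<^sub>R f x) \<in> borel_measurable borel" using loc_integrable_measurable[OF f] by measurable
    fix K
    show "integrable lborel (\<lambda>x. indicator (ball 0 K) x *\<^sub>R s *\<^sub>R f x)"
      using integrable_scaleR_right[OF loc_integrableD[OF f, of K], of s] by (simp add: mult.commute)
  qed
  show ?thesis
    using assms li[of u] li[of g] unfolding weak_pair_def by (auto simp flip: scaleR_scaleR simp: scaleR_left_commute)
qed

definition eps_const :: "nat \<Rightarrow> real \<Rightarrow> real" where
  "eps_const n m = 1 / (max 1 (covering_const n) * (m + 4))"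

definition final_const :: "'n::finite itself \<Rightarrow> real \<Rightarrow> real \<Rightarrow> real" where
  "final_const T \<beta> m = compare_const \<beta> CARD('n) /
     (emb_const (compare_const \<beta> CARD('n)) T * eps_const CARD('n) m * \<beta>)"

lemma final_const_pos:
  assumes "0 < \<beta>" "\<beta> \<le> 1" "0 \<le> m"
  shows "0 < emb_const (compare_const \<beta> CARD('n)) TYPE('n::finite)" "0 < eps_const n m" "0 < final_const TYPE('n) \<beta> m"
proof -
  have D: "1 \<le> compare_const \<beta> CARD('n)" by (rule compare_const_ge_1[OF assms(1,2)])
  have u: "0 < unit_ball_vol (real CARD('n))" by simp
  have "0 < potential_const CARD('n)" unfolding potential_const_def by (intro add_pos_nonneg add_nonneg_pos mult_nonneg_nonneg) (use u in auto)
  thus e: "0 < emb_const (compare_const \<beta> CARD('n)) TYPE('n)" using D u unfolding emb_const_def by (intro divide_pos_pos mult_pos_pos) auto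
  show e': "0 < eps_const n m" for n using assms unfolding eps_const_def by (intro divide_pos_pos mult_pos_pos) auto
  show "0 < final_const TYPE('n) \<beta> m" using D e e' assms unfolding final_const_def by (intro divide_pos_pos mult_pos_pos) auto
qed

text \<open>The function is multiplied by \<open>s\<close> such that the modular of its gradient becomes at most the reciprocal
  of the constant in \<open>conjugate_modular_bound\<close>: \<open>\<beta> / (k D)\<close> accounts for the passage to \<open>phi_hat \<phi>\<close> and for the
  comparability constant \<open>D\<close>, and \<open>\<epsilon>\<close> for the constant and for the modular bound \<open>\<bar>S\<bar> + 4\<close>. The truncations
  only see the gradient where \<open>u \<noteq> 0\<close>, hence only inside \<open>S\<close>.\<close>

lemma core_embedding:
  fixes u :: "real^'n \<Rightarrow> real" and \<phi> :: "real^'n \<Rightarrow> real \<Rightarrow> ennreal"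
  assumes n2: "CARD('n) \<ge> 2" and \<beta>: "0 < \<beta>" "\<beta> \<le> 1" and S: "open S" "emeasure lebesgue S < \<infinity>"
    and gyf: "generalized_young_function \<phi>" and A0: "cond_A0 \<beta> \<phi>" and A1: "cond_A1 \<beta> \<phi>"
    and ug: "weak_pair u g" and u0: "AE x in lborel. x \<notin> S \<longrightarrow> u x = 0" and k: "k > 0"
    and mod: "(\<integral>\<^sup>+x. \<phi> x (norm (g x) / k) * indicator S x \<partial>lborel) \<le> 1"
  shows "(\<integral>\<^sup>+x. sobolev_conjugate \<phi> x (\<bar>u x\<bar> / (final_const TYPE('n) \<beta> (measure lebesgue S) * k)) \<partial>lborel) \<le> 1"
proof -
  define m where "m = measure lebesgue S"
  have m0: "0 \<le> m" by (simp add: m_def)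
  define D where "D = compare_const \<beta> CARD('n)"
  have D1: "1 \<le> D" unfolding D_def by (rule compare_const_ge_1[OF \<beta>])
  define \<epsilon> where "\<epsilon> = eps_const CARD('n) m"
  define c0 where "c0 = emb_const D TYPE('n)"
  have \<epsilon>: "\<epsilon> > 0" and c0: "c0 > 0" 
    using final_const_pos(1)[OF \<beta> m0, where 'n = 'n] final_const_pos(2)[OF \<beta> m0] by (auto simp: \<epsilon>_def c0_def D_def)
  have mC: "1 \<le> max 1 (covering_const CARD('n)) * (m + 4)"
    using mult_mono[of 1 "max 1 (covering_const CARD('n))" 1 "m + 4"] m0 by simp
  hence \<epsilon>1: "\<epsilon> \<le> 1" by (simp add: \<epsilon>_def eps_const_def)
  obtain N where fam: "comparable_family D N (phi_hat \<phi>)" and good: "\<And>x. x \<notin> N \<Longrightarrow> good_point \<beta> (\<phi> x)"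
    using phi_hat_comparable_family[OF \<beta> gyf A0 A1] unfolding D_def by blast
  have lg: "loc_integrable g" and lu: "loc_integrable u" using ug by (auto simp: weak_pair_def)
  note [measurable] = loc_integrable_measurable[OF lg] loc_integrable_measurable[OF lu]
  define f where "f = (\<lambda>x. norm (g x) / k)"
  have f0: "0 \<le> f x" for x using k by (simp add: f_def)
  have [measurable]: "f \<in> borel_measurable borel" unfolding f_def by measurable
  obtain P where P [measurable]: "P \<in> borel_measurable borel" and fP: "AE x in lborel. \<phi> x (f x) = P x"
    using caratheodory_borel_version[OF gyf, of f] f0 by auto
  have Sb [measurable]: "S \<in> sets borel" using S(1) by auto
  have mS: "emeasure lborel S = ennreal m"
    using S Sb by (simp add: m_def emeasure_eq_ennreal_measure emeasure_completion)
  define s where "s = \<epsilon> * \<beta> / (k * D)"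
  have s: "s > 0" using \<epsilon> \<beta> k D1 by (simp add: s_def)
  define G0 where "G0 = (\<lambda>x. ennreal \<epsilon> * ((1 + 4 * P x) * indicator S x))"
  have [measurable]: "G0 \<in> borel_measurable borel" unfolding G0_def by measurable
  have intP: "(\<integral>\<^sup>+x. P x * indicator S x \<partial>lborel) \<le> 1"
  proof -
    have "(\<integral>\<^sup>+x. P x * indicator S x \<partial>lborel) = (\<integral>\<^sup>+x. \<phi> x (norm (g x) / k) * indicator S x \<partial>lborel)"
      using fP by (intro nn_integral_cong_AE) (auto elim!: eventually_mono simp: f_def)
    thus ?thesis using mod by simp
  qed
  have G0_int: "(\<integral>\<^sup>+x. G0 x \<partial>lborel) \<le> ennreal (1 / max 1 (covering_const CARD('n)))"
  proof -
    have "(\<integral>\<^sup>+x. G0 x \<partial>lborel) = ennreal \<epsilon> * (\<integral>\<^sup>+x. indicator S x + 4 * (P x * indicator S x) \<partial>lborel)"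
      unfolding G0_def by (subst nn_integral_cmult) (auto simp: distrib_right mult.assoc)
    also have "(\<integral>\<^sup>+x. indicator S x + 4 * (P x * indicator S x) \<partial>lborel) = ennreal m + 4 * (\<integral>\<^sup>+x. P x * indicator S x \<partial>lborel)"
      by (subst nn_integral_add) (auto simp: nn_integral_cmult mS)
    also have "\<dots> \<le> ennreal m + 4 * 1" by (intro add_left_mono mult_left_mono intP) auto
    also have "\<dots> = ennreal (m + 4)" using m0 by (simp add: ennreal_plus)
    finally have "(\<integral>\<^sup>+x. G0 x \<partial>lborel) \<le> ennreal \<epsilon> * ennreal (m + 4)" by (simp add: mult_left_mono)
    also have "\<dots> = ennreal (\<epsilon> * (m + 4))" using \<epsilon> m0 by (simp add: ennreal_mult)
    also have "\<epsilon> * (m + 4) = 1 / max 1 (covering_const CARD('n))" using m0 by (simp add: \<epsilon>_def eps_const_def)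
    finally show ?thesis .
  qed
  have G0_1: "(\<integral>\<^sup>+x. G0 x \<partial>lborel) \<le> 1"
  proof -
    note G0_int
    also have "ennreal (1 / max 1 (covering_const CARD('n))) \<le> ennreal 1" by (intro ennreal_leI) simp
    finally show ?thesis by simp
  qed
  have supp: "emeasure lborel {x. s * u x \<noteq> 0} < \<infinity>"
  proof -
    have "emeasure lborel {x. s * u x \<noteq> 0} \<le> emeasure lborel S"
      using u0 by (intro emeasure_mono_AE) (auto elim!: eventually_mono)
    also have "\<dots> < \<infinity>" by (simp add: mS)
    finally show ?thesis .
  qed
  have AEN: "AE x in lborel. x \<notin> N" using fam by (simp add: comparable_family_def)
  have dom: "AE y in lborel. s * u y \<noteq> 0 \<longrightarrow> phi_hat \<phi> y (D * norm (s *\<^sub>R g y)) \<le> G0 y"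
    using u0 fP AEN
  proof eventually_elim
    case (elim y)
    show ?case
    proof
      assume "s * u y \<noteq> 0"
      hence yS: "y \<in> S" using elim by auto
      have "norm (s *\<^sub>R g y) = s * norm (g y)" using s by simp
      hence "D * norm (s *\<^sub>R g y) = \<epsilon> * (\<beta> * f y)" using D1 k by (simp add: s_def f_def)
      hence "phi_hat \<phi> y (D * norm (s *\<^sub>R g y)) = phi_hat \<phi> y (\<epsilon> * (\<beta> * f y))" by simp
      also have "\<dots> \<le> ennreal \<epsilon> * phi_hat \<phi> y (\<beta> * f y)"
        using \<epsilon> \<epsilon>1 \<beta> f0 by (intro young_normal_scale[OF phi_hat_young_normal[of \<beta> \<phi> y, OF good[OF elim(3)] \<beta>(1)]]) auto
      also have "\<dots> \<le> ennreal \<epsilon> * (1 + 4 * \<phi> y (f y))"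
        by (intro mult_left_mono phi_hat_le[of \<beta> \<phi> y, OF good[OF elim(3)] \<beta> f0]) auto
      also have "\<dots> = G0 y" using yS elim(2) by (simp add: G0_def)
      finally show "phi_hat \<phi> y (D * norm (s *\<^sub>R g y)) \<le> G0 y" .
    qed
  qed
  have eq: "\<bar>u x\<bar> / (final_const TYPE('n) \<beta> m * k) = c0 * \<bar>s * u x\<bar>" for x
    using s c0 \<epsilon> \<beta> k D1 by (simp add: final_const_def D_def[symmetric] c0_def[symmetric] \<epsilon>_def[symmetric] abs_mult s_def field_simps)
  have "(\<integral>\<^sup>+x. sobolev_conjugate \<phi> x (\<bar>u x\<bar> / (final_const TYPE('n) \<beta> m * k)) \<partial>lborel)
     = (\<integral>\<^sup>+y. conj_of CARD('n) (phi_hat \<phi> y) (emb_const D TYPE('n) * \<bar>s * u y\<bar>) \<partial>lborel)"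
    unfolding eq sobolev_conjugate_eq c0_def ..
  also have "\<dots> \<le> ennreal (covering_const CARD('n)) * (\<integral>\<^sup>+y. G0 y \<partial>lborel)"
    by (rule conjugate_modular_bound[OF n2 fam weak_pair_scale[OF ug] supp _ dom G0_1]) measurable
  also have "\<dots> \<le> ennreal (covering_const CARD('n)) * ennreal (1 / max 1 (covering_const CARD('n)))"
    by (intro mult_left_mono G0_int) auto
  also have "\<dots> = ennreal (covering_const CARD('n) * (1 / max 1 (covering_const CARD('n))))"
    by (subst ennreal_mult) (auto simp: covering_const_def)
  also have "\<dots> \<le> ennreal 1" by (intro ennreal_leI) (auto simp: max_def divide_le_eq)
  finally show ?thesis by (simp add: m_def)
qed

theorem theorem3p5:
  assumes "CARD('n) \<ge> 2"
  shows "\<exists>c :: real \<Rightarrow> real \<Rightarrow> real.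
    \<forall>\<beta> (\<Omega> :: (real^'n) set) (\<phi> :: real^'n \<Rightarrow> real \<Rightarrow> ennreal).
      0 < \<beta> \<and> \<beta> \<le> 1 \<and>
      open \<Omega> \<and> emeasure lebesgue \<Omega> < \<infinity> \<and>
      generalized_young_function \<phi> \<and> cond_A0 \<beta> \<phi> \<and> cond_A1 \<beta> \<phi> \<longrightarrow>
        V1_0 \<phi> \<Omega> \<subseteq> L_space (sobolev_conjugate \<phi>) \<Omega> \<and>
        (\<forall>u \<in> V1_0 \<phi> \<Omega>.
           L_norm (sobolev_conjugate \<phi>) \<Omega> u
             \<le> ennreal (c \<beta> (measure lebesgue \<Omega>)) * V1_0_norm \<phi> \<Omega> u)"
proof (intro exI[of _ "final_const TYPE('n)"] allI impI)
  fix \<beta> and \<Omega> :: "(real^'n) set" and \<phi> :: "real^'n \<Rightarrow> real \<Rightarrow> ennreal"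
  assume hyp: "0 < \<beta> \<and> \<beta> \<le> 1 \<and> open \<Omega> \<and> emeasure lebesgue \<Omega> < \<infinity> \<and>
      generalized_young_function \<phi> \<and> cond_A0 \<beta> \<phi> \<and> cond_A1 \<beta> \<phi>"
  hence \<beta>: "0 < \<beta>" "\<beta> \<le> 1" and \<Omega>: "open \<Omega>" "emeasure lebesgue \<Omega> < \<infinity>"
    and gyf: "generalized_young_function \<phi>" and A0: "cond_A0 \<beta> \<phi>" and A1: "cond_A1 \<beta> \<phi>" by auto
  define c where "c = final_const TYPE('n) \<beta> (measure lebesgue \<Omega>)"
  have c: "c > 0" unfolding c_def using \<beta> by (intro final_const_pos) auto
  have \<Omega>s: "\<Omega> \<in> sets lebesgue" using \<Omega> by auto
  have main: "L_norm (sobolev_conjugate \<phi>) \<Omega> u \<le> ennreal c * V1_0_norm \<phi> \<Omega> u \<and> u \<in> L_space (sobolev_conjugate \<phi>) \<Omega>"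
    if u: "u \<in> V1_0 \<phi> \<Omega>" for u
  proof -
    define v where "v = (\<lambda>x. if x \<in> \<Omega> then u x else 0)"
    have vV: "v \<in> V1 \<phi> UNIV" and uW: "u \<in> W11_loc \<Omega>" using u by (auto simp: V1_0_def v_def)
    define G where "G = weak_gradient UNIV v"
    define h where "h = weak_gradient \<Omega> u"
    have vL: "L1_loc UNIV v" using vV by (simp add: V1_def W11_loc_def)
    have "\<exists>g. has_weak_gradient UNIV v g" using vV by (simp add: V1_def W11_loc_def)
    hence G: "has_weak_gradient UNIV v G" unfolding G_def weak_gradient_def by (rule someI_ex)
    have "\<exists>g. has_weak_gradient \<Omega> u g" using uW by (simp add: W11_loc_def)
    hence h: "has_weak_gradient \<Omega> u h" unfolding h_def weak_gradient_def by (rule someI_ex)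
    have GL: "L1_loc UNIV G" using G by (simp add: has_weak_gradient_def)
    \<comment> \<open>The gradient of the extension by 0 is identified with the gradient on the domain only
      inside the domain.\<close>
    have Gh: "AE x in lborel. x \<in> \<Omega> \<longrightarrow> G x = h x"
      using weak_gradient_unique[OF \<Omega>(1) has_weak_gradient_restrict[OF G[unfolded v_def]] h]
      by (simp add: AE_completion_iff)
    obtain v' where v': "loc_integrable v'" "AE x in lebesgue. v x = v' x" using L1_loc_borel_version[OF vL] .
    obtain G' where G': "loc_integrable G'" "AE x in lebesgue. G x = G' x" using L1_loc_borel_version[OF GL] .
    have wp: "weak_pair v' G'" by (rule weak_gradient_imp_weak_pair[OF vL G v'(1) G'(1) v'(2) G'(2)])
    have vv: "AE x in lborel. v x = v' x" and GG: "AE x in lborel. G x = G' x"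
      using v'(2) G'(2) by (simp_all add: AE_completion_iff)
    note [measurable] = loc_integrable_measurable[OF G'(1)]
    have mod_h: "modular \<phi> \<Omega> (\<lambda>x. norm (h x) / k) = (\<integral>\<^sup>+x. \<phi> x (norm (G' x) / k) * indicator \<Omega> x \<partial>lborel)" if k: "k > 0" for k
      unfolding modular_eq[OF \<Omega>s]
    proof (rule nn_integral_cong_AE)
      show "AE x in lborel. \<phi> x \<bar>norm (h x) / k\<bar> * indicator \<Omega> x = \<phi> x (norm (G' x) / k) * indicator \<Omega> x"
        using Gh GG by eventually_elim (use k in \<open>auto simp: indicator_def\<close>)
    qed
    have key: "modular (sobolev_conjugate \<phi>) \<Omega> (\<lambda>x. u x / (c * k)) \<le> 1"
      if k: "k > 0" and mk: "modular \<phi> \<Omega> (\<lambda>x. norm (h x) / k) \<le> 1" for k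
    proof -
      have z: "AE x in lborel. x \<notin> \<Omega> \<longrightarrow> v' x = 0" using vv by eventually_elim (auto simp: v_def split: if_splits)
      have "modular (sobolev_conjugate \<phi>) \<Omega> (\<lambda>x. u x / (c * k)) \<le> (\<integral>\<^sup>+x. sobolev_conjugate \<phi> x (\<bar>v' x\<bar> / (c * k)) \<partial>lborel)"
        unfolding modular_eq[OF \<Omega>s]
      proof (rule nn_integral_mono_AE)
        show "AE x in lborel. sobolev_conjugate \<phi> x \<bar>u x / (c * k)\<bar> * indicator \<Omega> x \<le> sobolev_conjugate \<phi> x (\<bar>v' x\<bar> / (c * k))"
          using vv by eventually_elim (use c k in \<open>auto simp: indicator_def v_def abs_mult\<close>)
      qed
      also have "\<dots> \<le> 1"
        unfolding c_def using mk k by (intro core_embedding[OF assms \<beta> \<Omega> gyf A0 A1 wp z]) (simp_all add: mod_h)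
      finally show ?thesis .
    qed
    have norm_le: "L_norm (sobolev_conjugate \<phi>) \<Omega> u \<le> ennreal c * V1_0_norm \<phi> \<Omega> u"
    proof -
      have "ennreal (1 / c) * L_norm (sobolev_conjugate \<phi>) \<Omega> u \<le> V1_0_norm \<phi> \<Omega> u"
        unfolding V1_0_norm_def L_norm_def[of \<phi>] h_def[symmetric]
      proof (intro Inf_greatest, clarify)
        fix k :: real assume k: "0 < k" "modular \<phi> \<Omega> (\<lambda>x. norm (h x) / k) \<le> 1"
        have "L_norm (sobolev_conjugate \<phi>) \<Omega> u \<le> ennreal (c * k)"
          unfolding L_norm_def using key[OF k] k c by (intro Inf_lower) auto
        hence "ennreal (1 / c) * L_norm (sobolev_conjugate \<phi>) \<Omega> u \<le> ennreal (1 / c) * ennreal (c * k)"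
          by (intro mult_left_mono) auto
        also have "\<dots> = ennreal k" using c k by (simp flip: ennreal_mult)
        finally show "ennreal (1 / c) * L_norm (sobolev_conjugate \<phi>) \<Omega> u \<le> ennreal k" .
      qed
      hence "ennreal c * (ennreal (1 / c) * L_norm (sobolev_conjugate \<phi>) \<Omega> u) \<le> ennreal c * V1_0_norm \<phi> \<Omega> u"
        by (intro mult_left_mono) auto
      thus ?thesis using c by (simp add: mult.assoc[symmetric] flip: ennreal_mult)
    qed
    have UNIV_sets: "(UNIV :: (real^'n) set) \<in> sets lebesgue" by simp
    obtain k0 where k0: "k0 > 0" "modular \<phi> \<Omega> (\<lambda>x. norm (h x) / k0) < \<infinity>"
    proof -
      obtain k where k: "k > 0" "modular \<phi> UNIV (\<lambda>x. norm (G x) / k) < \<infinity>"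
        using vV by (auto simp: V1_def L_space_def G_def)
      have "modular \<phi> \<Omega> (\<lambda>x. norm (h x) / k) \<le> modular \<phi> UNIV (\<lambda>x. norm (G x) / k)"
        unfolding modular_eq[OF \<Omega>s] modular_eq[OF UNIV_sets]
      proof (rule nn_integral_mono_AE)
        show "AE x in lborel. \<phi> x \<bar>norm (h x) / k\<bar> * indicator \<Omega> x \<le> \<phi> x \<bar>norm (G x) / k\<bar> * indicator UNIV x"
          using Gh by eventually_elim (auto simp: indicator_def)
      qed
      thus thesis using k that by (auto intro: le_less_trans)
    qed
    have "\<exists>k>0. modular \<phi> \<Omega> (\<lambda>x. norm (h x) / k) \<le> 1"
    proof -
      obtain M where M: "0 \<le> M" "modular \<phi> \<Omega> (\<lambda>x. norm (h x) / k0) = ennreal M"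
        using k0(2) by (cases "modular \<phi> \<Omega> (\<lambda>x. norm (h x) / k0)") auto
      define l where "l = max 1 M"
      have l: "l \<ge> 1" "M \<le> l" by (auto simp: l_def)
      have f0: "0 \<le> norm (G' x) / k0" for x using k0 by simp
      obtain P where P [measurable]: "P \<in> borel_measurable borel" and fP: "AE x in lborel. \<phi> x (norm (G' x) / k0) = P x"
        using caratheodory_borel_version[OF gyf, of "\<lambda>x. norm (G' x) / k0"] f0 by auto
      have yf: "AE x in lborel. young_function (\<phi> x)"
        using gyf by (simp add: generalized_young_function_def AE_completion_iff)
      have \<Omega>b [measurable]: "\<Omega> \<in> sets borel" using \<Omega> by auto
      have "modular \<phi> \<Omega> (\<lambda>x. norm (h x) / (l * k0)) = (\<integral>\<^sup>+x. \<phi> x (norm (G' x) / (l * k0)) * indicator \<Omega> x \<partial>lborel)"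
        using l k0 by (intro mod_h) auto
      also have "\<dots> \<le> (\<integral>\<^sup>+x. ennreal (1 / l) * (P x * indicator \<Omega> x) \<partial>lborel)"
      proof (rule nn_integral_mono_AE)
        show "AE x in lborel. \<phi> x (norm (G' x) / (l * k0)) * indicator \<Omega> x \<le> ennreal (1 / l) * (P x * indicator \<Omega> x)"
          using yf fP
        proof eventually_elim
          case (elim x)
          have "\<phi> x (norm (G' x) / (l * k0)) = \<phi> x ((1 / l) * (norm (G' x) / k0))" by simp
          also have "\<dots> \<le> ennreal (1 / l) * \<phi> x (norm (G' x) / k0)"
            using l k0 by (intro young_scale[OF elim(1)]) auto
          finally show ?case using elim(2) by (auto simp: indicator_def)
        qed
      qed
      also have "\<dots> = ennreal (1 / l) * (\<integral>\<^sup>+x. P x * indicator \<Omega> x \<partial>lborel)"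
        by (intro nn_integral_cmult) measurable
      also have "(\<integral>\<^sup>+x. P x * indicator \<Omega> x \<partial>lborel) = (\<integral>\<^sup>+x. \<phi> x (norm (G' x) / k0) * indicator \<Omega> x \<partial>lborel)"
        using fP by (intro nn_integral_cong_AE) (auto elim!: eventually_mono)
      also have "\<dots> = ennreal M" using mod_h[OF k0(1)] M by simp
      also have "ennreal (1 / l) * ennreal M = ennreal (M / l)" using l M by (simp flip: ennreal_mult)
      also have "\<dots> \<le> ennreal 1" using l by (intro ennreal_leI) (simp add: divide_le_eq)
      finally have "modular \<phi> \<Omega> (\<lambda>x. norm (h x) / (l * k0)) \<le> 1" by simp
      thus ?thesis using l k0 by (intro exI[of _ "l * k0"]) auto
    qed
    then obtain k where k: "k > 0" "modular \<phi> \<Omega> (\<lambda>x. norm (h x) / k) \<le> 1" by blast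
    have "modular (sobolev_conjugate \<phi>) \<Omega> (\<lambda>x. u x / (c * k)) < \<infinity>"
      using key[OF k] by (auto intro: le_less_trans)
    moreover have "u \<in> borel_measurable (lebesgue_on \<Omega>)"
    proof -
      have "v \<in> borel_measurable (lebesgue_on \<Omega>)" using L1_loc_measurable[OF vL] by (rule measurable_restrict_space1)
      thus ?thesis by (subst (asm) measurable_cong[where g = u]) (auto simp: v_def)
    qed
    moreover have "c * k > 0" using c k by simp
    ultimately have "u \<in> L_space (sobolev_conjugate \<phi>) \<Omega>" unfolding L_space_def by blast
    thus ?thesis using norm_le by simp
  qed
  show "V1_0 \<phi> \<Omega> \<subseteq> L_space (sobolev_conjugate \<phi>) \<Omega> \<and>
        (\<forall>u \<in> V1_0 \<phi> \<Omega>. L_norm (sobolev_conjugate \<phi>) \<Omega> u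
             \<le> ennreal (final_const TYPE('n) \<beta> (measure lebesgue \<Omega>)) * V1_0_norm \<phi> \<Omega> u)"
    using main unfolding c_def by blast
qed


end
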